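(* Let $\Lambda$ be a finite dimensional algebra and let $$L\to M\to N\to L[1]$$ be an Auslander-Reiten triangle in $D^b(\Lambda)$. Suppose that $N$ is a truncated projective resolution of some non-projective $\Lambda$-module; thus $N$ has at most two non-zero homology groups, one in degree $0$ and possibly one more in a higher degree at the other end of the complex, and is not the shift of a projective module. Then $$0\to H_0(L)\to H_0(M)\to H_0(N)\to 0$$ is a short exact sequence of $\Lambda$-modules that is the direct sum of a split exact sequence and (possibly) an Auslander-Reiten sequence.
   Context: $D^b(\Lambda)$ is the bounded derived category of finitely generated $\Lambda$-modules; homological indexing is used. A truncated projective resolution of a module $X$ is a complex $P_n\to P_{n-1}\to\cdots\to P_0$ given by the first terms of a projective resolution of $X$, so that it is exact except possibly at the two ends and $H_0$ of it is $X$. "The shift of a projective module" means a complex with only one nonzero term, that term being projective. "(Possibly)" means that the sequence is either split, or is the direct sum of a split exact sequence and an Auslander-Reiten sequence. *)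

theory Defs
  imports Complex_Main "HOL-Algebra.Module" "HOL-Algebra.AbelCoset"
begin

section \<open>Finite dimensional algebras and their modules\<close>

locale fd_algebra = vector_space scale
  for scale :: "'k::field \<Rightarrow> 'a::ring_1 \<Rightarrow> 'a" +
  assumes mult_scale_left: "scale c x * y = scale c (x * y)"
    and mult_scale_right: "x * scale c y = scale c (x * y)"
    and finite_dim: "\<exists>B. finite B \<and> span B = UNIV"

text \<open>Modules are left modules over the (non-commutative) ring given by the type \<open>'a\<close>.
  They have explicit carriers, using the record type of HOL-Algebra, whose fields
  \<open>mult\<close> and \<open>one\<close> are irrelevant. Homomorphisms are functions that
  only matter on the carrier.\<close>

definition lmodule :: "('a::ring_1, 'm) module \<Rightarrow> bool" where
  "lmodule M \<longleftrightarrow> abelian_group M \<and>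
     (\<forall>a. \<forall>x\<in>carrier M. a \<odot>\<^bsub>M\<^esub> x \<in> carrier M) \<and>
     (\<forall>x\<in>carrier M. 1 \<odot>\<^bsub>M\<^esub> x = x) \<and>
     (\<forall>a b. \<forall>x\<in>carrier M. (a * b) \<odot>\<^bsub>M\<^esub> x = a \<odot>\<^bsub>M\<^esub> (b \<odot>\<^bsub>M\<^esub> x)) \<and>
     (\<forall>a b. \<forall>x\<in>carrier M. (a + b) \<odot>\<^bsub>M\<^esub> x = a \<odot>\<^bsub>M\<^esub> x \<oplus>\<^bsub>M\<^esub> b \<odot>\<^bsub>M\<^esub> x) \<and>
     (\<forall>a. \<forall>x\<in>carrier M. \<forall>y\<in>carrier M.
        a \<odot>\<^bsub>M\<^esub> (x \<oplus>\<^bsub>M\<^esub> y) = a \<odot>\<^bsub>M\<^esub> x \<oplus>\<^bsub>M\<^esub> a \<odot>\<^bsub>M\<^esub> y)"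

definition fg_module :: "('a::ring_1, 'm) module \<Rightarrow> bool" where
  "fg_module M \<longleftrightarrow> lmodule M \<and>
     (\<exists>S. finite S \<and> S \<subseteq> carrier M \<and>
        (\<forall>x\<in>carrier M. \<exists>c. x = finsum M (\<lambda>s. c s \<odot>\<^bsub>M\<^esub> s) S))"

definition zero_module :: "('a::ring_1, 'm) module \<Rightarrow> bool" where
  "zero_module M \<longleftrightarrow> carrier M = {\<zero>\<^bsub>M\<^esub>}"

definition mhom :: "('a::ring_1, 'm) module \<Rightarrow> ('a, 'n) module \<Rightarrow> ('m \<Rightarrow> 'n) set" where
  "mhom M N = {f. f \<in> carrier M \<rightarrow> carrier N \<and>
     (\<forall>x\<in>carrier M. \<forall>y\<in>carrier M. f (x \<oplus>\<^bsub>M\<^esub> y) = f x \<oplus>\<^bsub>N\<^esub> f y) \<and>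
     (\<forall>a. \<forall>x\<in>carrier M. f (a \<odot>\<^bsub>M\<^esub> x) = a \<odot>\<^bsub>N\<^esub> f x)}"

definition module_iso :: "('a::ring_1, 'm) module \<Rightarrow> ('a, 'n) module \<Rightarrow> bool" where
  "module_iso M N \<longleftrightarrow> (\<exists>f\<in>mhom M N. bij_betw f (carrier M) (carrier N))"

definition projective_module :: "('a::ring_1, 'm) module \<Rightarrow> bool" where
  "projective_module P \<longleftrightarrow> lmodule P \<and>
     (\<forall>(A :: ('a, 'm) module) (B :: ('a, 'm) module) g f.
        lmodule A \<and> lmodule B \<and> g \<in> mhom A B \<and> g ` carrier A = carrier B \<and> f \<in> mhom P B \<longrightarrow>
        (\<exists>h\<in>mhom P A. \<forall>x\<in>carrier P. g (h x) = f x))"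

text \<open>\<open>M = M1 \<oplus> M2\<close> with coprojections \<open>i1\<close> and \<open>i2\<close>.\<close>

definition is_direct_sum ::
  "('a::ring_1, 'm) module \<Rightarrow> ('a, 'm) module \<Rightarrow> ('m \<Rightarrow> 'm) \<Rightarrow> ('a, 'm) module \<Rightarrow> ('m \<Rightarrow> 'm) \<Rightarrow> bool" where
  "is_direct_sum M M1 i1 M2 i2 \<longleftrightarrow> i1 \<in> mhom M1 M \<and> i2 \<in> mhom M2 M \<and>
     bij_betw (\<lambda>(x, y). i1 x \<oplus>\<^bsub>M\<^esub> i2 y) (carrier M1 \<times> carrier M2) (carrier M)"


section \<open>Short exact sequences and Auslander-Reiten sequences of modules\<close>

definition short_exact ::
  "('a::ring_1, 'm) module \<Rightarrow> ('m \<Rightarrow> 'm) \<Rightarrow> ('a, 'm) module \<Rightarrow> ('m \<Rightarrow> 'm) \<Rightarrow> ('a, 'm) module \<Rightarrow> bool" where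
  "short_exact A f B g C \<longleftrightarrow> fg_module A \<and> fg_module B \<and> fg_module C \<and>
     f \<in> mhom A B \<and> g \<in> mhom B C \<and>
     inj_on f (carrier A) \<and> f ` carrier A = {y\<in>carrier B. g y = \<zero>\<^bsub>C\<^esub>} \<and>
     g ` carrier B = carrier C"

definition split_mono :: "('a::ring_1, 'm) module \<Rightarrow> ('a, 'm) module \<Rightarrow> ('m \<Rightarrow> 'm) \<Rightarrow> bool" where
  "split_mono A B f \<longleftrightarrow> f \<in> mhom A B \<and> (\<exists>r\<in>mhom B A. \<forall>x\<in>carrier A. r (f x) = x)"

definition split_epi :: "('a::ring_1, 'm) module \<Rightarrow> ('a, 'm) module \<Rightarrow> ('m \<Rightarrow> 'm) \<Rightarrow> bool" where
  "split_epi B C g \<longleftrightarrow> g \<in> mhom B C \<and> (\<exists>s\<in>mhom C B. \<forall>x\<in>carrier C. g (s x) = x)"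

definition split_exact ::
  "('a::ring_1, 'm) module \<Rightarrow> ('m \<Rightarrow> 'm) \<Rightarrow> ('a, 'm) module \<Rightarrow> ('m \<Rightarrow> 'm) \<Rightarrow> ('a, 'm) module \<Rightarrow> bool" where
  "split_exact A f B g C \<longleftrightarrow> short_exact A f B g C \<and> split_epi B C g"

definition left_almost_split ::
  "('a::ring_1, 'm) module \<Rightarrow> ('a, 'm) module \<Rightarrow> ('m \<Rightarrow> 'm) \<Rightarrow> bool" where
  "left_almost_split A B f \<longleftrightarrow> f \<in> mhom A B \<and> \<not> split_mono A B f \<and>
     (\<forall>(Y :: ('a, 'm) module) h. fg_module Y \<and> h \<in> mhom A Y \<and> \<not> split_mono A Y h \<longrightarrow>
        (\<exists>h'\<in>mhom B Y. \<forall>x\<in>carrier A. h' (f x) = h x))"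

definition right_almost_split ::
  "('a::ring_1, 'm) module \<Rightarrow> ('a, 'm) module \<Rightarrow> ('m \<Rightarrow> 'm) \<Rightarrow> bool" where
  "right_almost_split B C g \<longleftrightarrow> g \<in> mhom B C \<and> \<not> split_epi B C g \<and>
     (\<forall>(Y :: ('a, 'm) module) h. fg_module Y \<and> h \<in> mhom Y C \<and> \<not> split_epi Y C h \<longrightarrow>
        (\<exists>h'\<in>mhom Y B. \<forall>x\<in>carrier Y. g (h' x) = h x))"

definition AR_sequence ::
  "('a::ring_1, 'm) module \<Rightarrow> ('m \<Rightarrow> 'm) \<Rightarrow> ('a, 'm) module \<Rightarrow> ('m \<Rightarrow> 'm) \<Rightarrow> ('a, 'm) module \<Rightarrow> bool" where
  "AR_sequence A f B g C \<longleftrightarrow>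
     short_exact A f B g C \<and> left_almost_split A B f \<and> right_almost_split B C g"

definition sum_of_split_and_AR ::
  "('a::ring_1, 'm) module \<Rightarrow> ('m \<Rightarrow> 'm) \<Rightarrow> ('a, 'm) module \<Rightarrow> ('m \<Rightarrow> 'm) \<Rightarrow> ('a, 'm) module \<Rightarrow> bool" where
  "sum_of_split_and_AR A f B g C \<longleftrightarrow>
     (\<exists>A1 f1 B1 g1 C1 A2 f2 B2 g2 C2 a1 a2 b1 b2 c1 c2.
        split_exact A1 f1 B1 g1 C1 \<and> AR_sequence A2 f2 B2 g2 C2 \<and>
        is_direct_sum A A1 a1 A2 a2 \<and> is_direct_sum B B1 b1 B2 b2 \<and> is_direct_sum C C1 c1 C2 c2 \<and>
        (\<forall>x\<in>carrier A1. f (a1 x) = b1 (f1 x)) \<and> (\<forall>x\<in>carrier A2. f (a2 x) = b2 (f2 x)) \<and>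
        (\<forall>y\<in>carrier B1. g (b1 y) = c1 (g1 y)) \<and> (\<forall>y\<in>carrier B2. g (b2 y) = c2 (g2 y)))"


section \<open>Complexes\<close>

text \<open>Homological indexing: \<open>bd X i\<close> maps \<open>ob X i\<close> to \<open>ob X (i - 1)\<close>.\<close>

record ('a, 'm) cplx =
  ob :: "int \<Rightarrow> ('a, 'm) module"
  bd :: "int \<Rightarrow> 'm \<Rightarrow> 'm"

type_synonym 'm graded_map = "int \<Rightarrow> 'm \<Rightarrow> 'm"

definition chain_complex :: "('a::ring_1, 'm) cplx \<Rightarrow> bool" where
  "chain_complex X \<longleftrightarrow> (\<forall>i. lmodule (ob X i) \<and> bd X i \<in> mhom (ob X i) (ob X (i - 1)) \<and>
     (\<forall>x\<in>carrier (ob X i). bd X (i - 1) (bd X i x) = \<zero>\<^bsub>ob X (i - 2)\<^esub>))"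

definition bounded_complex :: "('a::ring_1, 'm) cplx \<Rightarrow> bool" where
  "bounded_complex X \<longleftrightarrow> chain_complex X \<and> (\<forall>i. fg_module (ob X i)) \<and>
     (\<exists>n. \<forall>i. \<bar>i\<bar> > n \<longrightarrow> zero_module (ob X i))"

definition chain_map :: "('a::ring_1, 'm) cplx \<Rightarrow> ('a, 'm) cplx \<Rightarrow> 'm graded_map \<Rightarrow> bool" where
  "chain_map X Y f \<longleftrightarrow> (\<forall>i. f i \<in> mhom (ob X i) (ob Y i) \<and>
     (\<forall>x\<in>carrier (ob X i). bd Y i (f i x) = f (i - 1) (bd X i x)))"

definition id_map :: "'m graded_map" where
  "id_map = (\<lambda>i x. x)"

definition comp_map :: "'m graded_map \<Rightarrow> 'm graded_map \<Rightarrow> 'm graded_map" where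
  "comp_map g f = (\<lambda>i x. g i (f i x))"

definition homotopic :: "('a::ring_1, 'm) cplx \<Rightarrow> ('a, 'm) cplx \<Rightarrow> 'm graded_map \<Rightarrow> 'm graded_map \<Rightarrow> bool" where
  "homotopic X Y f g \<longleftrightarrow> (\<exists>s. \<forall>i. s i \<in> mhom (ob X i) (ob Y (i + 1)) \<and>
     (\<forall>x\<in>carrier (ob X i).
        f i x = g i x \<oplus>\<^bsub>ob Y i\<^esub> (bd Y (i + 1) (s i x) \<oplus>\<^bsub>ob Y i\<^esub> s (i - 1) (bd X i x))))"

text \<open>Homology is the quotient module of cycles by boundaries; its elements are cosets.\<close>

definition cycles :: "('a::ring_1, 'm) cplx \<Rightarrow> int \<Rightarrow> 'm set" where
  "cycles X i = {x\<in>carrier (ob X i). bd X i x = \<zero>\<^bsub>ob X (i - 1)\<^esub>}"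

definition boundaries :: "('a::ring_1, 'm) cplx \<Rightarrow> int \<Rightarrow> 'm set" where
  "boundaries X i = bd X (i + 1) ` carrier (ob X (i + 1))"

definition homology :: "('a::ring_1, 'm) cplx \<Rightarrow> int \<Rightarrow> ('a, 'm set) module" where
  "homology X i =
     \<lparr>carrier = (\<lambda>x. boundaries X i +>\<^bsub>ob X i\<^esub> x) ` cycles X i,
      mult = undefined, one = undefined,
      zero = boundaries X i,
      add = (\<lambda>S T. S <+>\<^bsub>ob X i\<^esub> T),
      smult = (\<lambda>a S. boundaries X i <+>\<^bsub>ob X i\<^esub> ((\<lambda>x. a \<odot>\<^bsub>ob X i\<^esub> x) ` S))\<rparr>"

definition homology_map :: "('a::ring_1, 'm) cplx \<Rightarrow> int \<Rightarrow> 'm graded_map \<Rightarrow> 'm set \<Rightarrow> 'm set" where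
  "homology_map Y i f S = boundaries Y i <+>\<^bsub>ob Y i\<^esub> (f i ` S)"

definition quasi_iso :: "('a::ring_1, 'm) cplx \<Rightarrow> ('a, 'm) cplx \<Rightarrow> 'm graded_map \<Rightarrow> bool" where
  "quasi_iso X Y f \<longleftrightarrow> chain_map X Y f \<and>
     (\<forall>i. bij_betw (homology_map Y i f) (carrier (homology X i)) (carrier (homology Y i)))"

definition shift :: "('a::ring_1, 'm) cplx \<Rightarrow> ('a, 'm) cplx" where
  "shift X = \<lparr>ob = (\<lambda>i. ob X (i - 1)),
              bd = (\<lambda>i x. \<ominus>\<^bsub>ob X (i - 2)\<^esub> bd X (i - 1) x)\<rparr>"

text \<open>\<open>C\<close> is a mapping cone of \<open>u: X \<rightarrow> Y\<close>, i.e. \<open>C i = X (i - 1) \<oplus> Y i\<close> with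
  \<open>d (x, y) = (- d x, u x + d y)\<close>, and \<open>\<iota>: Y \<rightarrow> C\<close> and \<open>\<pi>: C \<rightarrow> X[1]\<close> are the
  inclusion and the projection. The cone is described up to isomorphism so that its terms
  can live on the same type as those of \<open>X\<close> and \<open>Y\<close>.\<close>

definition is_cone ::
  "('a::ring_1, 'm) cplx \<Rightarrow> ('a, 'm) cplx \<Rightarrow> 'm graded_map \<Rightarrow>
   ('a, 'm) cplx \<Rightarrow> 'm graded_map \<Rightarrow> 'm graded_map \<Rightarrow> bool" where
  "is_cone X Y u C \<iota> \<pi> \<longleftrightarrow> chain_map X Y u \<and> chain_map Y C \<iota> \<and> chain_map C (shift X) \<pi> \<and>
     (\<exists>\<sigma>. \<forall>i. is_direct_sum (ob C i) (ob X (i - 1)) (\<sigma> i) (ob Y i) (\<iota> i) \<and>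
        (\<forall>x\<in>carrier (ob X (i - 1)).
           bd C i (\<sigma> i x) =
             \<sigma> (i - 1) (\<ominus>\<^bsub>ob X (i - 2)\<^esub> bd X (i - 1) x) \<oplus>\<^bsub>ob C (i - 1)\<^esub> \<iota> (i - 1) (u (i - 1) x)) \<and>
        (\<forall>x\<in>carrier (ob X (i - 1)). \<pi> i (\<sigma> i x) = x) \<and>
        (\<forall>y\<in>carrier (ob Y i). \<pi> i (\<iota> i y) = \<zero>\<^bsub>ob X (i - 1)\<^esub>))"


section \<open>The bounded derived category\<close>

text \<open>The localisation at the quasi-isomorphisms of the homotopy category of bounded complexes of
  finitely generated modules, by calculus of fractions: a morphism from \<open>X\<close> to \<open>Y\<close>
  is an equivalence class of roofs \<open>X \<leftarrow> Z \<rightarrow> Y\<close> whose left leg is a quasi-isomorphism.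
  All complexes, including the apices of roofs and the test objects below, have terms on one type
  \<open>'m\<close>; for this to be the whole derived category, \<open>'m\<close> must be large enough
  to carry a copy of every finitely generated module.\<close>

record ('a, 'm) roof =
  src :: "('a, 'm) cplx"
  apex :: "('a, 'm) cplx"
  tgt :: "('a, 'm) cplx"
  lleg :: "'m graded_map"
  rleg :: "'m graded_map"

definition is_roof :: "('a::ring_1, 'm) roof \<Rightarrow> bool" where
  "is_roof r \<longleftrightarrow> bounded_complex (src r) \<and> bounded_complex (apex r) \<and> bounded_complex (tgt r) \<and>
     quasi_iso (apex r) (src r) (lleg r) \<and> chain_map (apex r) (tgt r) (rleg r)"

definition roofs :: "('a::ring_1, 'm) cplx \<Rightarrow> ('a, 'm) cplx \<Rightarrow> ('a, 'm) roof set" where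
  "roofs X Y = {r. is_roof r \<and> src r = X \<and> tgt r = Y}"

definition roof_rel :: "(('a::ring_1, 'm) roof \<times> ('a, 'm) roof) set" where
  "roof_rel = {(r, q). is_roof r \<and> is_roof q \<and> src r = src q \<and> tgt r = tgt q \<and>
     (\<exists>W t t'. bounded_complex W \<and> chain_map W (apex r) t \<and> chain_map W (apex q) t' \<and>
        quasi_iso W (src r) (comp_map (lleg r) t) \<and>
        homotopic W (src r) (comp_map (lleg r) t) (comp_map (lleg q) t') \<and>
        homotopic W (tgt r) (comp_map (rleg r) t) (comp_map (rleg q) t'))}"

definition DHom :: "('a::ring_1, 'm) cplx \<Rightarrow> ('a, 'm) cplx \<Rightarrow> ('a, 'm) roof set set" where
  "DHom X Y = roofs X Y // (roof_rel \<inter> roofs X Y \<times> roofs X Y)"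

definition DQ :: "('a::ring_1, 'm) cplx \<Rightarrow> ('a, 'm) cplx \<Rightarrow> 'm graded_map \<Rightarrow> ('a, 'm) roof set" where
  "DQ X Y f = roof_rel `` {\<lparr>src = X, apex = X, tgt = Y, lleg = id_map, rleg = f\<rparr>}"

definition Did :: "('a::ring_1, 'm) cplx \<Rightarrow> ('a, 'm) roof set" where
  "Did X = DQ X X id_map"

definition Dzero :: "('a::ring_1, 'm) cplx \<Rightarrow> ('a, 'm) cplx \<Rightarrow> ('a, 'm) roof set" where
  "Dzero X Y = DQ X Y (\<lambda>i x. \<zero>\<^bsub>ob Y i\<^esub>)"

text \<open>Composition: complete the right leg of a roof in \<open>\<alpha>\<close> and the left leg of a roof in
  \<open>\<beta>\<close> to a square commuting up to homotopy.\<close>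

definition Dcomp :: "('a::ring_1, 'm) roof set \<Rightarrow> ('a, 'm) roof set \<Rightarrow> ('a, 'm) roof set" where
  "Dcomp \<beta> \<alpha> = {\<rho>. \<exists>r\<in>\<alpha>. \<exists>q\<in>\<beta>. \<exists>W t h. tgt r = src q \<and> bounded_complex W \<and>
     quasi_iso W (apex r) t \<and> chain_map W (apex q) h \<and>
     homotopic W (tgt r) (comp_map (rleg r) t) (comp_map (lleg q) h) \<and>
     (\<lparr>src = src r, apex = W, tgt = tgt q,
       lleg = comp_map (lleg r) t, rleg = comp_map (rleg q) h\<rparr>, \<rho>) \<in> roof_rel}"

text \<open>Addition: add the right legs of representatives with a common left leg.\<close>

definition Dadd :: "('a::ring_1, 'm) roof set \<Rightarrow> ('a, 'm) roof set \<Rightarrow> ('a, 'm) roof set" where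
  "Dadd \<alpha> \<beta> = {\<rho>. \<exists>r\<in>\<alpha>. \<exists>q\<in>\<beta>.
     src q = src r \<and> apex q = apex r \<and> tgt q = tgt r \<and> lleg q = lleg r \<and>
     (r\<lparr>rleg := (\<lambda>i x. rleg r i x \<oplus>\<^bsub>ob (tgt r) i\<^esub> rleg q i x)\<rparr>, \<rho>) \<in> roof_rel}"

definition Dshift :: "('a::ring_1, 'm) roof set \<Rightarrow> ('a, 'm) roof set" where
  "Dshift \<alpha> = {\<rho>. \<exists>r\<in>\<alpha>.
     (\<lparr>src = shift (src r), apex = shift (apex r), tgt = shift (tgt r),
       lleg = (\<lambda>i. lleg r (i - 1)), rleg = (\<lambda>i. rleg r (i - 1))\<rparr>, \<rho>) \<in> roof_rel}"

text \<open>The map induced on homology by (any representative of) a morphism of the derived category.\<close>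

definition Dhomology_map :: "int \<Rightarrow> ('a::ring_1, 'm) roof set \<Rightarrow> 'm set \<Rightarrow> 'm set" where
  "Dhomology_map i \<alpha> =
     (let r = (SOME r. r \<in> \<alpha>)
      in (\<lambda>S. homology_map (tgt r) i (rleg r)
            (the_inv_into (carrier (homology (apex r) i)) (homology_map (src r) i (lleg r)) S)))"

definition Dsplit_epi :: "('a::ring_1, 'm) cplx \<Rightarrow> ('a, 'm) cplx \<Rightarrow> ('a, 'm) roof set \<Rightarrow> bool" where
  "Dsplit_epi X Y \<alpha> \<longleftrightarrow> (\<exists>\<beta>\<in>DHom Y X. Dcomp \<alpha> \<beta> = Did Y)"

definition Diso :: "('a::ring_1, 'm) cplx \<Rightarrow> ('a, 'm) cplx \<Rightarrow> ('a, 'm) roof set \<Rightarrow> bool" where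
  "Diso X Y \<alpha> \<longleftrightarrow> \<alpha> \<in> DHom X Y \<and> (\<exists>\<beta>\<in>DHom Y X. Dcomp \<beta> \<alpha> = Did X \<and> Dcomp \<alpha> \<beta> = Did Y)"

definition Dbiproduct :: "('a::ring_1, 'm) cplx \<Rightarrow> ('a, 'm) cplx \<Rightarrow> ('a, 'm) cplx \<Rightarrow> bool" where
  "Dbiproduct X A B \<longleftrightarrow> (\<exists>i1\<in>DHom A X. \<exists>i2\<in>DHom B X. \<exists>p1\<in>DHom X A. \<exists>p2\<in>DHom X B.
     Dcomp p1 i1 = Did A \<and> Dcomp p2 i2 = Did B \<and>
     Dcomp p1 i2 = Dzero B A \<and> Dcomp p2 i1 = Dzero A B \<and>
     Dadd (Dcomp i1 p1) (Dcomp i2 p2) = Did X)"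

definition Dzero_object :: "('a::ring_1, 'm) cplx \<Rightarrow> bool" where
  "Dzero_object X \<longleftrightarrow> Did X = Dzero X X"

definition Dindecomposable :: "('a::ring_1, 'm) cplx \<Rightarrow> bool" where
  "Dindecomposable X \<longleftrightarrow> \<not> Dzero_object X \<and>
     (\<forall>A B. bounded_complex A \<and> bounded_complex B \<and> Dbiproduct X A B \<longrightarrow>
        Dzero_object A \<or> Dzero_object B)"

definition distinguished_triangle ::
  "('a::ring_1, 'm) cplx \<Rightarrow> ('a, 'm) cplx \<Rightarrow> ('a, 'm) cplx \<Rightarrow>
   ('a, 'm) roof set \<Rightarrow> ('a, 'm) roof set \<Rightarrow> ('a, 'm) roof set \<Rightarrow> bool" where
  "distinguished_triangle L M N u v w \<longleftrightarrow>
     u \<in> DHom L M \<and> v \<in> DHom M N \<and> w \<in> DHom N (shift L) \<and>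
     (\<exists>X Y C f \<iota> \<pi> a b c.
        bounded_complex X \<and> bounded_complex Y \<and> bounded_complex C \<and> is_cone X Y f C \<iota> \<pi> \<and>
        Diso L X a \<and> Diso M Y b \<and> Diso N C c \<and>
        Dcomp b u = Dcomp (DQ X Y f) a \<and>
        Dcomp c v = Dcomp (DQ Y C \<iota>) b \<and>
        Dcomp (Dshift a) w = Dcomp (DQ C (shift X) \<pi>) c)"

definition AR_triangle ::
  "('a::ring_1, 'm) cplx \<Rightarrow> ('a, 'm) cplx \<Rightarrow> ('a, 'm) cplx \<Rightarrow>
   ('a, 'm) roof set \<Rightarrow> ('a, 'm) roof set \<Rightarrow> ('a, 'm) roof set \<Rightarrow> bool" where
  "AR_triangle L M N u v w \<longleftrightarrow> distinguished_triangle L M N u v w \<and>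
     Dindecomposable L \<and> Dindecomposable N \<and> w \<noteq> Dzero N (shift L) \<and>
     (\<forall>W f. bounded_complex W \<and> f \<in> DHom W N \<and> \<not> Dsplit_epi W N f \<longrightarrow>
        (\<exists>f'\<in>DHom W M. Dcomp v f' = f))"


section \<open>Truncated projective resolutions\<close>

definition projective_resolution :: "('a::ring_1, 'm) cplx \<Rightarrow> ('a, 'm) module \<Rightarrow> bool" where
  "projective_resolution P X \<longleftrightarrow> chain_complex P \<and>
     (\<forall>i. fg_module (ob P i) \<and> projective_module (ob P i)) \<and>
     (\<forall>i<0. zero_module (ob P i)) \<and>
     (\<forall>i. i \<noteq> 0 \<longrightarrow> zero_module (homology P i)) \<and>
     module_iso (homology P 0) X"

text \<open>The last conjunct follows from the others unless \<open>n = 0\<close>, where it forces \<open>X\<close>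
  to be projective.\<close>

definition truncated_projective_resolution :: "('a::ring_1, 'm) cplx \<Rightarrow> ('a, 'm) module \<Rightarrow> bool" where
  "truncated_projective_resolution N X \<longleftrightarrow> bounded_complex N \<and>
     (\<exists>P n. projective_resolution P X \<and> n \<ge> 0 \<and>
        (\<forall>i. 0 \<le> i \<and> i \<le> n \<longrightarrow> ob N i = ob P i) \<and>
        (\<forall>i. 1 \<le> i \<and> i \<le> n \<longrightarrow> (\<forall>x\<in>carrier (ob P i). bd N i x = bd P i x)) \<and>
        (\<forall>i. i < 0 \<or> i > n \<longrightarrow> zero_module (ob N i))) \<and>
     module_iso (homology N 0) X"

end

theory Submission
  imports Defs
begin

text \<open>Everything rests on one lifting property. Given a
  homomorphism \<open>h: Y \<rightarrow> H\<^sub>0(N)\<close>, replacing \<open>N\<^sub>0\<close> by its pullback along \<open>h\<close> gives a complex \<open>W\<close> with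
  \<open>H\<^sub>0(W) = Y\<close> and a map \<open>W \<rightarrow> N\<close> that induces \<open>h\<close> on \<open>H\<^sub>0\<close> and a surjection on \<open>H\<^sub>1\<close>. If \<open>h\<close> is not
  a split epimorphism, then neither is \<open>W \<rightarrow> N\<close>, so it factors through \<open>M\<close>, and hence \<open>h\<close> factors through
  \<open>H\<^sub>0(M)\<close> and \<open>H\<^sub>1(M) \<rightarrow> H\<^sub>1(N)\<close> is surjective. No map \<open>\<Lambda> \<rightarrow> H\<^sub>0(N)\<close> is a split epimorphism, as \<open>X\<close> is not
  projective; with \<open>Y = \<Lambda>\<close> the long exact homology sequence therefore breaks into the short exact sequence.
  With arbitrary \<open>Y\<close>, its right-hand map \<open>g\<close> is right almost split unless it splits. Splitting off a summand of
  \<open>H\<^sub>0(M)\<close> inside the kernel of \<open>g\<close> makes \<open>g\<close> right minimal, and a pushout argument shows that what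
  remains is an Auslander-Reiten sequence.\<close>

section \<open>Modules\<close>

text \<open>Two obstacles shape the proof. Projectivity, almost split maps and Auslander-Reiten
  triangles are tested on modules or complexes over one type, while pullbacks, pushouts and homotopy
  pullbacks live on product and quotient types. Each such construction is therefore moved back by an
  isomorphic copy, which exists because elements of a finitely generated module are coded by finite
  lists of scalars. Secondly, morphisms of the derived category are sets of roofs. What has to be
  known of them is that homology is well defined on classes and respects composition; the Ore
  condition guarantees that composites are nonempty, without which an equation between them would
  carry no information. Exactness is obtained by chasing elements in a mapping cone, with
  surjectivity on H_1 in place of a connecting map. The triangle gives lifting only on the right;
  left almost splitness is forced by right minimality. A length function on submodules serves twice:
  submodules of finitely generated modules are finitely generated, and a right minimal summand
  exists by maximising, with no appeal to unique decompositions.\<close>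

lemma lmoduleD:
  fixes M :: "('a::ring_1, 'm) module" (structure)
  assumes "lmodule M"
  shows "abelian_group M"
    and "x \<in> carrier M \<Longrightarrow> a \<odot> x \<in> carrier M"
    and "x \<in> carrier M \<Longrightarrow> 1 \<odot> x = x"
    and "x \<in> carrier M \<Longrightarrow> (a * b) \<odot> x = a \<odot> (b \<odot> x)"
    and "x \<in> carrier M \<Longrightarrow> (a + b) \<odot> x = a \<odot> x \<oplus> b \<odot> x"
    and "x \<in> carrier M \<Longrightarrow> y \<in> carrier M \<Longrightarrow>
      a \<odot> (x \<oplus> y) = a \<odot> x \<oplus> a \<odot> y"
  using assms by (auto simp: lmodule_def)

lemma lmodule_group:
  fixes M :: "('a::ring_1, 'm) module" (structure)
  assumes "lmodule M"
  shows "\<zero> \<in> carrier M"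
    and "x \<in> carrier M \<Longrightarrow> y \<in> carrier M \<Longrightarrow> x \<oplus> y \<in> carrier M"
    and "x \<in> carrier M \<Longrightarrow> \<ominus> x \<in> carrier M"
    and "x \<in> carrier M \<Longrightarrow> \<zero> \<oplus> x = x"
    and "x \<in> carrier M \<Longrightarrow> x \<oplus> \<zero> = x"
    and "x \<in> carrier M \<Longrightarrow> x \<oplus> \<ominus> x = \<zero>"
    and "x \<in> carrier M \<Longrightarrow> \<ominus> x \<oplus> x = \<zero>"
    and "x \<in> carrier M \<Longrightarrow> y \<in> carrier M \<Longrightarrow> x \<oplus> (\<ominus> x \<oplus> y) = y"
    and "x \<in> carrier M \<Longrightarrow> y \<in> carrier M \<Longrightarrow> \<ominus> x \<oplus> (x \<oplus> y) = y"
    and "x \<in> carrier M \<Longrightarrow> \<ominus> (\<ominus> x) = x"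
    and "\<ominus> \<zero> = \<zero>"
    and "x \<in> carrier M \<Longrightarrow> y \<in> carrier M \<Longrightarrow> \<ominus> (x \<oplus> y) = \<ominus> x \<oplus> \<ominus> y"
    and "x \<ominus> y = x \<oplus> \<ominus> y"
  using assms[THEN lmoduleD(1)] abelian_group.axioms(1)[OF assms[THEN lmoduleD(1)]]
    abelian_group.minus_equality[of M "\<zero>" "\<zero>"]
  by (simp_all add: abelian_monoid.zero_closed abelian_monoid.a_closed abelian_group.a_inv_closed
      abelian_monoid.l_zero abelian_monoid.r_zero abelian_group.r_neg abelian_group.l_neg
      abelian_group.r_neg1 abelian_group.r_neg2 abelian_group.minus_minus abelian_group.minus_add
      abelian_group.minus_eq)

lemma lmodule_ac:
  fixes M :: "('a::ring_1, 'm) module" (structure)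
  assumes "lmodule M" "x \<in> carrier M" "y \<in> carrier M"
  shows "x \<oplus> y = y \<oplus> x"
    and "z \<in> carrier M \<Longrightarrow> x \<oplus> y \<oplus> z = x \<oplus> (y \<oplus> z)"
    and "z \<in> carrier M \<Longrightarrow> x \<oplus> (y \<oplus> z) = y \<oplus> (x \<oplus> z)"
  using abelian_monoid.a_ac[OF abelian_group.axioms(1)[OF lmoduleD(1)[OF assms(1)]]] assms by simp_all

lemma lmodule_cancel:
  assumes "lmodule M" "x \<in> carrier M" "y \<in> carrier M" "z \<in> carrier M"
  shows "x \<oplus>\<^bsub>M\<^esub> y = x \<oplus>\<^bsub>M\<^esub> z \<longleftrightarrow> y = z" and "y \<oplus>\<^bsub>M\<^esub> x = z \<oplus>\<^bsub>M\<^esub> x \<longleftrightarrow> y = z"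
  using lmodule_group(9)[OF assms(1)] assms lmodule_ac(1)[OF assms(1)] by metis+

lemma lmodule_smult_zero:
  fixes M :: "('a::ring_1, 'm) module" (structure)
  assumes M: "lmodule M"
  shows "a \<odot> \<zero> = \<zero>" and "x \<in> carrier M \<Longrightarrow> 0 \<odot> x = \<zero>"
proof -
  have idem: "y = \<zero>" if "y \<oplus> y = y" "y \<in> carrier M" for y
    using that lmodule_cancel(1)[OF M, of y y "\<zero>"] lmodule_group[OF M] by simp
  show "a \<odot> \<zero> = \<zero>"
    by (rule idem) (metis lmoduleD(2,6)[OF M] lmodule_group(1,4)[OF M])+
  assume x: "x \<in> carrier M"
  show "0 \<odot> x = \<zero>"
    by (rule idem) (use x lmoduleD(2)[OF M x] lmoduleD(5)[OF M x, of 0 0] in auto)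
qed

lemma lmodule_smult_neg:
  fixes M :: "('a::ring_1, 'm) module" (structure)
  assumes M: "lmodule M" and x: "x \<in> carrier M"
  shows "(- a) \<odot> x = \<ominus> (a \<odot> x)" and "a \<odot> (\<ominus> x) = \<ominus> (a \<odot> x)"
proof -
  interpret abelian_group M using M by (rule lmoduleD)
  show "(- a) \<odot> x = \<ominus> (a \<odot> x)"
    by (rule minus_equality[symmetric])
      (use x M lmoduleD(5)[OF M x, of "-a" a] in \<open>auto simp: lmoduleD lmodule_smult_zero\<close>)
  show "a \<odot> (\<ominus> x) = \<ominus> (a \<odot> x)"
    by (rule minus_equality[symmetric])
      (use x M lmoduleD(6)[OF M, of "\<ominus> x" x] in
        \<open>auto simp: lmoduleD lmodule_smult_zero l_neg lmodule_group\<close>)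
qed

lemma lmodule_diff_zero_iff:
  assumes M: "lmodule M" and "x \<in> carrier M" "y \<in> carrier M"
  shows "x \<oplus>\<^bsub>M\<^esub> \<ominus>\<^bsub>M\<^esub> y = \<zero>\<^bsub>M\<^esub> \<longleftrightarrow> x = y"
  using assms lmodule_cancel(2)[OF M, of "\<ominus>\<^bsub>M\<^esub> y" x y] lmodule_group[OF M] by auto

text \<open>AC normalisation may separate a term from its negative; these rules cancel the pairs.\<close>

lemma lmodule_cancel_simps:
  fixes M :: "('a::ring_1, 'm) module" (structure)
  assumes M: "lmodule M" and c: "x \<in> carrier M" "y \<in> carrier M"
  shows "x \<oplus> (y \<oplus> \<ominus> x) = y"
    and "z \<in> carrier M \<Longrightarrow> x \<oplus> (y \<oplus> (\<ominus> x \<oplus> z)) = y \<oplus> z"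
    and "z \<in> carrier M \<Longrightarrow> x \<oplus> (y \<oplus> (z \<oplus> \<ominus> x)) = y \<oplus> z"
    and "\<ominus> x \<oplus> (y \<oplus> x) = y"
    and "z \<in> carrier M \<Longrightarrow> \<ominus> x \<oplus> (y \<oplus> (x \<oplus> z)) = y \<oplus> z"
    and "z \<in> carrier M \<Longrightarrow> \<ominus> x \<oplus> (y \<oplus> (z \<oplus> x)) = y \<oplus> z"
  using lmodule_group[OF M] lmodule_ac(3)[OF M, of x y] lmodule_ac(3)[OF M, of "\<ominus> x" y]
    lmodule_ac(3)[OF M, of x z] lmodule_ac(3)[OF M, of "\<ominus> x" z] c by simp_all

lemmas lmodule_simps = lmodule_group lmodule_ac lmodule_cancel_simps lmoduleD(2-) lmodule_smult_zero lmodule_smult_neg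

text \<open>With \<open>0 \<odot> x = \<zero>\<close> among the premises,
  \<open>(-1) \<odot> x\<close> is an additive inverse, so the products, subquotients and copies
  built below never have to exhibit negatives.\<close>

lemma lmoduleI:
  fixes M :: "('a::ring_1, 'm) module" (structure)
  assumes "\<And>x y. x \<in> carrier M \<Longrightarrow> y \<in> carrier M \<Longrightarrow> x \<oplus> y \<in> carrier M"
    and "\<zero> \<in> carrier M"
    and "\<And>x y z. x \<in> carrier M \<Longrightarrow> y \<in> carrier M \<Longrightarrow> z \<in> carrier M \<Longrightarrow>
      (x \<oplus> y) \<oplus> z = x \<oplus> (y \<oplus> z)"
    and "\<And>x y. x \<in> carrier M \<Longrightarrow> y \<in> carrier M \<Longrightarrow> x \<oplus> y = y \<oplus> x"
    and "\<And>x. x \<in> carrier M \<Longrightarrow> \<zero> \<oplus> x = x"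
    and "\<And>a x. x \<in> carrier M \<Longrightarrow> a \<odot> x \<in> carrier M"
    and "\<And>x. x \<in> carrier M \<Longrightarrow> 1 \<odot> x = x"
    and "\<And>a b x. x \<in> carrier M \<Longrightarrow> (a * b) \<odot> x = a \<odot> (b \<odot> x)"
    and "\<And>a b x. x \<in> carrier M \<Longrightarrow> (a + b) \<odot> x = a \<odot> x \<oplus> b \<odot> x"
    and "\<And>a x y. x \<in> carrier M \<Longrightarrow> y \<in> carrier M \<Longrightarrow>
        a \<odot> (x \<oplus> y) = a \<odot> x \<oplus> a \<odot> y"
    and zero: "\<And>x. x \<in> carrier M \<Longrightarrow> 0 \<odot> x = \<zero>"
  shows "lmodule M"
proof -
  have "abelian_group M"
  proof (rule abelian_groupI)
    fix x assume x: "x \<in> carrier M"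
    have "(-1) \<odot> x \<oplus> x = \<zero>"
      using assms(9)[OF x, of "-1" 1] assms(7)[OF x] zero[OF x] by simp
    then show "\<exists>y\<in>carrier M. y \<oplus> x = \<zero>" using assms(6)[OF x] by blast
  qed (use assms in auto)
  then show ?thesis using assms by (auto simp: lmodule_def)
qed

lemma fg_lmodule: "fg_module M \<Longrightarrow> lmodule M"
  by (simp add: fg_module_def)


subsection \<open>Homomorphisms\<close>

lemma mhomD:
  assumes "f \<in> mhom M N"
  shows "x \<in> carrier M \<Longrightarrow> f x \<in> carrier N"
    and "x \<in> carrier M \<Longrightarrow> y \<in> carrier M \<Longrightarrow> f (x \<oplus>\<^bsub>M\<^esub> y) = f x \<oplus>\<^bsub>N\<^esub> f y"
    and "x \<in> carrier M \<Longrightarrow> f (a \<odot>\<^bsub>M\<^esub> x) = a \<odot>\<^bsub>N\<^esub> f x"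
  using assms by (auto simp: mhom_def)

lemma mhomI:
  assumes "\<And>x. x \<in> carrier M \<Longrightarrow> f x \<in> carrier N"
    and "\<And>x y. x \<in> carrier M \<Longrightarrow> y \<in> carrier M \<Longrightarrow> f (x \<oplus>\<^bsub>M\<^esub> y) = f x \<oplus>\<^bsub>N\<^esub> f y"
    and "\<And>a x. x \<in> carrier M \<Longrightarrow> f (a \<odot>\<^bsub>M\<^esub> x) = a \<odot>\<^bsub>N\<^esub> f x"
  shows "f \<in> mhom M N"
  using assms by (auto simp: mhom_def)

lemma mhom_zero:
  assumes "f \<in> mhom M N" "lmodule M" "lmodule N"
  shows "f \<zero>\<^bsub>M\<^esub> = \<zero>\<^bsub>N\<^esub>"
  using mhomD(3)[OF assms(1), of "\<zero>\<^bsub>M\<^esub>" 0] mhomD(1)[OF assms(1), of "\<zero>\<^bsub>M\<^esub>"] assms(2,3)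
  by (simp add: lmodule_simps)

lemma mhom_neg:
  assumes "f \<in> mhom M N" "lmodule M" "lmodule N" "x \<in> carrier M"
  shows "f (\<ominus>\<^bsub>M\<^esub> x) = \<ominus>\<^bsub>N\<^esub> f x"
  using mhomD(3)[OF assms(1), of x "-1"] mhomD(1)[OF assms(1), of x] assms(2-)
  by (simp add: lmodule_simps)

lemmas mhom_simps = mhomD mhom_zero mhom_neg

lemma mhom_comp:
  assumes "f \<in> mhom A B" "g \<in> mhom B C"
  shows "(\<lambda>x. g (f x)) \<in> mhom A C"
  using assms by (auto simp: mhom_def Pi_iff)

lemma mhom_id: "(\<lambda>x. x) \<in> mhom M M"
  by (auto simp: mhom_def)

lemma mhom_cong:
  assumes "lmodule A" "f \<in> mhom A B" "\<And>x. x \<in> carrier A \<Longrightarrow> f x = g x"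
  shows "g \<in> mhom A B"
  using assms by (auto simp: mhom_def Pi_iff lmodule_simps)

lemma mhom_const_zero: "lmodule N \<Longrightarrow> (\<lambda>x. \<zero>\<^bsub>N\<^esub>) \<in> mhom M N"
  by (auto simp: mhom_def lmodule_simps)

lemma mhom_inv:
  assumes M: "lmodule M" and f: "f \<in> mhom M N" "bij_betw f (carrier M) (carrier N)"
  shows "the_inv_into (carrier M) f \<in> mhom N M"
proof (rule mhomI)
  let ?g = "the_inv_into (carrier M) f"
  have inj: "inj_on f (carrier M)" and im: "f ` carrier M = carrier N"
    using f(2) by (auto simp: bij_betw_def)
  have gc: "?g y \<in> carrier M" and fg: "f (?g y) = y" if "y \<in> carrier N" for y
    using that inj im by (auto intro: the_inv_into_into f_the_inv_into_f)
  show "?g y \<in> carrier M" if "y \<in> carrier N" for y by (rule gc[OF that])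
  show "?g (x \<oplus>\<^bsub>N\<^esub> y) = ?g x \<oplus>\<^bsub>M\<^esub> ?g y" if "x \<in> carrier N" "y \<in> carrier N" for x y
    by (rule the_inv_into_f_eq[OF inj])
      (use that gc fg mhomD[OF f(1)] M in \<open>auto simp: lmodule_simps\<close>)
  show "?g (a \<odot>\<^bsub>N\<^esub> x) = a \<odot>\<^bsub>M\<^esub> ?g x" if "x \<in> carrier N" for a x
    by (rule the_inv_into_f_eq[OF inj])
      (use that gc fg mhomD[OF f(1)] M in \<open>auto simp: lmodule_simps\<close>)
qed

lemma mhom_inj_iff:
  fixes M :: "('a::ring_1, 'm) module" (structure)
  assumes "f \<in> mhom M N" "lmodule M" "lmodule N"
  shows "inj_on f (carrier M) \<longleftrightarrow> (\<forall>x\<in>carrier M. f x = \<zero>\<^bsub>N\<^esub> \<longrightarrow> x = \<zero>)"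
proof
  assume "inj_on f (carrier M)"
  then show "\<forall>x\<in>carrier M. f x = \<zero>\<^bsub>N\<^esub> \<longrightarrow> x = \<zero>"
    using mhom_zero[OF assms] lmodule_simps(1)[OF assms(2)] by (metis inj_onD)
next
  assume *: "\<forall>x\<in>carrier M. f x = \<zero>\<^bsub>N\<^esub> \<longrightarrow> x = \<zero>"
  show "inj_on f (carrier M)"
  proof (rule inj_onI)
    fix x y assume xy: "x \<in> carrier M" "y \<in> carrier M" "f x = f y"
    then have "f (x \<oplus> \<ominus> y) = \<zero>\<^bsub>N\<^esub>"
      using assms by (simp add: mhom_simps lmodule_simps)
    then have "x \<oplus> \<ominus> y = \<zero>" using * xy assms by (auto simp: lmodule_simps)
    then show "x = y" using xy assms by (simp add: lmodule_diff_zero_iff)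
  qed
qed


subsection \<open>Submodules and finite generation\<close>

text \<open>A set and not a record, so that submodules can be compared, intersected and given a
  length. Negatives come from scaling by -1.\<close>

definition lsubmodule :: "'m set \<Rightarrow> ('a::ring_1, 'm) module \<Rightarrow> bool" where
  "lsubmodule U M \<longleftrightarrow> U \<subseteq> carrier M \<and> \<zero>\<^bsub>M\<^esub> \<in> U \<and>
     (\<forall>x\<in>U. \<forall>y\<in>U. x \<oplus>\<^bsub>M\<^esub> y \<in> U) \<and> (\<forall>a. \<forall>x\<in>U. a \<odot>\<^bsub>M\<^esub> x \<in> U)"

abbreviation restr :: "('a, 'm) module \<Rightarrow> 'm set \<Rightarrow> ('a, 'm) module" where
  "restr M U \<equiv> M\<lparr>carrier := U\<rparr>"

lemma lsubmoduleD:
  fixes M :: "('a::ring_1, 'm) module" (structure)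
  assumes "lsubmodule U M"
  shows "U \<subseteq> carrier M" "\<zero> \<in> U" "x \<in> U \<Longrightarrow> x \<in> carrier M"
    "x \<in> U \<Longrightarrow> y \<in> U \<Longrightarrow> x \<oplus> y \<in> U" "x \<in> U \<Longrightarrow> a \<odot> x \<in> U"
    "lmodule M \<Longrightarrow> x \<in> U \<Longrightarrow> \<ominus> x \<in> U"
proof -
  show "U \<subseteq> carrier M" "\<zero> \<in> U" "x \<in> U \<Longrightarrow> x \<in> carrier M"
    "x \<in> U \<Longrightarrow> y \<in> U \<Longrightarrow> x \<oplus> y \<in> U" "x \<in> U \<Longrightarrow> a \<odot> x \<in> U"
    using assms by (auto simp: lsubmodule_def)
  assume "lmodule M" "x \<in> U"
  moreover from this assms have "(-1) \<odot> x \<in> U" "x \<in> carrier M" by (auto simp: lsubmodule_def)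
  ultimately show "\<ominus> x \<in> U" by (simp add: lmodule_simps)
qed

lemma lmodule_restr:
  assumes M: "lmodule M" and U: "lsubmodule U M"
  shows "lmodule (restr M U)"
  by (rule lmoduleI; insert lsubmoduleD[OF U] lsubmoduleD(3)[OF U] M; simp add: lmodule_simps)

lemma lsubmodule_carrier: "lmodule M \<Longrightarrow> lsubmodule (carrier M) M"
  by (auto simp: lsubmodule_def lmodule_simps)

lemma lsubmodule_zero: "lmodule M \<Longrightarrow> lsubmodule {\<zero>\<^bsub>M\<^esub>} M"
  by (auto simp: lsubmodule_def lmodule_simps)

lemma lsubmodule_restr:
  assumes "lsubmodule U M" shows "lsubmodule V (restr M U) \<longleftrightarrow> lsubmodule V M \<and> V \<subseteq> U"
  using assms by (auto simp: lsubmodule_def)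

lemma lsubmodule_Int: "lsubmodule U M \<Longrightarrow> lsubmodule V M \<Longrightarrow> lsubmodule (U \<inter> V) M"
  by (auto simp: lsubmodule_def)

lemma lsubmodule_vimage:
  assumes "f \<in> mhom M N" "lmodule M" "lmodule N" "lsubmodule V N"
  shows "lsubmodule {x \<in> carrier M. f x \<in> V} M"
  using assms by (auto simp: lsubmodule_def mhom_simps lmodule_simps)

lemma lsubmodule_kernel:
  assumes "f \<in> mhom M N" "lmodule M" "lmodule N"
  shows "lsubmodule {x \<in> carrier M. f x = \<zero>\<^bsub>N\<^esub>} M"
  using lsubmodule_vimage[OF assms lsubmodule_zero] assms by simp

lemma lsubmodule_image:
  assumes f: "f \<in> mhom M N" "lmodule M" "lmodule N" and U: "lsubmodule U M"
  shows "lsubmodule (f ` U) N"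
proof -
  note S = lsubmoduleD[OF U]
  have "f x \<oplus>\<^bsub>N\<^esub> f y \<in> f ` U" if "x \<in> U" "y \<in> U" for x y
    using mhomD(2)[OF f(1), of x y] S that by (metis image_eqI)
  moreover have "a \<odot>\<^bsub>N\<^esub> f x \<in> f ` U" if "x \<in> U" for x a
    using mhomD(3)[OF f(1), of x a] S that by (metis image_eqI)
  moreover have "\<zero>\<^bsub>N\<^esub> \<in> f ` U" using mhom_zero[OF f] S(2) by (metis image_eqI)
  ultimately show ?thesis using mhomD(1)[OF f(1)] S(3) by (auto simp: lsubmodule_def)
qed

lemma mhom_restr:
  assumes "f \<in> mhom M N" "U \<subseteq> carrier M" "\<And>x. x \<in> U \<Longrightarrow> f x \<in> V"
  shows "f \<in> mhom (restr M U) (restr N V)"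
  using assms by (auto simp: mhom_def subset_iff)

lemma mhom_restr_dom: "f \<in> mhom M N \<Longrightarrow> U \<subseteq> carrier M \<Longrightarrow> f \<in> mhom (restr M U) N"
  by (auto simp: mhom_def subset_iff)

lemma mhom_restr_incl: "f \<in> mhom M (restr N V) \<Longrightarrow> V \<subseteq> carrier N \<Longrightarrow> f \<in> mhom M N"
  by (auto simp: mhom_def)

lemma lsubmodule_sum:
  fixes M :: "('a::ring_1, 'm) module" (structure)
  assumes M: "lmodule M" and U: "lsubmodule U M" and V: "lsubmodule V M"
  shows "lsubmodule {u \<oplus> v | u v. u \<in> U \<and> v \<in> V} M"
    and "U \<subseteq> {u \<oplus> v | u v. u \<in> U \<and> v \<in> V}"
    and "V \<subseteq> {u \<oplus> v | u v. u \<in> U \<and> v \<in> V}"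
proof -
  note S = lsubmoduleD[OF U] lsubmoduleD[OF V]
  have "\<exists>u v. (u1 \<oplus> v1) \<oplus> (u2 \<oplus> v2) = u \<oplus> v \<and> u \<in> U \<and> v \<in> V"
    if "u1 \<in> U" "u2 \<in> U" "v1 \<in> V" "v2 \<in> V" for u1 u2 v1 v2
    by (intro exI[of _ "u1 \<oplus> u2"] exI[of _ "v1 \<oplus> v2"])
      (use that S(3,4,9,10) M in \<open>auto simp: lmodule_simps\<close>)
  moreover have "\<exists>u v. a \<odot> (u1 \<oplus> v1) = u \<oplus> v \<and> u \<in> U \<and> v \<in> V"
    if "u1 \<in> U" "v1 \<in> V" for u1 v1 a
    by (intro exI[of _ "a \<odot> u1"] exI[of _ "a \<odot> v1"])
      (use that S(3,5,9,11) M in \<open>auto simp: lmodule_simps\<close>)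
  moreover have "\<exists>u v. x = u \<oplus> v \<and> u \<in> U \<and> v \<in> V" if "x \<in> U \<or> x \<in> V" for x
    using that
  proof
    assume "x \<in> U" then show ?thesis using S(3,8) M
      by (intro exI[of _ x] exI[of _ "\<zero>"]) (auto simp: lmodule_simps)
  next
    assume "x \<in> V" then show ?thesis using S(2,9) M
      by (intro exI[of _ "\<zero>"] exI[of _ x]) (auto simp: lmodule_simps)
  qed
  moreover have "u \<oplus> v \<in> carrier M" if "u \<in> U" "v \<in> V" for u v
    using that S(3,9) M by (simp add: lmodule_simps)
  ultimately show "lsubmodule {u \<oplus> v | u v. u \<in> U \<and> v \<in> V} M"
    and "U \<subseteq> {u \<oplus> v | u v. u \<in> U \<and> v \<in> V}"
    and "V \<subseteq> {u \<oplus> v | u v. u \<in> U \<and> v \<in> V}"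
    unfolding lsubmodule_def using S(2) by auto
qed

definition mspan :: "('a::ring_1, 'm) module \<Rightarrow> 'm set \<Rightarrow> 'm set" where
  "mspan M S = \<Inter>{U. lsubmodule U M \<and> S \<subseteq> U}"

lemma mspan_least: "lsubmodule U M \<Longrightarrow> S \<subseteq> U \<Longrightarrow> mspan M S \<subseteq> U"
  by (auto simp: mspan_def)

lemma mspan_superset: "S \<subseteq> mspan M S"
  by (auto simp: mspan_def)

lemma lsubmodule_mspan:
  assumes "lmodule M" "S \<subseteq> carrier M"
  shows "lsubmodule (mspan M S) M"
proof -
  have "mspan M S \<subseteq> carrier M" using assms by (intro mspan_least lsubmodule_carrier)
  then show ?thesis by (auto simp: lsubmodule_def mspan_def)
qed

lemma finsum_in_lsubmodule:
  assumes M: "lmodule M" and U: "lsubmodule U M" and "finite S" "\<And>s. s \<in> S \<Longrightarrow> f s \<in> U"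
  shows "finsum M f S \<in> U"
proof -
  interpret abelian_group M using M by (rule lmoduleD)
  show ?thesis using assms(3,4)
  proof (induction S rule: finite_induct)
    case (insert x F)
    then have "f \<in> F \<rightarrow> carrier M" "f x \<in> carrier M" using lsubmoduleD(3)[OF U] by auto
    with insert show ?case by (simp add: lsubmoduleD[OF U])
  qed (simp add: lsubmoduleD[OF U])
qed

lemma mspan_finsum:
  fixes M :: "('a::ring_1, 'm) module" (structure)
  assumes M: "lmodule M" and S: "finite S" "S \<subseteq> carrier M"
  shows "mspan M S = range (\<lambda>c. finsum M (\<lambda>s. c s \<odot> s) S)" (is "_ = range ?f")
proof
  interpret abelian_group M using M by (rule lmoduleD)
  note L = lsubmodule_mspan[OF M S(2)]
  have sc: "(\<lambda>s. c s \<odot> s) \<in> S \<rightarrow> carrier M" for c using S(2) M by (auto simp: lmoduleD)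
  have scale: "a \<odot> finsum M (\<lambda>s. c s \<odot> s) F = finsum M (\<lambda>s. (a * c s) \<odot> s) F"
    if "F \<subseteq> S" for F a c
    using finite_subset[OF that S(1)] that
  proof (induction F rule: finite_induct)
    case (insert x F)
    have p: "(\<lambda>s. c s \<odot> s) \<in> F \<rightarrow> carrier M" "(\<lambda>s. (a * c s) \<odot> s) \<in> F \<rightarrow> carrier M"
      "x \<in> carrier M"
      using insert.prems S(2) M by (auto simp: lmoduleD(2))
    show ?case using insert p M by (simp add: lmoduleD lmodule_simps)
  qed (simp add: M lmodule_simps)
  show "range ?f \<subseteq> mspan M S"
    using S(1) mspan_superset[of S M] lsubmoduleD(5)[OF L] by (auto intro!: finsum_in_lsubmodule[OF M L])
  show "mspan M S \<subseteq> range ?f"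
  proof (rule mspan_least)
    have "?f c \<oplus> ?f c' = ?f (\<lambda>s. c s + c' s)" for c c'
      unfolding finsum_addf[OF sc sc, symmetric]
      by (rule finsum_cong') (use S M in \<open>auto simp: lmodule_simps\<close>)
    moreover have "\<zero> = ?f (\<lambda>s. 0)"
    proof -
      have "finsum M (\<lambda>s. 0 \<odot> s) F = \<zero>" if "F \<subseteq> S" for F
        using finite_subset[OF that S(1)] that
      proof (induction F rule: finite_induct)
        case (insert x F)
        then have x: "x \<in> carrier M" "F \<subseteq> carrier M" using S(2) by auto
        then have "(\<lambda>s. 0 \<odot> s) \<in> F \<rightarrow> carrier M" using lmoduleD(2)[OF M] by blast
        with x insert show ?case by (simp add: lmodule_smult_zero M)
      qed simp
      then show ?thesis by simp
    qed
    moreover have "?f c \<in> carrier M" for c using sc by (rule finsum_closed)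
    ultimately show "lsubmodule (range ?f) M" by (auto simp: lsubmodule_def scale)
    show "S \<subseteq> range ?f"
    proof
      fix s assume s: "s \<in> S"
      have "?f (\<lambda>t. if s = t then 1 else 0) = finsum M (\<lambda>t. if s = t then t else \<zero>) S"
        by (rule finsum_cong') (use S M in \<open>auto simp: lmodule_simps\<close>)
      also have "\<dots> = s" using add.finprod_singleton[OF s S(1), of "\<lambda>t. t"] S(2) by auto
      finally show "s \<in> range ?f" by (intro range_eqI[where x = "\<lambda>t. if s = t then 1 else 0"]) (rule sym)
    qed
  qed
qed

text \<open>Replaces explicit linear combinations by the least submodule containing the generators,
  which behaves well under images, inclusions and adding a generator.\<close>

lemma fg_module_iff:
  "fg_module M \<longleftrightarrow> lmodule M \<and> (\<exists>S. finite S \<and> S \<subseteq> carrier M \<and> mspan M S = carrier M)"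
proof -
  have "mspan M S = carrier M \<longleftrightarrow> (\<forall>x\<in>carrier M. \<exists>c. x = finsum M (\<lambda>s. c s \<odot>\<^bsub>M\<^esub> s) S)"
    if "lmodule M" "finite S" "S \<subseteq> carrier M" for S
    using mspan_finsum[OF that] mspan_least[OF lsubmodule_carrier[OF that(1)] that(3)] by auto
  then show ?thesis by (simp add: fg_module_def cong: conj_cong)
qed

lemma mspan_image:
  assumes f: "f \<in> mhom M N" "lmodule M" "lmodule N" and S: "S \<subseteq> carrier M"
  shows "f ` mspan M S = mspan N (f ` S)"
proof
  have "f ` S \<subseteq> carrier N" using S mhomD(1)[OF f(1)] by auto
  then have L: "lsubmodule (mspan N (f ` S)) N" by (rule lsubmodule_mspan[OF f(3)])
  have "mspan M S \<subseteq> {x \<in> carrier M. f x \<in> mspan N (f ` S)}"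
    using mspan_superset[of "f ` S" N] S by (intro mspan_least lsubmodule_vimage[OF f L]) auto
  then show "f ` mspan M S \<subseteq> mspan N (f ` S)" by auto
  show "mspan N (f ` S) \<subseteq> f ` mspan M S"
    using mspan_superset[of S M] by (intro mspan_least lsubmodule_image[OF f] lsubmodule_mspan f S) auto
qed

lemma fg_module_image:
  assumes M: "fg_module M" and N: "lmodule N" and f: "f \<in> mhom M N" "f ` carrier M = carrier N"
  shows "fg_module N"
proof -
  obtain S where S: "finite S" "S \<subseteq> carrier M" "mspan M S = carrier M" and L: "lmodule M"
    using M by (auto simp: fg_module_iff)
  have "mspan N (f ` S) = carrier N" using mspan_image[OF f(1) L N S(2)] S(3) f(2) by simp
  moreover have "f ` S \<subseteq> carrier N" using S(2) f(2) by auto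
  ultimately show ?thesis using S(1) N by (auto simp: fg_module_iff)
qed

subsection \<open>Length\<close>

lemma mspan_mono: "S \<subseteq> T \<Longrightarrow> mspan M S \<subseteq> mspan M T"
  by (auto simp: mspan_def)

lemma mspan_insert:
  fixes M :: "('a::ring_1, 'm) module" (structure)
  assumes M: "lmodule M" and s: "s \<in> carrier M" "S \<subseteq> carrier M" and x: "x \<in> mspan M (insert s S)"
  shows "\<exists>k\<in>mspan M S. \<exists>a. x = k \<oplus> a \<odot> s"
proof -
  have "lsubmodule (range (\<lambda>a. a \<odot> s)) M"
    unfolding lsubmodule_def using M s(1)
    by (auto simp: lmodule_simps simp flip: lmoduleD(4,5) intro: range_eqI[where x = 0])
  note C = this lsubmodule_sum[OF M lsubmodule_mspan[OF M s(2)] this]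
  have "s \<in> range (\<lambda>a. a \<odot> s)" using lmoduleD(3)[OF M s(1)] by (metis rangeI)
  then have "mspan M (insert s S) \<subseteq> {u \<oplus> v | u v. u \<in> mspan M S \<and> v \<in> range (\<lambda>a. a \<odot> s)}"
    using C(3,4) mspan_superset[of S M] by (intro mspan_least C(2)) blast
  then show ?thesis using x by blast
qed

lemma fd_algebra_basis:
  assumes "fd_algebra scale"
  obtains Basis where "finite_dimensional_vector_space scale Basis"
proof -
  interpret fd_algebra scale by fact
  obtain S where S: "finite S" "span S = UNIV" using finite_dim by auto
  obtain B where B: "B \<subseteq> S" "independent B" "S \<subseteq> span B"
    by (rule maximal_independent_subset)
  then have "span B = UNIV" using S(2) span_minimal[OF B(3) subspace_span] by auto
  with B(1,2) S(1) show thesis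
    by (intro that[of B]) (unfold_locales, auto intro: finite_subset)
qed

text \<open>The step of the induction extends a length function \<open>d\<close> on submodules of a module \<open>K\<close>
  to submodules \<open>U\<close> of \<open>K + \<Lambda>s\<close> by
  \<open>d (U \<inter> K) + dim {a. a s \<in> U + K}\<close>.\<close>

lemma length_mspan:
  fixes scale :: "'k::field \<Rightarrow> 'a::ring_1 \<Rightarrow> 'a" and M :: "('a, 'm) module" (structure)
  assumes alg: "fd_algebra scale" and M: "lmodule M" and S: "finite S" "S \<subseteq> carrier M"
  shows "\<exists>d :: 'm set \<Rightarrow> nat. \<forall>U V. lsubmodule U M \<and> lsubmodule V M \<and> U \<subset> V \<and> V \<subseteq> mspan M S \<longrightarrow> d U < d V"
  using S
proof (induction S rule: finite_induct)
  case empty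
  have "mspan M {} \<subseteq> {\<zero>}" by (intro mspan_least lsubmodule_zero M) simp
  then have "\<not> (lsubmodule U M \<and> lsubmodule V M \<and> U \<subset> V \<and> V \<subseteq> mspan M {})" for U V
    using lsubmoduleD(2)[of U M] by auto
  then show ?case by blast
next
  case (insert s S)
  then have s: "s \<in> carrier M" and S: "S \<subseteq> carrier M" by auto
  from insert obtain d :: "'m set \<Rightarrow> nat"
    where d': "\<forall>U V. lsubmodule U M \<and> lsubmodule V M \<and> U \<subset> V \<and> V \<subseteq> mspan M S \<longrightarrow> d U < d V" by auto
  have d: "d U < d V" if "lsubmodule U M" "lsubmodule V M" "U \<subset> V" "V \<subseteq> mspan M S" for U V
    using d' that by blast
  interpret fd_algebra scale by fact
  obtain Basis where "finite_dimensional_vector_space scale Basis"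
    using fd_algebra_basis[OF alg] .
  then interpret finite_dimensional_vector_space scale Basis .
  define K where "K = mspan M S"
  have K: "lsubmodule K M" unfolding K_def by (rule lsubmodule_mspan[OF M S])
  note KD = lsubmoduleD[OF K]
  define I where "I U = {a. \<exists>u\<in>U. \<exists>k\<in>K. a \<odot> s = u \<oplus> k}" for U
  have I_eq: "I U = {a. a \<odot> s \<in> {u \<oplus> k | u k. u \<in> U \<and> k \<in> K}}" for U
    by (auto simp: I_def)
  have I: "subspace (I U)" if U: "lsubmodule U M" for U
  proof -
    note L = lsubmoduleD[OF lsubmodule_sum(1)[OF M U K]]
    \<comment> \<open>Field scalars act on the module through the elements \<open>scale c 1\<close>
      of the algebra; this makes \<open>I U\<close> a vector subspace, so that it has a
      dimension.\<close>
    have "scale c a \<odot> s = scale c 1 \<odot> (a \<odot> s)" for c a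
      using lmoduleD(4)[OF M s, of "scale c 1" a] by (simp add: mult_scale_left)
    then show ?thesis unfolding subspace_def I_eq using s M L(2,4,5)
      by (simp add: lmoduleD lmodule_smult_zero)
  qed
  have mono: "I U \<subseteq> I V" if "U \<subseteq> V" for U V using that by (auto simp: I_def)
  have "d (U \<inter> K) + dim (I U) < d (V \<inter> K) + dim (I V)"
    if U: "lsubmodule U M" and V: "lsubmodule V M" and UV: "U \<subset> V" and Vs: "V \<subseteq> mspan M (insert s S)" for U V
  proof (rule ccontr)
    assume *: "\<not> ?thesis"
    note UD = lsubmoduleD[OF U] and VD = lsubmoduleD[OF V]
    note IK = lsubmodule_Int[OF U K] lsubmodule_Int[OF V K]
    have 1: "dim (I U) \<le> dim (I V)" by (rule dim_subset[OF mono]) (use UV in auto)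
    have 2: "d (U \<inter> K) < d (V \<inter> K)" if "U \<inter> K \<noteq> V \<inter> K"
      by (rule d[OF IK]) (use that UV in \<open>auto simp: K_def\<close>)
    with 1 * have eqK: "U \<inter> K = V \<inter> K" by fastforce
    then have "dim (I V) \<le> dim (I U)" using * by simp
    then have eqI: "I U = I V" using I[OF U] I[OF V] mono[of U V] UV by (intro subspace_dim_equal) auto
    \<comment> \<open>A modular law argument: \<open>x = k \<oplus> a \<odot> s\<close> with
      \<open>a\<close> in \<open>I V = I U\<close>, so \<open>a \<odot> s = u \<oplus> k'\<close>
      with \<open>u\<close> in \<open>U\<close>. Then \<open>x\<close> minus \<open>u\<close> is
      \<open>k \<oplus> k'\<close>, which lies in both \<open>V\<close> and \<open>K\<close>, hence
      in \<open>U\<close>.\<close>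
    have "V \<subseteq> U"
    proof
      fix x assume x: "x \<in> V"
      then obtain k a where k: "k \<in> K" "x = k \<oplus> a \<odot> s"
        using mspan_insert[OF M s S] Vs unfolding K_def by blast
      have c: "k \<in> carrier M" "a \<odot> s \<in> carrier M" "x \<in> carrier M"
        using k KD(3) s M VD(3) x by (auto simp: lmoduleD)
      have "a \<odot> s = x \<oplus> \<ominus> k" using k c M by (simp add: lmodule_simps)
      then have "a \<in> I V" using x KD(6)[OF M k(1)] by (auto simp: I_def)
      then have "a \<in> I U" by (simp add: eqI)
      then obtain u k' where u: "u \<in> U" "k' \<in> K" "a \<odot> s = u \<oplus> k'" unfolding I_def by blast
      then have c': "u \<in> carrier M" "k' \<in> carrier M" using UD(3) KD(3) by auto
      have "x \<oplus> \<ominus> u = k \<oplus> k'" using k u c c' M by (simp add: lmodule_simps)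
      moreover have "k \<oplus> k' \<in> K" using k u KD by auto
      moreover have "x \<oplus> \<ominus> u \<in> V" using x u(1) UV VD(4) VD(6)[OF M] by auto
      ultimately have "k \<oplus> k' \<in> U" using eqK by auto
      then have "u \<oplus> (k \<oplus> k') \<in> U" using u UD by auto
      moreover have "x = u \<oplus> (k \<oplus> k')" using k u c c' M by (simp add: lmodule_simps)
      ultimately show "x \<in> U" by simp
    qed
    then show False using UV by auto
  qed
  then show ?case by (intro exI[of _ "\<lambda>U. d (U \<inter> K) + dim (I U)"]) blast
qed

lemma length_exists:
  fixes scale :: "'k::field \<Rightarrow> 'a::ring_1 \<Rightarrow> 'a" and M :: "('a, 'm) module"
  assumes alg: "fd_algebra scale" and M: "fg_module M"
  shows "\<exists>d :: 'm set \<Rightarrow> nat. (\<forall>U V. lsubmodule U M \<longrightarrow> lsubmodule V M \<longrightarrow> U \<subset> V \<longrightarrow> d U < d V) \<and>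
    (\<forall>U V. lsubmodule U M \<longrightarrow> lsubmodule V M \<longrightarrow> U \<subseteq> V \<longrightarrow> d U \<le> d V)"
proof -
  from M obtain S where S: "lmodule M" "finite S" "S \<subseteq> carrier M" "mspan M S = carrier M" by (auto simp: fg_module_iff)
  obtain d :: "'m set \<Rightarrow> nat" where d: "\<And>U V. lsubmodule U M \<Longrightarrow> lsubmodule V M \<Longrightarrow> U \<subset> V \<Longrightarrow> d U < d V"
    using length_mspan[OF alg S(1-3)] S(4) by (metis lsubmoduleD(1))
  then show ?thesis by (intro exI[of _ d]) (auto simp: order_le_less)
qed

text \<open>Noetherianity from length: take a finite subset \<open>S\<close> of \<open>U\<close>
  whose span has the largest length. Adding an element of \<open>U\<close> outside the span would
  increase the length. The bound \<open>Suc (d U)\<close> makes the estimate strict, as the maximum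
  principle for natural numbers demands.\<close>

lemma fg_module_restr:
  fixes scale :: "'k::field \<Rightarrow> 'a::ring_1 \<Rightarrow> 'a" and M :: "('a, 'm) module"
  assumes alg: "fd_algebra scale" and M: "fg_module M" and U: "lsubmodule U M"
  shows "fg_module (restr M U)"
proof -
  note L = fg_lmodule[OF M]
  from length_exists[OF alg M] obtain d :: "'m set \<Rightarrow> nat" where
    "(\<forall>U V. lsubmodule U M \<longrightarrow> lsubmodule V M \<longrightarrow> U \<subset> V \<longrightarrow> d U < d V) \<and>
    (\<forall>U V. lsubmodule U M \<longrightarrow> lsubmodule V M \<longrightarrow> U \<subseteq> V \<longrightarrow> d U \<le> d V)" ..
  note d = this[THEN conjunct1, rule_format] this[THEN conjunct2, rule_format]
  have sub: "lsubmodule (mspan M S) M" "mspan M S \<subseteq> U" if "S \<subseteq> U" for S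
    using lsubmodule_mspan[OF L subset_trans[OF that lsubmoduleD(1)[OF U]]] mspan_least[OF U that]
    by simp_all
  have "\<exists>S. (finite S \<and> S \<subseteq> U) \<and> (\<forall>T. finite T \<and> T \<subseteq> U \<longrightarrow> d (mspan M T) \<le> d (mspan M S))"
  proof (rule ex_has_greatest_nat[where k = "{}" and b = "Suc (d U)"])
    show "\<forall>S. finite S \<and> S \<subseteq> U \<longrightarrow> d (mspan M S) < Suc (d U)"
      using d(2)[OF sub(1) U sub(2)] by (simp add: less_Suc_eq_le)
  qed simp
  then obtain S where S': "(finite S \<and> S \<subseteq> U) \<and>
      (\<forall>T. finite T \<and> T \<subseteq> U \<longrightarrow> d (mspan M T) \<le> d (mspan M S))" ..
  then have S: "finite S" "S \<subseteq> U" by simp_all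
  have max: "d (mspan M T) \<le> d (mspan M S)" if "finite T" "T \<subseteq> U" for T
    using S' that by simp
  have "U \<subseteq> mspan M S"
  proof
    fix x assume x: "x \<in> U"
    show "x \<in> mspan M S"
    proof (rule ccontr)
      assume "x \<notin> mspan M S"
      then have "mspan M S \<subset> mspan M (insert x S)"
        using mspan_mono[OF subset_insertI, of M S x] subsetD[OF mspan_superset[of "insert x S" M], of x]
        by (metis insertI1 psubsetI)
      then have "d (mspan M S) < d (mspan M (insert x S))" using S x by (intro d(1) sub(1)) simp_all
      then show False using max[of "insert x S"] S x by auto
    qed
  qed
  moreover have "mspan M S \<subseteq> mspan (restr M U) S"
    using lsubmodule_mspan[OF lmodule_restr[OF L U], of S] S(2)
    by (intro mspan_least mspan_superset) (auto simp: lsubmodule_restr[OF U])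
  moreover have "mspan (restr M U) S \<subseteq> U"
    using lsubmodule_carrier[OF lmodule_restr[OF L U]] S(2) by (intro mspan_least) auto
  ultimately show ?thesis using S lmodule_restr[OF L U] by (auto simp: fg_module_iff)
qed


subsection \<open>Isomorphic copies on a given type\<close>

text \<open>An element is determined by one choice of coefficients on the generators, and each
  coefficient by its coordinates in a basis of the algebra. Listing these coordinates in a fixed
  order codes the element by a finite list over the field; lists are used because they leave room
  for modules of every size even over a finite field.\<close>

lemma fg_module_embed:
  fixes scale :: "'k::field \<Rightarrow> 'a::ring_1 \<Rightarrow> 'a" and M :: "('a, 'x) module" and \<iota> :: "'k list \<Rightarrow> 'c"
  assumes alg: "fd_algebra scale" and \<iota>: "inj \<iota>" and M: "fg_module M"
  obtains j :: "'x \<Rightarrow> 'c" where "inj_on j (carrier M)"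
proof -
  from M obtain S where S: "finite S" "S \<subseteq> carrier M" and gen: "\<forall>x\<in>carrier M. \<exists>c. x = finsum M (\<lambda>s. c s \<odot>\<^bsub>M\<^esub> s) S"
    by (auto simp: fg_module_def)
  then obtain c where c: "\<And>x. x \<in> carrier M \<Longrightarrow> x = finsum M (\<lambda>s. c x s \<odot>\<^bsub>M\<^esub> s) S" by metis
  have grp: "abelian_group M" using fg_lmodule[OF M] by (rule lmoduleD)
  obtain ss where ss: "set ss = S" using finite_list[OF S(1)] by auto
  obtain Basis where "finite_dimensional_vector_space scale Basis"
    using fd_algebra_basis[OF alg] .
  then interpret finite_dimensional_vector_space scale Basis .
  obtain bs where bs: "set bs = Basis" using finite_list[OF finite_Basis] by auto
  define j where "j x = \<iota> (map (\<lambda>(s, b). representation Basis (c x s) b) (List.product ss bs))" for x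
  have rep: "a = (\<Sum>b\<in>Basis. scale (representation Basis a b) b)" for a
    using sum_representation_eq[OF independent_Basis _ finite_Basis order_refl, of a] span_Basis by simp
  have "inj_on j (carrier M)"
  proof (rule inj_onI)
    fix x y assume xy: "x \<in> carrier M" "y \<in> carrier M" "j x = j y"
    then have eq: "representation Basis (c x s) b = representation Basis (c y s) b" if "s \<in> S" "b \<in> Basis" for s b
      using that injD[OF \<iota>] ss bs unfolding j_def by fastforce
    have "c x s = c y s" if "s \<in> S" for s
      using rep[of "c x s"] rep[of "c y s"] eq[OF that] by (metis (no_types, lifting) sum.cong)
    then have "finsum M (\<lambda>s. c x s \<odot>\<^bsub>M\<^esub> s) S = finsum M (\<lambda>s. c y s \<odot>\<^bsub>M\<^esub> s) S"
      using S(2) fg_lmodule[OF M] by (intro abelian_monoid.finsum_cong'[OF abelian_group.axioms(1)[OF grp]]) (auto simp: lmoduleD)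
    then show "x = y" using c xy by metis
  qed
  then show thesis by (rule that)
qed


definition transport :: "('x \<Rightarrow> 'c) \<Rightarrow> ('a, 'x) module \<Rightarrow> ('a, 'c) module" where
  "transport j M = (let k = the_inv_into (carrier M) j in
     \<lparr>carrier = j ` carrier M, mult = undefined, one = undefined, zero = j \<zero>\<^bsub>M\<^esub>,
      add = (\<lambda>x y. j (k x \<oplus>\<^bsub>M\<^esub> k y)), smult = (\<lambda>a x. j (a \<odot>\<^bsub>M\<^esub> k x))\<rparr>)"

lemma transport:
  assumes M: "lmodule M" and j: "inj_on j (carrier M)"
  shows "lmodule (transport j M)" and "j \<in> mhom M (transport j M)"
    and "bij_betw j (carrier M) (carrier (transport j M))"
proof -
  have k: "the_inv_into (carrier M) j (j x) = x" if "x \<in> carrier M" for x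
    using the_inv_into_f_f[OF j that] .
  show "lmodule (transport j M)"
    by (rule lmoduleI; use M k in \<open>auto simp: transport_def Let_def lmodule_simps\<close>)
  show "j \<in> mhom M (transport j M)"
    by (rule mhomI) (use M k in \<open>auto simp: transport_def Let_def lmodule_simps\<close>)
  show "bij_betw j (carrier M) (carrier (transport j M))"
    using j by (auto simp: transport_def Let_def bij_betw_def)
qed

lemma fg_module_copy:
  fixes scale :: "'k::field \<Rightarrow> 'a::ring_1 \<Rightarrow> 'a" and M :: "('a, 'x) module" and \<iota> :: "'k list \<Rightarrow> 'c"
  assumes alg: "fd_algebra scale" and \<iota>: "inj \<iota>" and M: "fg_module M"
  obtains M' :: "('a, 'c) module" and j k where "fg_module M'"
    "j \<in> mhom M M'" "k \<in> mhom M' M" "bij_betw k (carrier M') (carrier M)"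
    "\<And>x. x \<in> carrier M \<Longrightarrow> k (j x) = x" "\<And>x. x \<in> carrier M' \<Longrightarrow> j (k x) = x"
proof -
  obtain j :: "'x \<Rightarrow> 'c" where j: "inj_on j (carrier M)" using fg_module_embed[OF alg \<iota> M] .
  note T = transport[OF fg_lmodule[OF M] j]
  have im: "j ` carrier M = carrier (transport j M)" using T(3) by (simp add: bij_betw_def)
  show thesis
  proof (rule that)
    show "fg_module (transport j M)" by (rule fg_module_image[OF M T(1,2) im])
    show "j \<in> mhom M (transport j M)" by (rule T)
    show "the_inv_into (carrier M) j \<in> mhom (transport j M) M"
      by (rule mhom_inv[OF fg_lmodule[OF M] T(2,3)])
    show "bij_betw (the_inv_into (carrier M) j) (carrier (transport j M)) (carrier M)"
      by (rule bij_betw_the_inv_into[OF T(3)])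
    show "the_inv_into (carrier M) j (j x) = x" if "x \<in> carrier M" for x
      using the_inv_into_f_f[OF j that] .
    show "j (the_inv_into (carrier M) j x) = x" if "x \<in> carrier (transport j M)" for x
      using that f_the_inv_into_f[OF j] im by blast
  qed
qed

subsection \<open>Products and subquotients\<close>

definition mprod :: "('a, 'm) module \<Rightarrow> ('a, 'n) module \<Rightarrow> ('a, 'm \<times> 'n) module" where
  "mprod M N = \<lparr>carrier = carrier M \<times> carrier N, mult = undefined, one = undefined,
     zero = (\<zero>\<^bsub>M\<^esub>, \<zero>\<^bsub>N\<^esub>),
     add = (\<lambda>x y. (fst x \<oplus>\<^bsub>M\<^esub> fst y, snd x \<oplus>\<^bsub>N\<^esub> snd y)),
     smult = (\<lambda>a x. (a \<odot>\<^bsub>M\<^esub> fst x, a \<odot>\<^bsub>N\<^esub> snd x))\<rparr>"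

lemma mprod_simps [simp]:
  "carrier (mprod M N) = carrier M \<times> carrier N"
  "\<zero>\<^bsub>mprod M N\<^esub> = (\<zero>\<^bsub>M\<^esub>, \<zero>\<^bsub>N\<^esub>)"
  "x \<oplus>\<^bsub>mprod M N\<^esub> y = (fst x \<oplus>\<^bsub>M\<^esub> fst y, snd x \<oplus>\<^bsub>N\<^esub> snd y)"
  "a \<odot>\<^bsub>mprod M N\<^esub> x = (a \<odot>\<^bsub>M\<^esub> fst x, a \<odot>\<^bsub>N\<^esub> snd x)"
  by (simp_all add: mprod_def)

lemma lmodule_mprod: "lmodule M \<Longrightarrow> lmodule N \<Longrightarrow> lmodule (mprod M N)"
  by (rule lmoduleI) (auto simp: lmodule_simps)

lemma fg_module_mprod:
  fixes M :: "('a::ring_1, 'm) module" (structure)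
  assumes M: "fg_module M" and N: "fg_module N"
  shows "fg_module (mprod M N)"
proof -
  note LM = fg_lmodule[OF M] and LN = fg_lmodule[OF N]
  note L = lmodule_mprod[OF LM LN]
  obtain S where S: "finite S" "S \<subseteq> carrier M" "mspan M S = carrier M" using M by (auto simp: fg_module_iff)
  obtain T where T: "finite T" "T \<subseteq> carrier N" "mspan N T = carrier N" using N by (auto simp: fg_module_iff)
  have h: "(\<lambda>x. (x, \<zero>\<^bsub>N\<^esub>)) \<in> mhom M (mprod M N)" "(\<lambda>y. (\<zero>, y)) \<in> mhom N (mprod M N)"
    using LM LN by (auto simp: mhom_def lmodule_simps)
  let ?G = "(\<lambda>x. (x, \<zero>\<^bsub>N\<^esub>)) ` S \<union> (\<lambda>y. (\<zero>, y)) ` T"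
  have G: "finite ?G" "?G \<subseteq> carrier (mprod M N)" using S T LM LN by (auto simp: lmodule_simps)
  note GL = lsubmodule_mspan[OF L G(2)]
  have 1: "(x, \<zero>\<^bsub>N\<^esub>) \<in> mspan (mprod M N) ?G" if "x \<in> carrier M" for x
  proof (rule subsetD[OF mspan_mono[OF Un_upper1]])
    have "(x, \<zero>\<^bsub>N\<^esub>) \<in> (\<lambda>x. (x, \<zero>\<^bsub>N\<^esub>)) ` mspan M S" using that S(3) by simp
    then show "(x, \<zero>\<^bsub>N\<^esub>) \<in> mspan (mprod M N) ((\<lambda>x. (x, \<zero>\<^bsub>N\<^esub>)) ` S)"
      by (simp only: mspan_image[OF h(1) LM L S(2)])
  qed
  have 2: "(\<zero>, y) \<in> mspan (mprod M N) ?G" if "y \<in> carrier N" for y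
  proof (rule subsetD[OF mspan_mono[OF Un_upper2]])
    have "(\<zero>, y) \<in> (\<lambda>y. (\<zero>, y)) ` mspan N T" using that T(3) by simp
    then show "(\<zero>, y) \<in> mspan (mprod M N) ((\<lambda>y. (\<zero>, y)) ` T)"
      by (simp only: mspan_image[OF h(2) LN L T(2)])
  qed
  have "(x, y) \<in> mspan (mprod M N) ?G" if "x \<in> carrier M" "y \<in> carrier N" for x y
    using lsubmoduleD(4)[OF GL 1[OF that(1)] 2[OF that(2)]] that by (simp add: LM LN lmodule_group)
  then have "mspan (mprod M N) ?G = carrier (mprod M N)" using lsubmoduleD(1)[OF GL] by fastforce
  then show ?thesis unfolding fg_module_iff using L G by blast
qed

text \<open>The subquotient (Z + B)/B, meaningful for any two submodules. The record is built
  exactly like \<open>homology\<close>, so that the two agree by unfolding. Scalar multiplication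
  adds \<open>B\<close> because \<open>a\<close> times a coset can be a proper subset of the coset
  it should be.\<close>

definition mquot :: "('a, 'm) module \<Rightarrow> 'm set \<Rightarrow> 'm set \<Rightarrow> ('a, 'm set) module" where
  "mquot M Z B = \<lparr>carrier = (\<lambda>x. B +>\<^bsub>M\<^esub> x) ` Z, mult = undefined, one = undefined, zero = B,
     add = (\<lambda>S T. S <+>\<^bsub>M\<^esub> T), smult = (\<lambda>a S. B <+>\<^bsub>M\<^esub> ((\<lambda>x. a \<odot>\<^bsub>M\<^esub> x) ` S))\<rparr>"

lemma coset_eq: "B +>\<^bsub>M\<^esub> x = {b \<oplus>\<^bsub>M\<^esub> x | b. b \<in> B}"
  by (auto simp: a_r_coset_def')

lemma set_add_eq: "S <+>\<^bsub>M\<^esub> T = {s \<oplus>\<^bsub>M\<^esub> t | s t. s \<in> S \<and> t \<in> T}"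
  by (auto simp: set_add_defs)

lemma coset_mem:
  assumes "lmodule M" "lsubmodule B M" "x \<in> carrier M"
  shows "x \<in> B +>\<^bsub>M\<^esub> x"
  unfolding coset_eq using assms lsubmoduleD(2)[OF assms(2)]
  by (auto simp: lmodule_simps intro!: exI[of _ "\<zero>\<^bsub>M\<^esub>"])

lemma coset_eq_iff:
  fixes M :: "('a::ring_1, 'm) module" (structure)
  assumes M: "lmodule M" and B: "lsubmodule B M" and x: "x \<in> carrier M" and y: "y \<in> carrier M"
  shows "B +> x = B +> y \<longleftrightarrow> (\<exists>b\<in>B. x = b \<oplus> y)"
proof
  assume "B +> x = B +> y"
  then have "x \<in> B +> y" using coset_mem[OF M B x] by simp
  then show "\<exists>b\<in>B. x = b \<oplus> y" by (auto simp: coset_eq)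
next
  note BD = lsubmoduleD[OF B]
  assume "\<exists>b\<in>B. x = b \<oplus> y"
  then obtain b where b: "b \<in> B" "x = b \<oplus> y" by blast
  note c = BD(3)[OF b(1)]
  have "\<exists>b''. b' \<oplus> x = b'' \<oplus> y \<and> b'' \<in> B" if b': "b' \<in> B" for b'
    by (rule exI[of _ "b' \<oplus> b"]) (use BD(3)[OF b'] BD(4) b b' c y M in \<open>simp add: lmodule_simps\<close>)
  moreover have "\<exists>b''. b' \<oplus> y = b'' \<oplus> x \<and> b'' \<in> B" if b': "b' \<in> B" for b'
    by (rule exI[of _ "b' \<oplus> \<ominus> b"])
      (use BD(3)[OF b'] BD(4) BD(6)[OF M] b b' c y M in \<open>simp add: lmodule_simps\<close>)
  ultimately show "B +> x = B +> y" by (auto simp: coset_eq)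
qed

lemma mquot_simps:
  fixes M :: "('a::ring_1, 'm) module" (structure)
  assumes M: "lmodule M" and B: "lsubmodule B M"
  shows "carrier (mquot M Z B) = (\<lambda>x. B +> x) ` Z"
    and "\<zero>\<^bsub>mquot M Z B\<^esub> = B +> \<zero>"
    and "x \<in> carrier M \<Longrightarrow> y \<in> carrier M \<Longrightarrow>
      (B +> x) \<oplus>\<^bsub>mquot M Z B\<^esub> (B +> y) = B +> (x \<oplus> y)"
    and "x \<in> carrier M \<Longrightarrow> a \<odot>\<^bsub>mquot M Z B\<^esub> (B +> x) = B +> (a \<odot> x)"
proof -
  note BD = lsubmoduleD[OF B]
  show "carrier (mquot M Z B) = (\<lambda>x. B +> x) ` Z" by (simp add: mquot_def)
  show "\<zero>\<^bsub>mquot M Z B\<^esub> = B +> \<zero>" using BD(3) M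
    by (force simp: mquot_def coset_eq lmodule_simps)
  show "(B +> x) \<oplus>\<^bsub>mquot M Z B\<^esub> (B +> y) = B +> (x \<oplus> y)"
    if x: "x \<in> carrier M" and y: "y \<in> carrier M"
  proof -
    have "\<exists>b. (b1 \<oplus> x) \<oplus> (b2 \<oplus> y) = b \<oplus> (x \<oplus> y) \<and> b \<in> B" if "b1 \<in> B" "b2 \<in> B" for b1 b2
      by (rule exI[of _ "b1 \<oplus> b2"]) (use that BD(3,4) x y M in \<open>simp add: lmodule_simps\<close>)
    moreover have "\<exists>s t. b \<oplus> (x \<oplus> y) = s \<oplus> t \<and> (\<exists>b. s = b \<oplus> x \<and> b \<in> B) \<and> (\<exists>b. t = b \<oplus> y \<and> b \<in> B)"
      if "b \<in> B" for b
    proof (rule exI[of _ "b \<oplus> x"], rule exI[of _ "\<zero> \<oplus> y"],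
        intro conjI)
      show "b \<oplus> (x \<oplus> y) = (b \<oplus> x) \<oplus> (\<zero> \<oplus> y)"
        using that BD(3) x y M by (simp add: lmodule_simps)
      show "\<exists>b'. b \<oplus> x = b' \<oplus> x \<and> b' \<in> B" using that by blast
      show "\<exists>b'. \<zero> \<oplus> y = b' \<oplus> y \<and> b' \<in> B" using BD(2) by blast
    qed
    ultimately show ?thesis by (auto simp: mquot_def set_add_eq coset_eq)
  qed
  show "a \<odot>\<^bsub>mquot M Z B\<^esub> (B +> x) = B +> (a \<odot> x)" if x: "x \<in> carrier M"
  proof -
    have "\<exists>b. b1 \<oplus> a \<odot> (b2 \<oplus> x) = b \<oplus> a \<odot> x \<and> b \<in> B" if "b1 \<in> B" "b2 \<in> B" for b1 b2
      by (rule exI[of _ "b1 \<oplus> a \<odot> b2"]) (use that BD(3,4,5) x M in \<open>simp add: lmodule_simps\<close>)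
    moreover have "\<exists>b1 b2. b \<oplus> a \<odot> x = b1 \<oplus> a \<odot> (b2 \<oplus> x) \<and> b1 \<in> B \<and> b2 \<in> B"
      if "b \<in> B" for b
      by (rule exI[of _ b], rule exI[of _ "\<zero>"]) (use that BD(2) x M in \<open>simp add: lmodule_group\<close>)
    ultimately have "{b1 \<oplus> a \<odot> (b2 \<oplus> x) | b1 b2. b1 \<in> B \<and> b2 \<in> B} = {b \<oplus> a \<odot> x | b. b \<in> B}"
      by blast
    moreover have "B <+> (\<lambda>x. a \<odot> x) ` {b \<oplus> x | b. b \<in> B}
        = {b1 \<oplus> a \<odot> (b2 \<oplus> x) | b1 b2. b1 \<in> B \<and> b2 \<in> B}"
      unfolding set_add_eq by blast
    ultimately show ?thesis by (simp add: mquot_def coset_eq)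
  qed
qed

lemma mquot:
  assumes M: "lmodule M" and Z: "lsubmodule Z M" and B: "lsubmodule B M"
  shows "lmodule (mquot M Z B)" and "(\<lambda>x. B +>\<^bsub>M\<^esub> x) \<in> mhom (restr M Z) (mquot M Z B)"
proof -
  note Q = mquot_simps[OF M B] and ZD = lsubmoduleD[OF Z]
  show "lmodule (mquot M Z B)"
    by (rule lmoduleI) (use ZD(2-5) M Q in \<open>auto simp: lmodule_simps\<close>)
  show "(\<lambda>x. B +>\<^bsub>M\<^esub> x) \<in> mhom (restr M Z) (mquot M Z B)"
    by (rule mhomI) (use ZD(2-5) M Q in \<open>auto simp: lmodule_simps\<close>)
qed

lemma fg_module_mquot:
  fixes scale :: "'k::field \<Rightarrow> 'a::ring_1 \<Rightarrow> 'a" and M :: "('a, 'm) module"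
  assumes "fd_algebra scale" "fg_module M" "lsubmodule Z M" "lsubmodule B M"
  shows "fg_module (mquot M Z B)"
proof (rule fg_module_image)
  show "fg_module (restr M Z)" by (rule fg_module_restr[OF assms(1-3)])
  note Q = mquot[OF fg_lmodule[OF assms(2)] assms(3,4)]
  show "lmodule (mquot M Z B)" "(\<lambda>x. B +>\<^bsub>M\<^esub> x) \<in> mhom (restr M Z) (mquot M Z B)" by (rule Q)+
qed (simp add: mquot_def)

text \<open>Two preimages of one element differ by an element of the kernel of \<open>g\<close>, on
  which \<open>p\<close> vanishes; hence the chosen preimage does not matter. Used for any
  surjection in place of a literal quotient map.\<close>

lemma mhom_factor_surj:
  assumes B: "lmodule B" and C: "lmodule C" and D: "lmodule D"
    and g: "g \<in> mhom B C" "g ` carrier B = carrier C" and p: "p \<in> mhom B D"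
    and ker: "\<And>b. b \<in> carrier B \<Longrightarrow> g b = \<zero>\<^bsub>C\<^esub> \<Longrightarrow> p b = \<zero>\<^bsub>D\<^esub>"
  obtains s where "s \<in> mhom C D" "\<And>b. b \<in> carrier B \<Longrightarrow> s (g b) = p b"
proof -
  define s where "s c = p (SOME b. b \<in> carrier B \<and> g b = c)" for c
  have s: "s (g b) = p b" if b: "b \<in> carrier B" for b
  proof -
    let ?b = "SOME b'. b' \<in> carrier B \<and> g b' = g b"
    have b': "?b \<in> carrier B" "g ?b = g b"
      using someI[of "\<lambda>b'. b' \<in> carrier B \<and> g b' = g b" b] b by auto
    then have "p (?b \<oplus>\<^bsub>B\<^esub> \<ominus>\<^bsub>B\<^esub> b) = \<zero>\<^bsub>D\<^esub>"
      using b B C mhomD(1)[OF g(1) b] by (intro ker) (simp_all add: mhom_simps[OF g(1)] lmodule_group)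
    then show ?thesis
      using b b' B D mhomD(1)[OF p] by (simp add: s_def mhom_simps[OF p] lmodule_group lmodule_diff_zero_iff)
  qed
  have "s \<in> mhom C D"
  proof (rule mhomI)
    fix c assume "c \<in> carrier C"
    then obtain b where b: "b \<in> carrier B" "c = g b" using g(2) by auto
    then show "s c \<in> carrier D" using s mhomD(1)[OF p] by simp
    show "s (a \<odot>\<^bsub>C\<^esub> c) = a \<odot>\<^bsub>D\<^esub> s c" for a
      using b s[of "a \<odot>\<^bsub>B\<^esub> b"] s[of b] mhomD(3)[OF p b(1)] mhomD(3)[OF g(1) b(1)] lmoduleD(2)[OF B b(1)]
      by simp
    fix c' assume "c' \<in> carrier C"
    then obtain b' where b': "b' \<in> carrier B" "c' = g b'" using g(2) by auto
    show "s (c \<oplus>\<^bsub>C\<^esub> c') = s c \<oplus>\<^bsub>D\<^esub> s c'"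
      using b b' s[of "b \<oplus>\<^bsub>B\<^esub> b'"] s[of b] s[of b'] mhomD(2)[OF p b(1) b'(1)] mhomD(2)[OF g(1) b(1) b'(1)]
        lmodule_group(2)[OF B b(1) b'(1)]
      by simp
  qed
  then show thesis using s by (rule that)
qed

section \<open>Sums of homomorphisms, maps of products, and pushouts\<close>

lemma mhom_restr_carrier: "mhom (restr M (carrier M)) N = mhom M N"
  by (simp add: mhom_def)

lemma mhom_add:
  assumes "lmodule N" "f \<in> mhom M N" "g \<in> mhom M N"
  shows "(\<lambda>x. f x \<oplus>\<^bsub>N\<^esub> g x) \<in> mhom M N"
  using assms by (intro mhomI) (simp_all add: mhomD lmodule_simps)

lemma mhom_uminus:
  assumes "lmodule N" "f \<in> mhom M N"
  shows "(\<lambda>x. \<ominus>\<^bsub>N\<^esub> f x) \<in> mhom M N"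
  using assms by (intro mhomI) (simp_all add: mhomD lmodule_simps)

lemma mhom_pair:
  assumes "f \<in> mhom M A" "g \<in> mhom M B"
  shows "(\<lambda>x. (f x, g x)) \<in> mhom M (mprod A B)"
  using assms by (intro mhomI) (simp_all add: mhomD)

lemma mhom_fst: "fst \<in> mhom (mprod A B) A" and mhom_snd: "snd \<in> mhom (mprod A B) B"
  by (rule mhomI; auto)+

lemma mhom_in_left:
  assumes "lmodule A" "lmodule B" shows "(\<lambda>x. (x, \<zero>\<^bsub>B\<^esub>)) \<in> mhom A (mprod A B)"
  by (intro mhom_pair mhom_id mhom_const_zero assms)

lemma mhom_in_right:
  assumes "lmodule A" "lmodule B" shows "(\<lambda>x. (\<zero>\<^bsub>A\<^esub>, x)) \<in> mhom B (mprod A B)"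
  by (intro mhom_pair mhom_id mhom_const_zero assms)

text \<open>Besides the universal property this keeps the generators and relations of the usual
  construction, the quotient of Y \<oplus> B by the pairs (h a, - f a). Exactness of the pushed-out
  sequence is read off from them.\<close>

definition is_pushout :: "('a::ring_1, 'u) module \<Rightarrow> ('u \<Rightarrow> 'v) \<Rightarrow> ('a, 'v) module \<Rightarrow> ('u \<Rightarrow> 'w) \<Rightarrow> ('a, 'w) module \<Rightarrow>
    ('a, 'c) module \<Rightarrow> ('w \<Rightarrow> 'c) \<Rightarrow> ('v \<Rightarrow> 'c) \<Rightarrow> bool" where
  "is_pushout A f B h Y E iY iB \<longleftrightarrow> fg_module E \<and> iY \<in> mhom Y E \<and> iB \<in> mhom B E \<and>
    (\<forall>a\<in>carrier A. iY (h a) = iB (f a)) \<and>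
    (\<forall>e\<in>carrier E. \<exists>y\<in>carrier Y. \<exists>b\<in>carrier B. e = iY y \<oplus>\<^bsub>E\<^esub> iB b) \<and>
    (\<forall>y\<in>carrier Y. \<forall>b\<in>carrier B. iY y \<oplus>\<^bsub>E\<^esub> iB b = \<zero>\<^bsub>E\<^esub> \<longrightarrow>
      (\<exists>a\<in>carrier A. y = h a \<and> b = \<ominus>\<^bsub>B\<^esub> f a)) \<and>
    (\<forall>(C :: ('a, 'c) module) u v. lmodule C \<and> u \<in> mhom Y C \<and> v \<in> mhom B C \<and>
      (\<forall>a\<in>carrier A. u (h a) = v (f a)) \<longrightarrow>
      (\<exists>p\<in>mhom E C. (\<forall>y\<in>carrier Y. p (iY y) = u y) \<and> (\<forall>b\<in>carrier B. p (iB b) = v b)))"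

lemma pushout_exists:
  fixes scale :: "'k::field \<Rightarrow> 'a::ring_1 \<Rightarrow> 'a" and \<iota> :: "'k list \<Rightarrow> 'c"
    and A :: "('a, 'u) module" and B :: "('a, 'v) module" and Y :: "('a, 'w) module"
  assumes alg: "fd_algebra scale" and \<iota>: "inj \<iota>"
    and A: "lmodule A" and B: "fg_module B" and Y: "fg_module Y"
    and f: "f \<in> mhom A B" and h: "h \<in> mhom A Y"
  obtains E :: "('a, 'c) module" and iY iB where "is_pushout A f B h Y E iY iB"
proof -
  note LB = fg_lmodule[OF B] and LY = fg_lmodule[OF Y]
  let ?P = "mprod Y B"
  note P = fg_module_mprod[OF Y B]
  note LP = fg_lmodule[OF P]
  have r: "(\<lambda>a. (h a, \<ominus>\<^bsub>B\<^esub> f a)) \<in> mhom A ?P" by (intro mhom_pair h mhom_uminus LB f)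
  define R where "R = (\<lambda>a. (h a, \<ominus>\<^bsub>B\<^esub> f a)) ` carrier A"
  have R: "lsubmodule R ?P" unfolding R_def by (rule lsubmodule_image[OF r A LP lsubmodule_carrier[OF A]])
  note PP = lsubmodule_carrier[OF LP]
  let ?Q = "mquot ?P (carrier ?P) R"
  have fgQ: "fg_module ?Q" by (rule fg_module_mquot[OF alg P PP R])
  note LQ = fg_lmodule[OF fgQ]
  define q where "q = (\<lambda>x. R +>\<^bsub>?P\<^esub> x)"
  have q: "q \<in> mhom ?P ?Q" using mquot(2)[OF LP PP R] unfolding q_def mhom_restr_carrier .
  have qsurj: "q ` carrier ?P = carrier ?Q" by (simp add: q_def mquot_def)
  have q0: "q x = \<zero>\<^bsub>?Q\<^esub> \<longleftrightarrow> x \<in> R" if "x \<in> carrier ?P" for x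
  proof -
    have z: "\<zero>\<^bsub>?P\<^esub> \<in> carrier ?P" by (rule lmodule_group(1)[OF LP])
    have "\<And>b. b \<in> R \<Longrightarrow> b \<oplus>\<^bsub>?P\<^esub> \<zero>\<^bsub>?P\<^esub> = b" by (rule lmodule_group(5)[OF LP lsubmoduleD(3)[OF R]])
    then show ?thesis unfolding q_def mquot_simps(2)[OF LP R] coset_eq_iff[OF LP R that z] by metis
  qed
  obtain E :: "('a, 'c) module" and j k where E: "fg_module E"
    and j: "j \<in> mhom ?Q E" and k: "k \<in> mhom E ?Q" and bij: "bij_betw k (carrier E) (carrier ?Q)"
    and kj: "\<And>x. x \<in> carrier ?Q \<Longrightarrow> k (j x) = x" and jk: "\<And>x. x \<in> carrier E \<Longrightarrow> j (k x) = x"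
    using fg_module_copy[OF alg \<iota> fgQ] by blast
  note LE = fg_lmodule[OF E]
  have jq: "(\<lambda>x. j (q x)) \<in> mhom ?P E" by (rule mhom_comp[OF q j])
  have jq0: "j (q x) = \<zero>\<^bsub>E\<^esub> \<longleftrightarrow> x \<in> R" if "x \<in> carrier ?P" for x
    using q0[OF that] kj[OF mhomD(1)[OF q that]] mhom_zero[OF k LE LQ] mhom_zero[OF j LQ LE] by metis
  have jqs: "(\<lambda>x. j (q x)) ` carrier ?P = carrier E"
  proof -
    have "j ` carrier ?Q = carrier E" using mhomD(1)[OF j] mhomD(1)[OF k] jk by (metis image_eqI subsetI subset_antisym image_subsetI)
    then show ?thesis by (simp only: qsurj[symmetric] image_image)
  qed
  let ?iY = "\<lambda>y. j (q (y, \<zero>\<^bsub>B\<^esub>))" and ?iB = "\<lambda>b. j (q (\<zero>\<^bsub>Y\<^esub>, b))"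
  have iY: "?iY \<in> mhom Y E" by (rule mhom_comp[OF mhom_in_left[OF LY LB] jq])
  have iB: "?iB \<in> mhom B E" by (rule mhom_comp[OF mhom_in_right[OF LY LB] jq])
  have split: "?iY y \<oplus>\<^bsub>E\<^esub> ?iB b = j (q (y, b))" if "y \<in> carrier Y" "b \<in> carrier B" for y b
    using that mhomD(2)[OF jq, of "(y, \<zero>\<^bsub>B\<^esub>)" "(\<zero>\<^bsub>Y\<^esub>, b)"] LY LB by (simp add: lmodule_group)
  have "is_pushout A f B h Y E ?iY ?iB"
    unfolding is_pushout_def
  proof (intro conjI E iY iB ballI allI impI; (elim conjE)?)
    show "?iY (h a) = ?iB (f a)" if a: "a \<in> carrier A" for a
    proof -
      have c: "h a \<in> carrier Y" "f a \<in> carrier B" using a mhomD(1)[OF h] mhomD(1)[OF f] by auto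
      have "?iY (h a) \<oplus>\<^bsub>E\<^esub> ?iB (\<ominus>\<^bsub>B\<^esub> f a) = \<zero>\<^bsub>E\<^esub>"
        using a c LB by (subst split) (auto simp: jq0 R_def lmodule_group)
      then show ?thesis using c mhom_neg[OF iB LB LE c(2)] mhomD(1)[OF iY c(1)] mhomD(1)[OF iB c(2)]
        by (simp add: lmodule_diff_zero_iff[OF LE])
    qed
    show "\<exists>y\<in>carrier Y. \<exists>b\<in>carrier B. e = ?iY y \<oplus>\<^bsub>E\<^esub> ?iB b" if "e \<in> carrier E" for e
    proof -
      have "e \<in> (\<lambda>x. j (q x)) ` carrier ?P" using that jqs by simp
      then obtain y b where "y \<in> carrier Y" "b \<in> carrier B" "e = j (q (y, b))" by auto
      then show ?thesis using split by metis
    qed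
    show "\<exists>a\<in>carrier A. y = h a \<and> b = \<ominus>\<^bsub>B\<^esub> f a"
      if "y \<in> carrier Y" "b \<in> carrier B" "?iY y \<oplus>\<^bsub>E\<^esub> ?iB b = \<zero>\<^bsub>E\<^esub>" for y b
    proof -
      have "(y, b) \<in> R" using that split jq0[of "(y, b)"] by simp
      then show ?thesis by (auto simp: R_def)
    qed
  next
    fix C :: "('a, 'c) module" and u v
    assume C: "lmodule C" and u: "u \<in> mhom Y C" and v: "v \<in> mhom B C"
      and uv': "\<forall>a\<in>carrier A. u (h a) = v (f a)"
    then have uv: "\<And>a. a \<in> carrier A \<Longrightarrow> u (h a) = v (f a)" by simp
    have p0: "(\<lambda>x. u (fst x) \<oplus>\<^bsub>C\<^esub> v (snd x)) \<in> mhom ?P C"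
      by (intro mhom_add C mhom_comp[OF mhom_fst u] mhom_comp[OF mhom_snd v])
    obtain p where p: "p \<in> mhom E C" "\<And>x. x \<in> carrier ?P \<Longrightarrow> p (j (q x)) = u (fst x) \<oplus>\<^bsub>C\<^esub> v (snd x)"
    proof (rule mhom_factor_surj[OF LP LE C jq jqs p0])
      fix x assume x: "x \<in> carrier ?P" "j (q x) = \<zero>\<^bsub>E\<^esub>"
      then obtain a where a: "a \<in> carrier A" "x = (h a, \<ominus>\<^bsub>B\<^esub> f a)" using jq0 by (auto simp: R_def)
      then show "u (fst x) \<oplus>\<^bsub>C\<^esub> v (snd x) = \<zero>\<^bsub>C\<^esub>"
        using uv[OF a(1)] mhomD(1)[OF f a(1)] mhomD(1)[OF v] C mhom_neg[OF v LB C]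
        by (simp add: lmodule_group)
    qed blast
    have "p (?iY y) = u y" if "y \<in> carrier Y" for y
      using p(2)[of "(y, \<zero>\<^bsub>B\<^esub>)"] that LB LY C mhomD(1)[OF u] mhom_zero[OF v LB C] by (simp add: lmodule_group)
    moreover have "p (?iB b) = v b" if "b \<in> carrier B" for b
      using p(2)[of "(\<zero>\<^bsub>Y\<^esub>, b)"] that LB LY C mhomD(1)[OF v] mhom_zero[OF u LY C] by (simp add: lmodule_group)
    ultimately show "\<exists>p\<in>mhom E C. (\<forall>y\<in>carrier Y. p (?iY y) = u y) \<and> (\<forall>b\<in>carrier B. p (?iB b) = v b)"
      using p(1) by blast
  qed
  then show thesis by (rule that)
qed


subsection \<open>Auslander-Reiten sequences from right almost split maps\<close>

lemma short_exactD:
  assumes "short_exact A f B g C"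
  shows "fg_module A" "fg_module B" "fg_module C" "lmodule A" "lmodule B" "lmodule C"
    "f \<in> mhom A B" "g \<in> mhom B C" "inj_on f (carrier A)" "g ` carrier B = carrier C"
    "a \<in> carrier A \<Longrightarrow> g (f a) = \<zero>\<^bsub>C\<^esub>"
    "b \<in> carrier B \<Longrightarrow> g b = \<zero>\<^bsub>C\<^esub> \<Longrightarrow> \<exists>a\<in>carrier A. b = f a"
  using assms by (auto simp: short_exact_def fg_lmodule)

text \<open>\<open>f\<close> identifies \<open>A\<close> with the kernel of \<open>g\<close>, so its
  inverse can be applied after \<open>p\<close>.\<close>

lemma short_exact_kernel_lift:
  assumes ex: "short_exact A f B g C" and Y: "lmodule Y" and p: "p \<in> mhom Y B"
    and 0: "\<And>y. y \<in> carrier Y \<Longrightarrow> g (p y) = \<zero>\<^bsub>C\<^esub>"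
  obtains r where "r \<in> mhom Y A" "\<And>y. y \<in> carrier Y \<Longrightarrow> f (r y) = p y"
proof -
  note S = short_exactD[OF ex]
  let ?K = "{b \<in> carrier B. g b = \<zero>\<^bsub>C\<^esub>}"
  have K: "f ` carrier A = ?K" using ex by (simp add: short_exact_def)
  have sub: "?K \<subseteq> carrier B" by auto
  have f: "f \<in> mhom A (restr B ?K)" using mhom_restr[OF S(7) subset_refl, of ?K] K by (auto simp: mhom_def)
  have bij: "bij_betw f (carrier A) (carrier (restr B ?K))" using S(9) K by (simp add: bij_betw_def)
  have pK: "p \<in> mhom Y (restr B ?K)" using p 0 by (auto simp: mhom_def)
  note i = mhom_inv[OF S(4) f bij]
  show thesis
  proof (rule that)
    show "(\<lambda>y. the_inv_into (carrier A) f (p y)) \<in> mhom Y A" by (rule mhom_comp[OF pK i])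
    show "f (the_inv_into (carrier A) f (p y)) = p y" if "y \<in> carrier Y" for y
      by (rule f_the_inv_into_f[OF S(9)]) (use K mhomD(1)[OF pK that] in simp)
  qed
qed

text \<open>If \<open>r\<close> retracts \<open>f\<close>, then b - f (r b) vanishes on the image of
  \<open>f\<close>, hence factors through \<open>g\<close>; the factor is a section because
  \<open>g\<close> kills f (r b).\<close>

lemma split_mono_imp_split_epi:
  assumes ex: "short_exact A f B g C" and f: "split_mono A B f"
  shows "split_epi B C g"
proof -
  note S = short_exactD[OF ex]
  obtain r where r: "r \<in> mhom B A" "\<And>a. a \<in> carrier A \<Longrightarrow> r (f a) = a" using f by (auto simp: split_mono_def)
  have fr: "(\<lambda>b. f (r b)) \<in> mhom B B" by (rule mhom_comp[OF r(1) S(7)])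
  have p: "(\<lambda>b. b \<oplus>\<^bsub>B\<^esub> \<ominus>\<^bsub>B\<^esub> f (r b)) \<in> mhom B B"
    by (intro mhom_add mhom_uminus mhom_id fr S)
  obtain s where s: "s \<in> mhom C B" "\<And>b. b \<in> carrier B \<Longrightarrow> s (g b) = b \<oplus>\<^bsub>B\<^esub> \<ominus>\<^bsub>B\<^esub> f (r b)"
  proof (rule mhom_factor_surj[OF S(5,6,5,8,10) p])
    fix b assume "b \<in> carrier B" "g b = \<zero>\<^bsub>C\<^esub>"
    then obtain a where "a \<in> carrier A" "b = f a" using S(12) by blast
    then show "b \<oplus>\<^bsub>B\<^esub> \<ominus>\<^bsub>B\<^esub> f (r b) = \<zero>\<^bsub>B\<^esub>" using r(2) mhomD(1)[OF S(7)] S(5) by (simp add: lmodule_group)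
  qed blast
  have "g (s (g b)) = g b" if b: "b \<in> carrier B" for b
  proof -
    have c: "r b \<in> carrier A" "f (r b) \<in> carrier B" "g b \<in> carrier C"
      using mhomD(1)[OF r(1) b] mhomD(1)[OF fr b] mhomD(1)[OF S(8) b] by auto
    show ?thesis
      using b c S(5,6,11) by (simp add: s mhomD(2)[OF S(8)] mhom_neg[OF S(8)] lmodule_group)
  qed
  then have "g (s c) = c" if "c \<in> carrier C" for c using that unfolding S(10)[symmetric] by auto
  then show ?thesis using s(1) S(8) by (auto simp: split_epi_def)
qed

text \<open>The pushout of the sequence along \<open>h: A \<rightarrow> Y\<close> either splits, and then \<open>h\<close> extends to
  \<open>B\<close>, or maps to the original sequence over \<open>C\<close>. In the second case minimality makes the composite
  endomorphism of \<open>B\<close>, and hence of \<open>A\<close>, invertible, so that \<open>h\<close> is a split monomorphism.\<close>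

lemma left_almost_split_if_right_minimal:
  fixes scale :: "'k::field \<Rightarrow> 'a::ring_1 \<Rightarrow> 'a" and \<iota> :: "'k list \<Rightarrow> 'c" and A B C :: "('a, 'c) module"
  assumes alg: "fd_algebra scale" and \<iota>: "inj \<iota>"
    and ex: "short_exact A f B g C" and ras: "right_almost_split B C g"
    and min: "\<And>\<phi>. \<phi> \<in> mhom B B \<Longrightarrow> (\<And>b. b \<in> carrier B \<Longrightarrow> g (\<phi> b) = g b) \<Longrightarrow>
      bij_betw \<phi> (carrier B) (carrier B)"
  shows "left_almost_split A B f"
proof -
  note S = short_exactD[OF ex]
  have ns: "\<not> split_mono A B f" using split_mono_imp_split_epi[OF ex] ras by (auto simp: right_almost_split_def)
  have "\<exists>h'\<in>mhom B Y. \<forall>x\<in>carrier A. h' (f x) = h x"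
    if Y: "fg_module Y" and h: "h \<in> mhom A Y" and nh: "\<not> split_mono A Y h" for Y :: "('a, 'c) module" and h
  proof -
    note LY = fg_lmodule[OF Y]
    obtain E :: "('a, 'c) module" and iY iB where po: "is_pushout A f B h Y E iY iB"
      using pushout_exists[OF alg \<iota> S(4,2) Y S(7) h] .
    have E: "fg_module E" and iY: "iY \<in> mhom Y E" and iB: "iB \<in> mhom B E"
      using po by (auto simp: is_pushout_def)
    have com: "iY (h a) = iB (f a)" if "a \<in> carrier A" for a
      using po that unfolding is_pushout_def by blast
    have gen: "\<exists>y\<in>carrier Y. \<exists>b\<in>carrier B. e = iY y \<oplus>\<^bsub>E\<^esub> iB b" if "e \<in> carrier E" for e
      using po that unfolding is_pushout_def by blast
    have rel: "\<exists>a\<in>carrier A. y = h a \<and> b = \<ominus>\<^bsub>B\<^esub> f a"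
      if "y \<in> carrier Y" "b \<in> carrier B" "iY y \<oplus>\<^bsub>E\<^esub> iB b = \<zero>\<^bsub>E\<^esub>" for y b
      using po that unfolding is_pushout_def by blast
    note LE = fg_lmodule[OF E]
    \<comment> \<open>Zero on \<open>Y\<close> and \<open>g\<close> on \<open>B\<close> agree along
      \<open>A\<close> because \<open>g\<close> kills the image of \<open>f\<close>.\<close>
    obtain p where p: "p \<in> mhom E C" "\<And>y. y \<in> carrier Y \<Longrightarrow> p (iY y) = \<zero>\<^bsub>C\<^esub>"
        "\<And>b. b \<in> carrier B \<Longrightarrow> p (iB b) = g b"
    proof -
      have "\<exists>p\<in>mhom E C. (\<forall>y\<in>carrier Y. p (iY y) = \<zero>\<^bsub>C\<^esub>) \<and> (\<forall>b\<in>carrier B. p (iB b) = g b)"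
        using po S(6,8,11) mhom_const_zero[OF S(6), of Y] unfolding is_pushout_def by simp
      then show thesis using that by blast
    qed
    have exE: "short_exact Y iY E p C"
    proof -
      have "inj_on iY (carrier Y)"
      proof (subst mhom_inj_iff[OF iY LY LE], intro ballI impI)
        fix y assume y: "y \<in> carrier Y" "iY y = \<zero>\<^bsub>E\<^esub>"
        then have "iY y \<oplus>\<^bsub>E\<^esub> iB \<zero>\<^bsub>B\<^esub> = \<zero>\<^bsub>E\<^esub>" using mhom_zero[OF iB S(5) LE] LE by (simp add: lmodule_group)
        then obtain a where a: "a \<in> carrier A" "y = h a" "\<zero>\<^bsub>B\<^esub> = \<ominus>\<^bsub>B\<^esub> f a"
          using rel[OF y(1)] S(5) lmodule_group(1) by blast
        then have "f a = \<zero>\<^bsub>B\<^esub>" using mhomD(1)[OF S(7) a(1)] S(5) by (metis lmodule_group(10,11))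
        then have "a = \<zero>\<^bsub>A\<^esub>" using mhom_inj_iff[OF S(7,4,5)] S(9) a(1) by auto
        then show "y = \<zero>\<^bsub>Y\<^esub>" using a mhom_zero[OF h S(4) LY] by simp
      qed
      moreover have "iY ` carrier Y = {e \<in> carrier E. p e = \<zero>\<^bsub>C\<^esub>}"
      proof
        show "iY ` carrier Y \<subseteq> {e \<in> carrier E. p e = \<zero>\<^bsub>C\<^esub>}" using p(2) mhomD(1)[OF iY] by auto
        show "{e \<in> carrier E. p e = \<zero>\<^bsub>C\<^esub>} \<subseteq> iY ` carrier Y"
        proof clarify
          fix e assume e: "e \<in> carrier E" "p e = \<zero>\<^bsub>C\<^esub>"
          obtain y b where yb: "y \<in> carrier Y" "b \<in> carrier B" "e = iY y \<oplus>\<^bsub>E\<^esub> iB b" using gen[OF e(1)] by blast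
          then have "g b = \<zero>\<^bsub>C\<^esub>" using e(2) mhomD(2)[OF p(1)] mhomD(1)[OF iY] mhomD(1)[OF iB]
            p(2,3) mhomD(1)[OF S(8)] S(6) by (simp add: lmodule_group)
          then obtain a where a: "a \<in> carrier A" "b = f a" using S(12) yb by blast
          then have "e = iY (y \<oplus>\<^bsub>Y\<^esub> h a)" using yb com mhomD(2)[OF iY] mhomD(1)[OF h] by simp
          then show "e \<in> iY ` carrier Y" using yb(1) mhomD(1)[OF h a(1)] LY by (simp add: lmodule_group)
        qed
      qed
      moreover have "p ` carrier E = carrier C"
      proof -
        have "carrier C \<subseteq> p ` carrier E"
        proof
          fix c assume "c \<in> carrier C"
          then obtain b where "b \<in> carrier B" "c = g b" unfolding S(10)[symmetric] by blast
          then show "c \<in> p ` carrier E" using p(3) mhomD(1)[OF iB] by (intro image_eqI[of c p "iB b"]) simp_all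
        qed
        then show ?thesis using mhomD(1)[OF p(1)] by auto
      qed
      ultimately show ?thesis using Y E S(3) iY p(1) by (simp add: short_exact_def)
    qed
    show ?thesis
    proof (cases "split_epi E C p")
      case True
      then obtain s where s: "s \<in> mhom C E" "\<And>c. c \<in> carrier C \<Longrightarrow> p (s c) = c" by (auto simp: split_epi_def)
      \<comment> \<open>Both terms have the same image g b under \<open>p\<close>, so the difference
        comes from \<open>Y\<close>. On f a the term with \<open>s\<close> vanishes and what is left
        is iB (f a) = iY (h a), so the map obtained extends \<open>h\<close>.\<close>
      let ?\<sigma> = "\<lambda>b. iB b \<oplus>\<^bsub>E\<^esub> \<ominus>\<^bsub>E\<^esub> s (g b)"
      have \<sigma>: "?\<sigma> \<in> mhom B E" by (intro mhom_add mhom_uminus LE iB mhom_comp[OF S(8) s(1)])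
      obtain h' where h': "h' \<in> mhom B Y" "\<And>b. b \<in> carrier B \<Longrightarrow> iY (h' b) = ?\<sigma> b"
      proof (rule short_exact_kernel_lift[OF exE S(5) \<sigma>])
        fix b assume b: "b \<in> carrier B"
        then show "p (?\<sigma> b) = \<zero>\<^bsub>C\<^esub>"
          using mhomD(1)[OF S(8) b] mhomD(1)[OF s(1)] mhomD(1)[OF iB b] LE S(6)
          by (simp add: mhomD(2)[OF p(1)] mhom_neg[OF p(1)] p(3) s(2) lmodule_group)
      qed blast
      have "h' (f a) = h a" if a: "a \<in> carrier A" for a
      proof -
        have fa: "f a \<in> carrier B" "h a \<in> carrier Y" using mhomD(1)[OF S(7) a] mhomD(1)[OF h a] by auto
        have "iY (h' (f a)) = iY (h a)"
          using h'(2)[OF fa(1)] S(11)[OF a] com[OF a] mhomD(1)[OF iB fa(1)] LE mhom_zero[OF s(1) S(6) LE]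
          by (simp add: lmodule_group)
        moreover have "inj_on iY (carrier Y)" using exE by (simp add: short_exact_def)
        ultimately show ?thesis using fa mhomD(1)[OF h'(1) fa(1)] by (simp add: inj_on_eq_iff)
      qed
      with h'(1) show ?thesis by blast
    next
      case False
      then obtain q where q: "q \<in> mhom E B" "\<And>e. e \<in> carrier E \<Longrightarrow> g (q e) = p e"
        using ras E p(1) unfolding right_almost_split_def by blast
      \<comment> \<open>An endomorphism of \<open>B\<close> over \<open>C\<close>, hence bijective
        by minimality. Following \<open>q\<close> by its inverse gives a map from \<open>E\<close>
        to \<open>B\<close> over \<open>C\<close> that is the identity on \<open>B\<close>;
        restricted to \<open>Y\<close> it lands in the kernel of \<open>g\<close>, that is in
        \<open>A\<close>, and is a retraction of \<open>h\<close>.\<close>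
      let ?\<beta> = "\<lambda>b. q (iB b)"
      have \<beta>: "?\<beta> \<in> mhom B B" by (rule mhom_comp[OF iB q(1)])
      have g\<beta>: "g (?\<beta> b) = g b" if "b \<in> carrier B" for b using that q(2) p(3) mhomD(1)[OF iB] by simp
      have bij: "bij_betw ?\<beta> (carrier B) (carrier B)" by (rule min[OF \<beta> g\<beta>])
      define \<beta>' where "\<beta>' = the_inv_into (carrier B) ?\<beta>"
      have \<beta>': "\<beta>' \<in> mhom B B" unfolding \<beta>'_def by (rule mhom_inv[OF S(5) \<beta> bij])
      have bb: "\<beta>' (?\<beta> b) = b" if "b \<in> carrier B" for b
        unfolding \<beta>'_def using bij that by (intro the_inv_into_f_f) (auto simp: bij_betw_def)
      have bb': "?\<beta> (\<beta>' b) = b" if "b \<in> carrier B" for b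
        unfolding \<beta>'_def using bij that by (intro f_the_inv_into_f_bij_betw) auto
      have g\<beta>': "g (\<beta>' b) = g b" if "b \<in> carrier B" for b
        using g\<beta>[OF mhomD(1)[OF \<beta>' that]] bb'[OF that] by simp
      have qY: "(\<lambda>y. q (iY y)) \<in> mhom Y B" by (rule mhom_comp[OF iY q(1)])
      have pr: "(\<lambda>y. \<beta>' (q (iY y))) \<in> mhom Y B" by (rule mhom_comp[OF qY \<beta>'])
      obtain r where r: "r \<in> mhom Y A" "\<And>y. y \<in> carrier Y \<Longrightarrow> f (r y) = \<beta>' (q (iY y))"
      proof (rule short_exact_kernel_lift[OF ex LY pr])
        fix y assume y: "y \<in> carrier Y"
        show "g (\<beta>' (q (iY y))) = \<zero>\<^bsub>C\<^esub>"
          using g\<beta>'[OF mhomD(1)[OF qY y]] q(2)[OF mhomD(1)[OF iY y]] p(2)[OF y] by simp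
      qed blast
      have "r (h a) = a" if a: "a \<in> carrier A" for a
      proof -
        have "f (r (h a)) = f a"
          using r(2)[OF mhomD(1)[OF h a]] com[OF a] bb[OF mhomD(1)[OF S(7) a]] by simp
        then show ?thesis using S(9) a mhomD(1)[OF r(1) mhomD(1)[OF h a]] by (simp add: inj_on_eq_iff)
      qed
      then have "split_mono A Y h" using h r(1) by (auto simp: split_mono_def)
      with nh show ?thesis by simp
    qed
  qed
  with ns S(7) show ?thesis by (auto simp: left_almost_split_def)
qed

text \<open>Among the endomorphisms \<open>e\<close> of \<open>B\<close> over \<open>C\<close>, one that maximises the length of
  the kernel minus the length of the image satisfies \<open>ker e\<^sup>2 = ker e\<close> and \<open>im e\<^sup>2 = im e\<close>.\<close>

lemma right_minimal_version:
  fixes scale :: "'k::field \<Rightarrow> 'a::ring_1 \<Rightarrow> 'a" and B :: "('a, 'm) module" (structure) and C :: "('a, 'n) module"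
  assumes alg: "fd_algebra scale" and B: "fg_module B"
  obtains e where "e \<in> mhom B B" "\<And>b. b \<in> carrier B \<Longrightarrow> g (e b) = g b"
    "\<And>b. b \<in> e ` carrier B \<Longrightarrow> e b = \<zero> \<Longrightarrow> b = \<zero>"
    "\<And>b. b \<in> carrier B \<Longrightarrow> \<exists>i\<in>e ` carrier B. \<exists>k\<in>carrier B. e k = \<zero> \<and> b = i \<oplus> k"
    "\<And>\<phi>. \<phi> \<in> mhom (restr B (e ` carrier B)) (restr B (e ` carrier B)) \<Longrightarrow>
      (\<And>b. b \<in> e ` carrier B \<Longrightarrow> g (\<phi> b) = g b) \<Longrightarrow> bij_betw \<phi> (e ` carrier B) (e ` carrier B)"
proof -
  note L = fg_lmodule[OF B]
  from length_exists[OF alg B] obtain d :: "'m set \<Rightarrow> nat" where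
    "(\<forall>U V. lsubmodule U B \<longrightarrow> lsubmodule V B \<longrightarrow> U \<subset> V \<longrightarrow> d U < d V) \<and>
    (\<forall>U V. lsubmodule U B \<longrightarrow> lsubmodule V B \<longrightarrow> U \<subseteq> V \<longrightarrow> d U \<le> d V)" ..
  note d = this[THEN conjunct1, rule_format] this[THEN conjunct2, rule_format]
  define K where "K e = {b \<in> carrier B. e b = \<zero>}" for e :: "'m \<Rightarrow> 'm"
  define I where "I e = e ` carrier B" for e :: "'m \<Rightarrow> 'm"
  have K: "lsubmodule (K e) B" and I: "lsubmodule (I e) B" if "e \<in> mhom B B" for e
    using that lsubmodule_kernel[OF that L L] lsubmodule_image[OF that L L lsubmodule_carrier[OF L]]
    by (simp_all add: K_def I_def)
  define D where "D = d (carrier B)"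
  have bound: "d (K e) \<le> D" "d (I e) \<le> D" if "e \<in> mhom B B" for e
    unfolding D_def using K[OF that] I[OF that] by (auto intro!: d(2) lsubmodule_carrier L dest: lsubmoduleD(1))
  define P where "P e \<longleftrightarrow> e \<in> mhom B B \<and> (\<forall>b\<in>carrier B. g (e b) = g b)" for e
  \<comment> \<open>The difference of the two lengths, shifted by the total length \<open>D\<close>
    so that it is a natural number and truncated subtraction is exact; it never exceeds
    \<open>2 * D\<close>.\<close>
  define m where "m e = d (K e) + (D - d (I e))" for e
  have "P (\<lambda>b. b)" by (simp add: P_def mhom_id)
  moreover have "\<forall>e. P e \<longrightarrow> m e < Suc (2 * D)" using bound by (fastforce simp: P_def m_def)
  ultimately have "\<exists>e. P e \<and> (\<forall>e'. P e' \<longrightarrow> m e' \<le> m e)" by (rule ex_has_greatest_nat)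
  then obtain e where e: "P e" and max: "\<And>e'. P e' \<Longrightarrow> m e' \<le> m e" by blast
  then have eh: "e \<in> mhom B B" and eg: "\<And>b. b \<in> carrier B \<Longrightarrow> g (e b) = g b" by (auto simp: P_def)
  \<comment> \<open>Following \<open>e\<close> by an endomorphism of its image over \<open>C\<close>
    can only enlarge the kernel and shrink the image, so by maximality it changes neither. The case
    \<phi> = e gives the decomposition of \<open>B\<close>, the general case the minimality of the
    image.\<close>
  have comp: "K (\<lambda>b. \<phi> (e b)) = K e \<and> I (\<lambda>b. \<phi> (e b)) = I e"
    if \<phi>: "\<phi> \<in> mhom (restr B (I e)) (restr B (I e))" and g\<phi>: "\<And>b. b \<in> I e \<Longrightarrow> g (\<phi> b) = g b" for \<phi>
  proof -
    have "e \<in> mhom B (restr B (I e))" using eh by (auto simp: mhom_def I_def)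
    then have "(\<lambda>b. \<phi> (e b)) \<in> mhom B (restr B (I e))" using \<phi> by (rule mhom_comp)
    then have h: "(\<lambda>b. \<phi> (e b)) \<in> mhom B B"
      using lsubmoduleD(1)[OF I[OF eh]] by (rule mhom_restr_incl)
    then have P: "P (\<lambda>b. \<phi> (e b))" using g\<phi> eg by (simp add: P_def I_def)
    have sub: "I (\<lambda>b. \<phi> (e b)) \<subseteq> I e" using mhomD(1)[OF \<phi>] by (auto simp: I_def)
    have "\<phi> \<zero> = \<zero>" using mhom_zero[OF \<phi>] lmodule_restr[OF L I[OF eh]] by simp
    then have sup: "K e \<subseteq> K (\<lambda>b. \<phi> (e b))" by (auto simp: K_def)
    have le: "d (I (\<lambda>b. \<phi> (e b))) \<le> d (I e)" "d (K e) \<le> d (K (\<lambda>b. \<phi> (e b)))"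
      using sub sup by (auto intro!: d(2) I K h eh)
    have "\<not> d (K e) < d (K (\<lambda>b. \<phi> (e b)))" "\<not> d (I (\<lambda>b. \<phi> (e b))) < d (I e)"
      using max[OF P] le bound[OF eh] bound[OF h] by (auto simp: m_def)
    then show ?thesis using d(1)[OF I[OF h] I[OF eh]] d(1)[OF K[OF eh] K[OF h]] sub sup by blast
  qed
  have "e \<in> mhom (restr B (I e)) (restr B (I e))"
    using lsubmoduleD(1)[OF I[OF eh]] by (intro mhom_restr[OF eh]) (auto simp: I_def)
  then have ee: "K (\<lambda>b. e (e b)) = K e" "I (\<lambda>b. e (e b)) = I e"
    using comp[of e] eg lsubmoduleD(3)[OF I[OF eh]] by auto
  show thesis
  proof (rule that[OF eh eg])
    show "b = \<zero>" if "b \<in> e ` carrier B" "e b = \<zero>" for b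
    proof -
      obtain c where c: "c \<in> carrier B" "b = e c" using \<open>b \<in> e ` carrier B\<close> by auto
      then have "c \<in> K (\<lambda>b. e (e b))" using that(2) by (simp add: K_def)
      then show ?thesis using c by (simp add: ee K_def)
    qed
    show "\<exists>i\<in>e ` carrier B. \<exists>k\<in>carrier B. e k = \<zero> \<and> b = i \<oplus> k" if b: "b \<in> carrier B" for b
    proof -
      have "e b \<in> I (\<lambda>b. e (e b))" using b ee by (simp add: I_def)
      then obtain c where c: "c \<in> carrier B" "e b = e (e c)" by (auto simp: I_def)
      have ec: "e c \<in> carrier B" "e (e c) \<in> carrier B" using mhomD(1)[OF eh] c by auto
      have "e (b \<oplus> \<ominus> e c) = \<zero>" using b c ec L by (simp add: mhomD(2)[OF eh] mhom_neg[OF eh] lmodule_group)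
      moreover have "b = e c \<oplus> (b \<oplus> \<ominus> e c)" using b ec L by (simp add: lmodule_simps)
      moreover have "b \<oplus> \<ominus> e c \<in> carrier B" using b ec L by (simp add: lmodule_group)
      ultimately show ?thesis using c(1) by blast
    qed
    show "bij_betw \<phi> (e ` carrier B) (e ` carrier B)"
      if \<phi>: "\<phi> \<in> mhom (restr B (e ` carrier B)) (restr B (e ` carrier B))"
        and g\<phi>: "\<And>b. b \<in> e ` carrier B \<Longrightarrow> g (\<phi> b) = g b" for \<phi>
    proof -
      note c = comp[unfolded I_def, OF \<phi> g\<phi>]
      have LI: "lmodule (restr B (e ` carrier B))" using lmodule_restr[OF L I[OF eh]] by (simp add: I_def)
      have "b = \<zero>" if b: "b \<in> e ` carrier B" "\<phi> b = \<zero>" for b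
      proof -
        obtain x where "x \<in> carrier B" "b = e x" using b(1) by auto
        then have "x \<in> K (\<lambda>b. \<phi> (e b))" using b(2) by (simp add: K_def)
        then have "x \<in> K e" using c by simp
        then show ?thesis using \<open>b = e x\<close> by (simp add: K_def)
      qed
      then have "inj_on \<phi> (e ` carrier B)" using mhom_inj_iff[OF \<phi> LI LI] by simp
      moreover have "\<phi> ` e ` carrier B = e ` carrier B" using c by (simp add: image_image)
      ultimately show ?thesis by (simp add: bij_betw_def)
    qed
  qed
qed


section \<open>Splitting off a summand that lies in the kernel of the right-hand map\<close>

lemma is_direct_sum_restr:
  fixes M :: "('a::ring_1, 'm) module" (structure)
  assumes M: "lmodule M" and U: "lsubmodule U M" and V: "lsubmodule V M"
    and int: "U \<inter> V = {\<zero>}" and sum: "\<And>x. x \<in> carrier M \<Longrightarrow> \<exists>u\<in>U. \<exists>v\<in>V. x = u \<oplus> v"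
  shows "is_direct_sum M (restr M U) (\<lambda>x. x) (restr M V) (\<lambda>x. x)"
proof -
  note UD = lsubmoduleD[OF U] and VD = lsubmoduleD[OF V]
  have "inj_on (\<lambda>(x, y). x \<oplus> y) (U \<times> V)"
  proof (rule inj_onI, clarify)
    fix u v u' v' assume uv: "u \<in> U" "v \<in> V" "u' \<in> U" "v' \<in> V" and eq: "u \<oplus> v = u' \<oplus> v'"
    have c: "u \<in> carrier M" "u' \<in> carrier M" "v \<in> carrier M" "v' \<in> carrier M" using uv UD(3) VD(3) by auto
    have "u \<oplus> \<ominus> u' = (u \<oplus> v) \<oplus> (\<ominus> u' \<oplus> \<ominus> v)" using c M by (simp add: lmodule_simps)
    also have "\<dots> = v' \<oplus> \<ominus> v" unfolding eq using c M by (simp add: lmodule_simps)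
    finally have e: "u \<oplus> \<ominus> u' = v' \<oplus> \<ominus> v" .
    have "u \<oplus> \<ominus> u' \<in> U" "v' \<oplus> \<ominus> v \<in> V"
      using uv UD(4) UD(6)[OF M] VD(4) VD(6)[OF M] by auto
    then have "u \<oplus> \<ominus> u' = \<zero>" "v' \<oplus> \<ominus> v = \<zero>" using int e by auto
    then show "u = u' \<and> v = v'" using c by (auto simp: lmodule_diff_zero_iff[OF M])
  qed
  moreover have "(\<lambda>(x, y). x \<oplus> y) ` (U \<times> V) = carrier M"
    using sum UD(3) VD(3) lmodule_group(2)[OF M] by (auto simp: image_iff)
  ultimately show ?thesis using mhom_restr_dom[OF mhom_id UD(1)] mhom_restr_dom[OF mhom_id VD(1)]
    by (simp add: is_direct_sum_def bij_betw_def)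
qed

text \<open>Since g e = g, the kernel \<open>B1\<close> of \<open>e\<close> lies in the kernel of
  \<open>g\<close>. The split summand thus has zero on its right, and all of \<open>C\<close> stays
  with the image \<open>B2\<close> of \<open>e\<close>. Lifts into \<open>B\<close> are moved into
  \<open>B2\<close> by \<open>e\<close> without changing their composite with \<open>g\<close>, so
  the remaining map is still right almost split.\<close>

lemma split_or_sum_of_split_and_AR:
  fixes scale :: "'k::field \<Rightarrow> 'a::ring_1 \<Rightarrow> 'a" and \<iota> :: "'k list \<Rightarrow> 'c" and A B C :: "('a, 'c) module"
  assumes alg: "fd_algebra scale" and \<iota>: "inj \<iota>" and ex: "short_exact A f B g C"
    and lift: "\<And>(Y :: ('a, 'c) module) h. fg_module Y \<Longrightarrow> h \<in> mhom Y C \<Longrightarrow> \<not> split_epi Y C h \<Longrightarrow>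
      \<exists>h'\<in>mhom Y B. \<forall>y\<in>carrier Y. g (h' y) = h y"
  shows "split_exact A f B g C \<or> sum_of_split_and_AR A f B g C"
proof (cases "split_epi B C g")
  case True
  then show ?thesis using ex by (simp add: split_exact_def)
next
  case ns: False
  note S = short_exactD[OF ex]
  obtain e where e: "e \<in> mhom B B" and ge: "\<And>b. b \<in> carrier B \<Longrightarrow> g (e b) = g b"
    and int: "\<And>b. b \<in> e ` carrier B \<Longrightarrow> e b = \<zero>\<^bsub>B\<^esub> \<Longrightarrow> b = \<zero>\<^bsub>B\<^esub>"
    and sum: "\<And>b. b \<in> carrier B \<Longrightarrow> \<exists>i\<in>e ` carrier B. \<exists>k\<in>carrier B. e k = \<zero>\<^bsub>B\<^esub> \<and> b = i \<oplus>\<^bsub>B\<^esub> k"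
    and min: "\<And>\<phi>. \<phi> \<in> mhom (restr B (e ` carrier B)) (restr B (e ` carrier B)) \<Longrightarrow>
      (\<And>b. b \<in> e ` carrier B \<Longrightarrow> g (\<phi> b) = g b) \<Longrightarrow> bij_betw \<phi> (e ` carrier B) (e ` carrier B)"
    by (rule right_minimal_version[OF alg S(2), of g]) blast
  define B1 where "B1 = {b \<in> carrier B. e b = \<zero>\<^bsub>B\<^esub>}"
  define B2 where "B2 = e ` carrier B"
  have B1: "lsubmodule B1 B" unfolding B1_def by (rule lsubmodule_kernel[OF e S(5,5)])
  have B2: "lsubmodule B2 B" unfolding B2_def by (rule lsubmodule_image[OF e S(5,5) lsubmodule_carrier[OF S(5)]])
  note BD1 = lsubmoduleD[OF B1] and BD2 = lsubmoduleD[OF B2]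
  have gB1: "g b = \<zero>\<^bsub>C\<^esub>" if "b \<in> B1" for b
    using that ge[of b] mhom_zero[OF S(8,5,6)] by (auto simp: B1_def)
  define A1 where "A1 = {a \<in> carrier A. f a \<in> B1}"
  define A2 where "A2 = {a \<in> carrier A. f a \<in> B2}"
  have A1: "lsubmodule A1 A" and A2: "lsubmodule A2 A" unfolding A1_def A2_def
    using B1 B2 by (auto intro!: lsubmodule_vimage[OF S(7,4,5)])
  note AD1 = lsubmoduleD[OF A1] and AD2 = lsubmoduleD[OF A2]
  have intB: "B1 \<inter> B2 = {\<zero>\<^bsub>B\<^esub>}" using int BD1(2) BD2(2) by (auto simp: B1_def B2_def)
  have sumB: "\<exists>u\<in>B1. \<exists>v\<in>B2. b = u \<oplus>\<^bsub>B\<^esub> v" if b: "b \<in> carrier B" for b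
  proof -
    obtain i k where ik: "i \<in> B2" "k \<in> B1" "b = i \<oplus>\<^bsub>B\<^esub> k" using sum[OF b] by (auto simp: B1_def B2_def)
    then have "b = k \<oplus>\<^bsub>B\<^esub> i" using BD1(3) BD2(3) by (simp add: lmodule_ac(1)[OF S(5)])
    with ik show ?thesis by blast
  qed
  have intA: "A1 \<inter> A2 = {\<zero>\<^bsub>A\<^esub>}"
  proof -
    have "a = \<zero>\<^bsub>A\<^esub>" if "a \<in> A1" "a \<in> A2" for a
    proof -
      have "f a = \<zero>\<^bsub>B\<^esub>" using that intB by (auto simp: A1_def A2_def)
      then show ?thesis using S(9) that(1) mhom_inj_iff[OF S(7,4,5)] by (auto simp: A1_def)
    qed
    then show ?thesis using AD1(2) AD2(2) by blast
  qed
  \<comment> \<open>Split f a into its components in \<open>B1\<close> and \<open>B2\<close>. The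
    first is killed by \<open>g\<close>, hence so is the second, and both come from
    \<open>A\<close>.\<close>
  have sumA: "\<exists>u\<in>A1. \<exists>v\<in>A2. a = u \<oplus>\<^bsub>A\<^esub> v" if a: "a \<in> carrier A" for a
  proof -
    obtain u v where uv: "u \<in> B1" "v \<in> B2" "f a = u \<oplus>\<^bsub>B\<^esub> v" using sumB[OF mhomD(1)[OF S(7) a]] by blast
    have c: "u \<in> carrier B" "v \<in> carrier B" using uv BD1(3) BD2(3) by auto
    have "g (f a) = g v" using uv c gB1 mhomD(1)[OF S(8)] S(6) by (simp add: mhomD(2)[OF S(8)] lmodule_group)
    then have "g v = \<zero>\<^bsub>C\<^esub>" using S(11)[OF a] by simp
    then obtain a2 where a2: "a2 \<in> carrier A" "v = f a2" using S(12) c by blast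
    obtain a1 where a1: "a1 \<in> carrier A" "u = f a1" using S(12) c gB1 uv(1) by blast
    have "f a = f (a1 \<oplus>\<^bsub>A\<^esub> a2)" using uv(3) a1 a2 by (simp add: mhomD(2)[OF S(7)])
    then have "a = a1 \<oplus>\<^bsub>A\<^esub> a2" using S(9) a a1(1) a2(1) lmodule_group(2)[OF S(4)] by (simp add: inj_on_eq_iff)
    then show ?thesis using a1 a2 uv by (auto simp: A1_def A2_def)
  qed
  note dsA = is_direct_sum_restr[OF S(4) A1 A2 intA sumA]
  note dsB = is_direct_sum_restr[OF S(5) B1 B2 intB sumB]
  have dsC: "is_direct_sum C (restr C {\<zero>\<^bsub>C\<^esub>}) (\<lambda>x. x) C (\<lambda>x. x)"
    using S(6) by (auto simp: is_direct_sum_def mhom_id mhom_restr_dom[OF mhom_id] lmodule_group bij_betw_def inj_on_def image_iff)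
  have ex1: "short_exact (restr A A1) f (restr B B1) g (restr C {\<zero>\<^bsub>C\<^esub>})"
  proof -
    have "f \<in> mhom (restr A A1) (restr B B1)" by (rule mhom_restr[OF S(7) AD1(1)]) (simp add: A1_def)
    moreover have "g \<in> mhom (restr B B1) (restr C {\<zero>\<^bsub>C\<^esub>})" by (rule mhom_restr[OF S(8) BD1(1)]) (simp add: gB1)
    moreover have "inj_on f A1" using S(9) AD1(1) by (rule inj_on_subset)
    moreover have "f ` A1 = B1"
    proof
      show "B1 \<subseteq> f ` A1"
      proof
        fix b assume b: "b \<in> B1"
        then obtain a where "a \<in> carrier A" "b = f a" using S(12) BD1(3) gB1 by blast
        with b show "b \<in> f ` A1" by (auto simp: A1_def)
      qed
    qed (auto simp: A1_def)
    moreover have "g ` B1 = {\<zero>\<^bsub>C\<^esub>}" using gB1 BD1(2) by auto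
    ultimately show ?thesis using gB1
      by (auto simp: short_exact_def fg_module_restr[OF alg] S A1 B1 lsubmodule_zero)
  qed
  \<comment> \<open>The right-hand term of this summand is zero, so the zero map is a
    section.\<close>
  have "(\<lambda>c. \<zero>\<^bsub>B\<^esub>) \<in> mhom (restr C {\<zero>\<^bsub>C\<^esub>}) (restr B B1)"
    using mhom_const_zero[OF lmodule_restr[OF S(5) B1]] by simp
  moreover have "g \<zero>\<^bsub>B\<^esub> = \<zero>\<^bsub>C\<^esub>" by (rule mhom_zero[OF S(8,5,6)])
  ultimately have split1: "split_exact (restr A A1) f (restr B B1) g (restr C {\<zero>\<^bsub>C\<^esub>})"
    using ex1 short_exactD(8)[OF ex1] by (auto simp: split_exact_def split_epi_def)
  have ex2: "short_exact (restr A A2) f (restr B B2) g C"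
  proof -
    have "f \<in> mhom (restr A A2) (restr B B2)" by (rule mhom_restr[OF S(7) AD2(1)]) (simp add: A2_def)
    moreover have "g \<in> mhom (restr B B2) C" by (rule mhom_restr_dom[OF S(8) BD2(1)])
    moreover have "inj_on f A2" using S(9) AD2(1) by (rule inj_on_subset)
    moreover have "f ` A2 = {b \<in> B2. g b = \<zero>\<^bsub>C\<^esub>}"
    proof
      show "{b \<in> B2. g b = \<zero>\<^bsub>C\<^esub>} \<subseteq> f ` A2"
      proof clarify
        fix b assume b: "b \<in> B2" "g b = \<zero>\<^bsub>C\<^esub>"
        then obtain a where "a \<in> carrier A" "b = f a" using S(12) BD2(3) by blast
        with b show "b \<in> f ` A2" by (auto simp: A2_def)
      qed
    qed (use S(11) in \<open>auto simp: A2_def\<close>)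
    moreover have "g ` B2 = carrier C"
      unfolding B2_def image_image using ge S(10) by (simp add: image_def)
    ultimately show ?thesis
      by (simp add: short_exact_def fg_module_restr[OF alg] S A2 B2)
  qed
  have eB2: "e \<in> mhom B (restr B B2)" using e by (auto simp: mhom_def B2_def)
  have ras: "right_almost_split (restr B B2) C g"
    unfolding right_almost_split_def
  proof (intro conjI allI impI; (elim conjE)?)
    show "g \<in> mhom (restr B B2) C" by (rule short_exactD(8)[OF ex2])
    show "\<not> split_epi (restr B B2) C g"
    proof
      assume "split_epi (restr B B2) C g"
      then obtain s where s: "s \<in> mhom C (restr B B2)" "\<forall>c\<in>carrier C. g (s c) = c" by (auto simp: split_epi_def)
      from s(1) BD2(1) have "s \<in> mhom C B" by (rule mhom_restr_incl)
      with s(2) S(8) ns show False by (auto simp: split_epi_def)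
    qed
    fix Y :: "('a, 'c) module" and h
    assume "fg_module Y" "h \<in> mhom Y C" "\<not> split_epi Y C h"
    then obtain h' where h': "h' \<in> mhom Y B" "\<And>y. y \<in> carrier Y \<Longrightarrow> g (h' y) = h y" using lift by blast
    then have "g (e (h' y)) = h y" if "y \<in> carrier Y" for y using that ge mhomD(1)[OF h'(1)] by simp
    then show "\<exists>h'\<in>mhom Y (restr B B2). \<forall>y\<in>carrier Y. g (h' y) = h y"
      by (intro bexI[OF _ mhom_comp[OF h'(1) eB2]] ballI)
  qed
  have las: "left_almost_split (restr A A2) (restr B B2) f"
    by (rule left_almost_split_if_right_minimal[OF alg \<iota> ex2 ras]) (use min in \<open>simp add: B2_def\<close>)
  have "AR_sequence (restr A A2) f (restr B B2) g C" using ex2 las ras by (simp add: AR_sequence_def)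
  with split1 dsA dsB dsC have "sum_of_split_and_AR A f B g C"
    unfolding sum_of_split_and_AR_def by blast
  then show ?thesis ..
qed

section \<open>Complexes and homology\<close>

abbreviation chains :: "('a, 'm) cplx \<Rightarrow> int \<Rightarrow> 'm set" where
  "chains X i \<equiv> carrier (ob X i)"

lemma chain_complexD:
  assumes "chain_complex X"
  shows "lmodule (ob X i)" "bd X i \<in> mhom (ob X i) (ob X (i - 1))"
    "bd X (i + 1) \<in> mhom (ob X (i + 1)) (ob X i)"
    "x \<in> chains X (i + 1) \<Longrightarrow> bd X i (bd X (i + 1) x) = \<zero>\<^bsub>ob X (i - 1)\<^esub>"
    "x \<in> chains X i \<Longrightarrow> bd X (i - 1) (bd X i x) = \<zero>\<^bsub>ob X (i - 2)\<^esub>"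
proof -
  have *: "lmodule (ob X i)" "bd X i \<in> mhom (ob X i) (ob X (i - 1))"
    "x \<in> chains X i \<Longrightarrow> bd X (i - 1) (bd X i x) = \<zero>\<^bsub>ob X (i - 2)\<^esub>" for i x
    using assms unfolding chain_complex_def by blast+
  show "lmodule (ob X i)" "bd X i \<in> mhom (ob X i) (ob X (i - 1))"
    "x \<in> chains X i \<Longrightarrow> bd X (i - 1) (bd X i x) = \<zero>\<^bsub>ob X (i - 2)\<^esub>"
    by (fact *)+
  show "bd X (i + 1) \<in> mhom (ob X (i + 1)) (ob X i)" using *(2)[of "i + 1"] by simp
  show "x \<in> chains X (i + 1) \<Longrightarrow> bd X i (bd X (i + 1) x) = \<zero>\<^bsub>ob X (i - 1)\<^esub>"
    using *(3)[of x "i + 1"] by simp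
qed

lemma bounded_complexD:
  assumes "bounded_complex X"
  shows "chain_complex X" "fg_module (ob X i)"
  using assms by (auto simp: bounded_complex_def)

lemma chain_mapD:
  assumes "chain_map X Y f"
  shows "f i \<in> mhom (ob X i) (ob Y i)"
    "x \<in> chains X i \<Longrightarrow> bd Y i (f i x) = f (i - 1) (bd X i x)"
    "x \<in> chains X (i + 1) \<Longrightarrow> bd Y (i + 1) (f (i + 1) x) = f i (bd X (i + 1) x)"
proof -
  show "f i \<in> mhom (ob X i) (ob Y i)"
    "x \<in> chains X i \<Longrightarrow> bd Y i (f i x) = f (i - 1) (bd X i x)"
    using assms by (auto simp: chain_map_def)
  show "x \<in> chains X (i + 1) \<Longrightarrow> bd Y (i + 1) (f (i + 1) x) = f i (bd X (i + 1) x)"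
    using assms unfolding chain_map_def by (metis add_diff_cancel_right')
qed

lemma chain_map_id: "chain_map X X id_map"
  by (auto simp: chain_map_def id_map_def mhom_id)

lemma chain_map_comp:
  assumes f: "chain_map X Y f" and g: "chain_map Y Z g"
  shows "chain_map X Z (comp_map g f)"
  using chain_mapD(2)[OF f] chain_mapD(2)[OF g] mhomD(1)[OF chain_mapD(1)[OF f]]
    mhom_comp[OF chain_mapD(1)[OF f] chain_mapD(1)[OF g]]
  by (simp add: chain_map_def comp_map_def)

section \<open>Homology classes of cycles and induced maps\<close>

definition hcls :: "('a::ring_1, 'm) cplx \<Rightarrow> int \<Rightarrow> 'm \<Rightarrow> 'm set" where
  "hcls X i x = boundaries X i +>\<^bsub>ob X i\<^esub> x"

lemma homology_eq_mquot: "homology X i = mquot (ob X i) (cycles X i) (boundaries X i)"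
  by (simp add: homology_def mquot_def)

lemma cyclesD:
  assumes "x \<in> cycles X i"
  shows "x \<in> chains X i" "bd X i x = \<zero>\<^bsub>ob X (i - 1)\<^esub>"
  using assms by (auto simp: cycles_def)

lemma lsubmodule_cycles: "chain_complex X \<Longrightarrow> lsubmodule (cycles X i) (ob X i)"
  unfolding cycles_def by (rule lsubmodule_kernel) (simp_all add: chain_complexD)

lemma lsubmodule_boundaries: "chain_complex X \<Longrightarrow> lsubmodule (boundaries X i) (ob X i)"
  unfolding boundaries_def
  by (rule lsubmodule_image[OF chain_complexD(3,1,1) lsubmodule_carrier[OF chain_complexD(1)]])

lemma hcls:
  assumes "chain_complex X"
  shows "hcls X i \<in> mhom (restr (ob X i) (cycles X i)) (homology X i)"
    and "carrier (homology X i) = hcls X i ` cycles X i"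
    and "\<zero>\<^bsub>homology X i\<^esub> = hcls X i \<zero>\<^bsub>ob X i\<^esub>"
  using mquot(2)[OF chain_complexD(1) lsubmodule_cycles lsubmodule_boundaries] assms
    mquot_simps(1,2)[OF chain_complexD(1) lsubmodule_boundaries]
  by (simp_all add: homology_eq_mquot hcls_def[abs_def])

lemma lmodule_homology: "chain_complex X \<Longrightarrow> lmodule (homology X i)"
  unfolding homology_eq_mquot
  by (rule mquot(1)[OF chain_complexD(1) lsubmodule_cycles lsubmodule_boundaries])

lemma fg_homology:
  fixes scale :: "'k::field \<Rightarrow> 'a::ring_1 \<Rightarrow> 'a" and X :: "('a, 'm) cplx"
  assumes "fd_algebra scale" "bounded_complex X"
  shows "fg_module (homology X i)"
  unfolding homology_eq_mquot
  by (rule fg_module_mquot[OF assms(1) bounded_complexD(2)[OF assms(2)]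
      lsubmodule_cycles lsubmodule_boundaries]; rule bounded_complexD(1)[OF assms(2)])

lemma hcls_in: "chain_complex X \<Longrightarrow> x \<in> cycles X i \<Longrightarrow> hcls X i x \<in> carrier (homology X i)"
  by (simp add: hcls(2))

lemma hcls_cases:
  assumes "chain_complex X" "S \<in> carrier (homology X i)"
  obtains x where "x \<in> cycles X i" "S = hcls X i x"
  using assms(2) unfolding hcls(2)[OF assms(1)] by blast

lemma hcls_eq_iff:
  assumes X: "chain_complex X" and x: "x \<in> chains X i" and y: "y \<in> chains X i"
  shows "hcls X i x = hcls X i y \<longleftrightarrow> (\<exists>z\<in>chains X (i + 1). x = y \<oplus>\<^bsub>ob X i\<^esub> bd X (i + 1) z)"
proof -
  have "hcls X i x = hcls X i y \<longleftrightarrow> (\<exists>z\<in>chains X (i + 1). x = bd X (i + 1) z \<oplus>\<^bsub>ob X i\<^esub> y)"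
    unfolding hcls_def coset_eq_iff[OF chain_complexD(1)[OF X] lsubmodule_boundaries[OF X] x y]
    by (simp add: boundaries_def)
  moreover have "bd X (i + 1) z \<oplus>\<^bsub>ob X i\<^esub> y = y \<oplus>\<^bsub>ob X i\<^esub> bd X (i + 1) z" if "z \<in> chains X (i + 1)" for z
    by (rule lmodule_ac(1)[OF chain_complexD(1)[OF X] mhomD(1)[OF chain_complexD(3)[OF X] that] y])
  ultimately show ?thesis by auto
qed

lemma hcls_eq_zero_iff:
  assumes X: "chain_complex X" and x: "x \<in> chains X i"
  shows "hcls X i x = \<zero>\<^bsub>homology X i\<^esub> \<longleftrightarrow> x \<in> boundaries X i"
  unfolding hcls(3)[OF X] hcls_eq_iff[OF X x lmodule_group(1)[OF chain_complexD(1)[OF X]]]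
  using mhomD(1)[OF chain_complexD(3)[OF X, of i]] lmodule_group(4)[OF chain_complexD(1)[OF X]]
  by (auto simp: boundaries_def)

lemma chain_map_cycles:
  assumes X: "chain_complex X" and Y: "chain_complex Y" and f: "chain_map X Y f" and x: "x \<in> cycles X i"
  shows "f i x \<in> cycles Y i"
  using chain_mapD(2)[OF f cyclesD(1)[OF x]] cyclesD(2)[OF x] mhomD(1)[OF chain_mapD(1)[OF f] cyclesD(1)[OF x]]
    mhom_zero[OF chain_mapD(1)[OF f] chain_complexD(1)[OF X] chain_complexD(1)[OF Y]]
  by (simp add: cycles_def)

lemma chain_map_boundaries:
  assumes f: "chain_map X Y f" and x: "x \<in> boundaries X i"
  shows "f i x \<in> boundaries Y i"
proof -
  obtain z where z: "z \<in> chains X (i + 1)" "x = bd X (i + 1) z" using x by (auto simp: boundaries_def)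
  then have "f i x = bd Y (i + 1) (f (i + 1) z)" using chain_mapD(3)[OF f z(1)] by simp
  then show ?thesis using mhomD(1)[OF chain_mapD(1)[OF f] z(1)] by (auto simp: boundaries_def)
qed

text \<open>The image of a coset under \<open>f\<close> may miss part of the target coset; the
  boundaries added in \<open>homology_map\<close> fill it up. All later computations use this rule
  on representatives instead of cosets.\<close>

lemma homology_map_hcls:
  assumes X: "chain_complex X" and Y: "chain_complex Y" and f: "chain_map X Y f" and x: "x \<in> chains X i"
  shows "homology_map Y i f (hcls X i x) = hcls Y i (f i x)"
proof -
  let ?BX = "boundaries X i" and ?BY = "boundaries Y i"
  note LY = chain_complexD(1)[OF Y] and BY = lsubmoduleD[OF lsubmodule_boundaries[OF Y, of i]]
  have fB: "f i b \<in> ?BY" if "b \<in> ?BX" for b by (rule chain_map_boundaries[OF f that])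
  have BX: "b \<in> chains X i" if "b \<in> ?BX" for b
    using that lsubmoduleD(3)[OF lsubmodule_boundaries[OF X]] by blast
  note fx = mhomD(1)[OF chain_mapD(1)[OF f] x]
  have "\<exists>b''\<in>?BY. b \<oplus>\<^bsub>ob Y i\<^esub> f i (b' \<oplus>\<^bsub>ob X i\<^esub> x) = b'' \<oplus>\<^bsub>ob Y i\<^esub> f i x" if "b \<in> ?BY" "b' \<in> ?BX" for b b'
    by (rule bexI[of _ "b \<oplus>\<^bsub>ob Y i\<^esub> f i b'"])
      (use that BY(3,4) fB BX x fx in \<open>simp_all add: mhomD(2)[OF chain_mapD(1)[OF f]] lmodule_ac(2)[OF LY]\<close>)
  moreover have "\<exists>b'\<in>?BY. \<exists>b''\<in>?BX. b \<oplus>\<^bsub>ob Y i\<^esub> f i x = b' \<oplus>\<^bsub>ob Y i\<^esub> f i (b'' \<oplus>\<^bsub>ob X i\<^esub> x)" if "b \<in> ?BY" for b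
    by (rule bexI[OF bexI[of _ "\<zero>\<^bsub>ob X i\<^esub>"] that])
      (use lsubmoduleD(2)[OF lsubmodule_boundaries[OF X]] lmodule_group(4)[OF chain_complexD(1)[OF X] x] in simp_all)
  ultimately have "{b \<oplus>\<^bsub>ob Y i\<^esub> f i (b' \<oplus>\<^bsub>ob X i\<^esub> x) | b b'. b \<in> ?BY \<and> b' \<in> ?BX} = {b \<oplus>\<^bsub>ob Y i\<^esub> f i x | b. b \<in> ?BY}"
    by blast
  moreover have "homology_map Y i f (hcls X i x) = {b \<oplus>\<^bsub>ob Y i\<^esub> f i (b' \<oplus>\<^bsub>ob X i\<^esub> x) | b b'. b \<in> ?BY \<and> b' \<in> ?BX}"
    unfolding homology_map_def hcls_def coset_eq set_add_eq by blast
  ultimately show ?thesis unfolding hcls_def coset_eq by simp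
qed

lemma homology_map_mhom:
  assumes X: "chain_complex X" and Y: "chain_complex Y" and f: "chain_map X Y f"
  shows "homology_map Y i f \<in> mhom (homology X i) (homology Y i)"
proof -
  note hX = hcls[OF X] and hY = hcls[OF Y]
  have c: "x \<in> chains X i" "f i x \<in> cycles Y i" if "x \<in> cycles X i" for x
    using cyclesD(1)[OF that] chain_map_cycles[OF X Y f that] by auto
  have "f i \<in> mhom (restr (ob X i) (cycles X i)) (restr (ob Y i) (cycles Y i))"
    using c by (intro mhom_restr[OF chain_mapD(1)[OF f]]) auto
  then have p: "(\<lambda>x. hcls Y i (f i x)) \<in> mhom (restr (ob X i) (cycles X i)) (homology Y i)"
    using hY(1) by (rule mhom_comp)
  have LZ: "lmodule (restr (ob X i) (cycles X i))"
    by (rule lmodule_restr[OF chain_complexD(1)[OF X] lsubmodule_cycles[OF X]])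
  obtain s where s: "s \<in> mhom (homology X i) (homology Y i)"
    "\<And>x. x \<in> carrier (restr (ob X i) (cycles X i)) \<Longrightarrow> s (hcls X i x) = hcls Y i (f i x)"
  proof (rule mhom_factor_surj[OF LZ lmodule_homology[OF X] lmodule_homology[OF Y] hX(1) _ p])
    show "hcls X i ` carrier (restr (ob X i) (cycles X i)) = carrier (homology X i)" by (simp add: hX(2))
    fix x assume "x \<in> carrier (restr (ob X i) (cycles X i))" "hcls X i x = \<zero>\<^bsub>homology X i\<^esub>"
    then have x: "x \<in> chains X i" "x \<in> boundaries X i" using c hcls_eq_zero_iff[OF X] by auto
    then have "f i x \<in> boundaries Y i" by (intro chain_map_boundaries[OF f])
    then show "hcls Y i (f i x) = \<zero>\<^bsub>homology Y i\<^esub>"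
      using hcls_eq_zero_iff[OF Y mhomD(1)[OF chain_mapD(1)[OF f] x(1)]] by simp
  qed blast
  show ?thesis
    by (rule mhom_cong[OF lmodule_homology[OF X] s(1)])
      (use s(2) c homology_map_hcls[OF X Y f] in \<open>auto simp: hX(2)\<close>)
qed

lemma homology_map_comp:
  assumes X: "chain_complex X" and Y: "chain_complex Y" and Z: "chain_complex Z"
    and f: "chain_map X Y f" and g: "chain_map Y Z g" and S: "S \<in> carrier (homology X i)"
  shows "homology_map Z i (comp_map g f) S = homology_map Z i g (homology_map Y i f S)"
proof -
  obtain x where x: "x \<in> cycles X i" "S = hcls X i x" using S hcls(2)[OF X] by auto
  note c = cyclesD(1)[OF x(1)]
  show ?thesis unfolding x(2) homology_map_hcls[OF X Y f c]
      homology_map_hcls[OF X Z chain_map_comp[OF f g] c]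
      homology_map_hcls[OF Y Z g mhomD(1)[OF chain_mapD(1)[OF f] c]]
    by (simp add: comp_map_def)
qed

lemma homology_map_id:
  assumes X: "chain_complex X" and S: "S \<in> carrier (homology X i)"
  shows "homology_map X i id_map S = S"
proof -
  obtain x where x: "x \<in> cycles X i" "S = hcls X i x" using S hcls(2)[OF X] by auto
  show ?thesis unfolding x(2) homology_map_hcls[OF X X chain_map_id cyclesD(1)[OF x(1)]]
    by (simp add: id_map_def)
qed

lemma homotopic_refl:
  assumes X: "chain_complex X" and Y: "chain_complex Y" and f: "chain_map X Y f"
  shows "homotopic X Y f f"
  unfolding homotopic_def
proof (intro exI[of _ "\<lambda>i x. \<zero>\<^bsub>ob Y (i + 1)\<^esub>"] allI conjI ballI)
  fix i
  show "(\<lambda>x. \<zero>\<^bsub>ob Y (i + 1)\<^esub>) \<in> mhom (ob X i) (ob Y (i + 1))"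
    by (rule mhom_const_zero[OF chain_complexD(1)[OF Y]])
  fix x assume "x \<in> chains X i"
  then show "f i x = f i x \<oplus>\<^bsub>ob Y i\<^esub> (bd Y (i + 1) \<zero>\<^bsub>ob Y (i + 1)\<^esub> \<oplus>\<^bsub>ob Y i\<^esub> \<zero>\<^bsub>ob Y (i - 1 + 1)\<^esub>)"
    using mhomD(1)[OF chain_mapD(1)[OF f]] chain_complexD(1)[OF Y]
      mhom_zero[OF chain_complexD(3)[OF Y] chain_complexD(1)[OF Y] chain_complexD(1)[OF Y]]
    by (simp add: lmodule_group)
qed

lemma homotopic_homology:
  assumes X: "chain_complex X" and Y: "chain_complex Y" and f: "chain_map X Y f" and g: "chain_map X Y g"
    and fg: "homotopic X Y f g" and x: "x \<in> cycles X i"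
  shows "hcls Y i (f i x) = hcls Y i (g i x)"
proof -
  obtain s where s: "\<And>i. s i \<in> mhom (ob X i) (ob Y (i + 1))"
    "\<And>i x. x \<in> chains X i \<Longrightarrow>
       f i x = g i x \<oplus>\<^bsub>ob Y i\<^esub> (bd Y (i + 1) (s i x) \<oplus>\<^bsub>ob Y i\<^esub> s (i - 1) (bd X i x))"
    using fg unfolding homotopic_def by blast
  note c = cyclesD(1)[OF x]
  have sx: "s i x \<in> chains Y (i + 1)" by (rule mhomD(1)[OF s(1) c])
  have 0: "s (i - 1) (bd X i x) = \<zero>\<^bsub>ob Y i\<^esub>"
    using mhom_zero[OF s(1)[of "i - 1"] chain_complexD(1)[OF X] chain_complexD(1)[OF Y]] cyclesD(2)[OF x] by simp
  have "f i x = g i x \<oplus>\<^bsub>ob Y i\<^esub> bd Y (i + 1) (s i x)"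
    using s(2)[OF c] lmodule_group(5)[OF chain_complexD(1)[OF Y] mhomD(1)[OF chain_complexD(3)[OF Y] sx]]
    by (simp add: 0)
  then show ?thesis
    using hcls_eq_iff[OF Y mhomD(1)[OF chain_mapD(1)[OF f] c] mhomD(1)[OF chain_mapD(1)[OF g] c]] sx by blast
qed


subsection \<open>Quasi-isomorphisms\<close>

lemma quasi_isoI:
  assumes X: "chain_complex X" and Y: "chain_complex Y" and f: "chain_map X Y f"
    and inj: "\<And>i x. x \<in> cycles X i \<Longrightarrow> f i x \<in> boundaries Y i \<Longrightarrow> x \<in> boundaries X i"
    and surj: "\<And>i y. y \<in> cycles Y i \<Longrightarrow>
      \<exists>x\<in>cycles X i. \<exists>z\<in>chains Y (i + 1). f i x = y \<oplus>\<^bsub>ob Y i\<^esub> bd Y (i + 1) z"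
  shows "quasi_iso X Y f"
  unfolding quasi_iso_def
proof (intro conjI allI f)
  fix i
  note h = homology_map_mhom[OF X Y f, of i] and hc = homology_map_hcls[OF X Y f]
  note fc = mhomD(1)[OF chain_mapD(1)[OF f]]
  have "S = \<zero>\<^bsub>homology X i\<^esub>" if S: "S \<in> carrier (homology X i)" "homology_map Y i f S = \<zero>\<^bsub>homology Y i\<^esub>" for S
  proof -
    obtain x where x: "x \<in> cycles X i" "S = hcls X i x" using S hcls(2)[OF X] by auto
    note c = cyclesD(1)[OF x(1)]
    have "f i x \<in> boundaries Y i"
      using S(2) hc[OF c] hcls_eq_zero_iff[OF Y fc[OF c]] x(2) by simp
    then show ?thesis using inj[OF x(1)] hcls_eq_zero_iff[OF X c] x(2) by simp
  qed
  then have "inj_on (homology_map Y i f) (carrier (homology X i))"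
    using mhom_inj_iff[OF h lmodule_homology[OF X] lmodule_homology[OF Y]] by blast
  moreover have "carrier (homology Y i) \<subseteq> homology_map Y i f ` carrier (homology X i)"
  proof
    fix S assume "S \<in> carrier (homology Y i)"
    then obtain y where y: "y \<in> cycles Y i" "S = hcls Y i y" using hcls(2)[OF Y] by auto
    obtain x z where x: "x \<in> cycles X i" "z \<in> chains Y (i + 1)" "f i x = y \<oplus>\<^bsub>ob Y i\<^esub> bd Y (i + 1) z"
      using surj[OF y(1)] by blast
    note c = cyclesD(1)[OF x(1)]
    have "hcls Y i (f i x) = hcls Y i y" using x hcls_eq_iff[OF Y fc[OF c] cyclesD(1)[OF y(1)]] by blast
    then have "S = homology_map Y i f (hcls X i x)" using y(2) hc[OF c] by simp
    then show "S \<in> homology_map Y i f ` carrier (homology X i)" using hcls_in[OF X x(1)] by blast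
  qed
  ultimately show "bij_betw (homology_map Y i f) (carrier (homology X i)) (carrier (homology Y i))"
    using mhomD(1)[OF h] by (auto simp: bij_betw_def)
qed

lemma quasi_isoD:
  assumes "quasi_iso X Y f"
  shows "chain_map X Y f" "bij_betw (homology_map Y i f) (carrier (homology X i)) (carrier (homology Y i))"
  using assms by (auto simp: quasi_iso_def)

lemma quasi_iso_surj:
  assumes X: "chain_complex X" and Y: "chain_complex Y" and f: "quasi_iso X Y f" and y: "y \<in> cycles Y i"
  obtains x z where "x \<in> cycles X i" "z \<in> chains Y (i + 1)" "y = f i x \<oplus>\<^bsub>ob Y i\<^esub> bd Y (i + 1) z"
    "hcls Y i y = hcls Y i (f i x)"
proof -
  note cm = quasi_isoD(1)[OF f]
  have "hcls Y i y \<in> homology_map Y i f ` carrier (homology X i)"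
    using quasi_isoD(2)[OF f] hcls_in[OF Y y] by (auto simp: bij_betw_def)
  then obtain x where x: "x \<in> cycles X i" "hcls Y i y = homology_map Y i f (hcls X i x)" using hcls(2)[OF X] by auto
  note c = cyclesD(1)[OF x(1)]
  have eq: "hcls Y i y = hcls Y i (f i x)" using x(2) homology_map_hcls[OF X Y cm c] by simp
  then obtain z where "z \<in> chains Y (i + 1)" "y = f i x \<oplus>\<^bsub>ob Y i\<^esub> bd Y (i + 1) z"
    using hcls_eq_iff[OF Y cyclesD(1)[OF y] mhomD(1)[OF chain_mapD(1)[OF cm] c]] by blast
  with x(1) eq show thesis using that by blast
qed

lemma quasi_iso_inj:
  assumes X: "chain_complex X" and Y: "chain_complex Y" and f: "quasi_iso X Y f"
    and x: "x \<in> cycles X i" "f i x \<in> boundaries Y i"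
  shows "x \<in> boundaries X i"
proof -
  note cm = quasi_isoD(1)[OF f] and c = cyclesD(1)[OF x(1)]
  have "homology_map Y i f (hcls X i x) = \<zero>\<^bsub>homology Y i\<^esub>"
    using homology_map_hcls[OF X Y cm c] hcls_eq_zero_iff[OF Y mhomD(1)[OF chain_mapD(1)[OF cm] c]] x(2) by simp
  moreover have "inj_on (homology_map Y i f) (carrier (homology X i))" using quasi_isoD(2)[OF f] by (simp add: bij_betw_def)
  ultimately have "hcls X i x = \<zero>\<^bsub>homology X i\<^esub>"
    using mhom_inj_iff[OF homology_map_mhom[OF X Y cm] lmodule_homology[OF X] lmodule_homology[OF Y]]
      hcls_in[OF X x(1)] by blast
  then show ?thesis using hcls_eq_zero_iff[OF X c] by simp
qed

lemma quasi_iso_id: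
  assumes X: "chain_complex X" shows "quasi_iso X X id_map"
proof -
  have "bij_betw (homology_map X i id_map) (carrier (homology X i)) (carrier (homology X i))" for i
    by (subst bij_betw_cong[where g = "\<lambda>x. x"])
      (simp_all add: homology_map_id[OF X] bij_betw_def)
  then show ?thesis by (simp add: quasi_iso_def chain_map_id)
qed

lemma quasi_iso_comp:
  assumes X: "chain_complex X" and Y: "chain_complex Y" and Z: "chain_complex Z"
    and f: "quasi_iso X Y f" and g: "quasi_iso Y Z g"
  shows "quasi_iso X Z (comp_map g f)"
proof -
  note cf = quasi_isoD(1)[OF f] and cg = quasi_isoD(1)[OF g]
  have "bij_betw (homology_map Z i (comp_map g f)) (carrier (homology X i)) (carrier (homology Z i))" for i
    using bij_betw_trans[OF quasi_isoD(2)[OF f, of i] quasi_isoD(2)[OF g, of i]]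
    by (subst bij_betw_cong[where g = "homology_map Z i g \<circ> homology_map Y i f"])
      (simp_all add: homology_map_comp[OF X Y Z cf cg])
  then show ?thesis using chain_map_comp[OF cf cg] by (simp add: quasi_iso_def)
qed

section \<open>Bounded complexes and their copies on a given type\<close>

lemma zero_module_mhom:
  assumes "lmodule M" "lmodule N" "f \<in> mhom M N" "inj_on f (carrier M)" "zero_module N"
  shows "zero_module M"
proof -
  have "x = \<zero>\<^bsub>M\<^esub>" if "x \<in> carrier M" for x
    using that assms(4,5) mhomD(1)[OF assms(3) that] mhom_inj_iff[OF assms(3,1,2)] by (auto simp: zero_module_def)
  then show ?thesis using lmodule_group(1)[OF assms(1)] unfolding zero_module_def by blast
qed

lemma bounded_complexI:
  assumes "\<And>i. fg_module (ob X i)"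
    and "\<And>i. bd X i \<in> mhom (ob X i) (ob X (i - 1))"
    and "\<And>i x. x \<in> chains X i \<Longrightarrow> bd X (i - 1) (bd X i x) = \<zero>\<^bsub>ob X (i - 2)\<^esub>"
    and "\<And>i. \<bar>i\<bar> > n \<Longrightarrow> zero_module (ob X i)"
  shows "bounded_complex X"
  using assms by (auto simp: bounded_complex_def chain_complex_def fg_lmodule)

lemma bounded_complex_bound:
  assumes "bounded_complex X"
  obtains n where "\<And>i. \<bar>i\<bar> > n \<Longrightarrow> zero_module (ob X i)"
  using assms unfolding bounded_complex_def by blast

lemma bounded_complex_copy:
  fixes scale :: "'k::field \<Rightarrow> 'a::ring_1 \<Rightarrow> 'a" and \<iota> :: "'k list \<Rightarrow> 'c" and X :: "('a, 'x) cplx"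
  assumes alg: "fd_algebra scale" and \<iota>: "inj \<iota>" and X: "bounded_complex X"
  obtains X' :: "('a, 'c) cplx" and j k where "bounded_complex X'"
    "\<forall>i. j i \<in> mhom (ob X i) (ob X' i)" "\<forall>i. k i \<in> mhom (ob X' i) (ob X i)"
    "\<forall>i. \<forall>x\<in>chains X i. k i (j i x) = x" "\<forall>i. \<forall>x\<in>chains X' i. j i (k i x) = x"
    "\<forall>i. bd X' i = (\<lambda>x. j (i - 1) (bd X i (k i x)))"
proof -
  note B = bounded_complexD[OF X] and D = chain_complexD[OF bounded_complexD(1)[OF X]]
  \<comment> \<open>The copied module and the two isomorphisms are packed into one triple, so that a
    single use of choice selects them in all degrees together.\<close>
  let ?P = "\<lambda>i (t :: ('a, 'c) module \<times> ('x \<Rightarrow> 'c) \<times> ('c \<Rightarrow> 'x)).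
    fg_module (fst t) \<and> fst (snd t) \<in> mhom (ob X i) (fst t) \<and> snd (snd t) \<in> mhom (fst t) (ob X i) \<and>
    (\<forall>x\<in>chains X i. snd (snd t) (fst (snd t) x) = x) \<and>
    (\<forall>x\<in>carrier (fst t). fst (snd t) (snd (snd t) x) = x)"
  have "\<forall>i. \<exists>t. ?P i t"
  proof
    fix i
    obtain M' :: "('a, 'c) module" and j k where "fg_module M'"
      "j \<in> mhom (ob X i) M'" "k \<in> mhom M' (ob X i)"
      "\<And>x. x \<in> chains X i \<Longrightarrow> k (j x) = x" "\<And>x. x \<in> carrier M' \<Longrightarrow> j (k x) = x"
      by (rule fg_module_copy[OF alg \<iota> B(2)[of i]]) blast
    then show "\<exists>t. ?P i t"
      by (intro exI[of _ "(M', j, k)"]) simp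
  qed
  then obtain T where T: "\<forall>i. ?P i (T i)"
    by (rule choice[THEN exE])
  define M where "M i = fst (T i)" for i
  define j where "j i = fst (snd (T i))" for i
  define k where "k i = snd (snd (T i))" for i
  have M: "fg_module (M i)" and j: "j i \<in> mhom (ob X i) (M i)" and k: "k i \<in> mhom (M i) (ob X i)"
    and kj: "x \<in> chains X i \<Longrightarrow> k i (j i x) = x" and jk: "y \<in> carrier (M i) \<Longrightarrow> j i (k i y) = y" for i x y
    using T by (auto simp: M_def j_def k_def)
  define X' where "X' = \<lparr>ob = M, bd = (\<lambda>i x. j (i - 1) (bd X i (k i x)))\<rparr>"
  obtain n where n: "\<And>i. \<bar>i\<bar> > n \<Longrightarrow> zero_module (ob X i)" using bounded_complex_bound[OF X] by blast
  have "bounded_complex X'"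
  proof (rule bounded_complexI)
    fix i
    show "fg_module (ob X' i)" by (simp add: X'_def M)
    show "bd X' i \<in> mhom (ob X' i) (ob X' (i - 1))"
      using mhom_comp[OF mhom_comp[OF k D(2)] j] by (simp add: X'_def)
    show "bd X' (i - 1) (bd X' i x) = \<zero>\<^bsub>ob X' (i - 2)\<^esub>" if "x \<in> chains X' i" for x
    proof -
      have c: "k i x \<in> chains X i" using that mhomD(1)[OF k] by (simp add: X'_def)
      have "j (i - 2) \<zero>\<^bsub>ob X (i - 2)\<^esub> = \<zero>\<^bsub>M (i - 2)\<^esub>" by (rule mhom_zero[OF j D(1) fg_lmodule[OF M]])
      then show ?thesis using kj[OF mhomD(1)[OF D(2) c]] D(5)[OF c] by (simp add: X'_def)
    qed
    show "zero_module (ob X' i)" if "\<bar>i\<bar> > n"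
    proof -
      have "inj_on (k i) (carrier (M i))" by (rule inj_on_inverseI[of _ "j i"]) (rule jk)
      then show ?thesis unfolding X'_def
        using zero_module_mhom[OF fg_lmodule[OF M] D(1) k _ n[OF that]] by simp
    qed
  qed
  then show thesis
    by (rule that[of X' j k]) (simp_all add: X'_def j k kj jk)
qed


subsection \<open>Homotopy pullbacks\<close>

text \<open>The third component of the differential makes the square
  commute up to the homotopy given by the third projection.\<close>

definition homotopy_pullback :: "('a::ring_1, 'm) cplx \<Rightarrow> ('a, 'm) cplx \<Rightarrow> ('a, 'm) cplx \<Rightarrow>
    'm graded_map \<Rightarrow> 'm graded_map \<Rightarrow> ('a, 'm \<times> 'm \<times> 'm) cplx" where
  "homotopy_pullback A C B f s = \<lparr>ob = (\<lambda>i. mprod (ob A i) (mprod (ob C i) (ob B (i + 1)))),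
    bd = (\<lambda>i (a, c, b). (bd A i a, bd C i c,
      f i a \<oplus>\<^bsub>ob B i\<^esub> \<ominus>\<^bsub>ob B i\<^esub> (s i c \<oplus>\<^bsub>ob B i\<^esub> bd B (i + 1) b)))\<rparr>"

lemma homotopy_pullback_bounded:
  assumes A: "bounded_complex A" and C: "bounded_complex C" and B: "bounded_complex B"
    and f: "chain_map A B f" and s: "chain_map C B s"
  shows "bounded_complex (homotopy_pullback A C B f s)" (is "bounded_complex ?W")
proof -
  note DA = chain_complexD[OF bounded_complexD(1)[OF A]] and DB = chain_complexD[OF bounded_complexD(1)[OF B]]
    and DC = chain_complexD[OF bounded_complexD(1)[OF C]]
  obtain na where na: "\<And>i. \<bar>i\<bar> > na \<Longrightarrow> zero_module (ob A i)" using bounded_complex_bound[OF A] by blast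
  obtain nb where nb: "\<And>i. \<bar>i\<bar> > nb \<Longrightarrow> zero_module (ob B i)" using bounded_complex_bound[OF B] by blast
  obtain nc where nc: "\<And>i. \<bar>i\<bar> > nc \<Longrightarrow> zero_module (ob C i)" using bounded_complex_bound[OF C] by blast
  show ?thesis
  proof (rule bounded_complexI)
    fix i
    show "fg_module (ob ?W i)"
      by (simp add: homotopy_pullback_def fg_module_mprod bounded_complexD A B C)
    have 3: "(\<lambda>x. f i (fst x) \<oplus>\<^bsub>ob B i\<^esub> \<ominus>\<^bsub>ob B i\<^esub> (s i (fst (snd x)) \<oplus>\<^bsub>ob B i\<^esub> bd B (i + 1) (snd (snd x))))
        \<in> mhom (ob ?W i) (ob B i)"
      unfolding homotopy_pullback_def cplx.simps
      by (intro mhom_add mhom_uminus DB mhom_comp[OF mhom_fst chain_mapD(1)[OF f]]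
          mhom_comp[OF mhom_comp[OF mhom_snd mhom_fst] chain_mapD(1)[OF s]]
          mhom_comp[OF mhom_comp[OF mhom_snd mhom_snd] DB(3)])
    have 1: "(\<lambda>x. bd A i (fst x)) \<in> mhom (ob ?W i) (ob A (i - 1))"
      unfolding homotopy_pullback_def cplx.simps by (rule mhom_comp[OF mhom_fst DA(2)])
    have 2: "(\<lambda>x. bd C i (fst (snd x))) \<in> mhom (ob ?W i) (ob C (i - 1))"
      unfolding homotopy_pullback_def cplx.simps by (rule mhom_comp[OF mhom_comp[OF mhom_snd mhom_fst] DC(2)])
    show "bd ?W i \<in> mhom (ob ?W i) (ob ?W (i - 1))"
      using mhom_pair[OF 1 mhom_pair[OF 2 3]] by (simp add: homotopy_pullback_def case_prod_beta')
    show "bd ?W (i - 1) (bd ?W i x) = \<zero>\<^bsub>ob ?W (i - 2)\<^esub>" if x: "x \<in> chains ?W i" for x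
    proof -
      obtain a c b where abc: "x = (a, c, b)" "a \<in> chains A i" "c \<in> chains C i" "b \<in> chains B (i + 1)"
        using x by (auto simp: homotopy_pullback_def)
      let ?d = "bd B i"
      have c: "f i a \<in> chains B i" "s i c \<in> chains B i" "bd B (i + 1) b \<in> chains B i"
        using abc mhomD(1)[OF chain_mapD(1)[OF f]] mhomD(1)[OF chain_mapD(1)[OF s]] mhomD(1)[OF DB(3)] by auto
      note dc = mhomD(1)[OF DB(2) c(1)] mhomD(1)[OF DB(2) c(2)]
      have "?d (f i a \<oplus>\<^bsub>ob B i\<^esub> \<ominus>\<^bsub>ob B i\<^esub> (s i c \<oplus>\<^bsub>ob B i\<^esub> bd B (i + 1) b))
          = ?d (f i a) \<oplus>\<^bsub>ob B (i - 1)\<^esub> \<ominus>\<^bsub>ob B (i - 1)\<^esub> ?d (s i c)"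
        using c dc by (simp add: mhomD(2)[OF DB(2)] mhom_neg[OF DB(2) DB(1) DB(1)] DB(1,4) abc lmodule_group)
      also have "\<dots> = f (i - 1) (bd A i a) \<oplus>\<^bsub>ob B (i - 1)\<^esub> \<ominus>\<^bsub>ob B (i - 1)\<^esub> s (i - 1) (bd C i c)"
        using chain_mapD(2)[OF f abc(2)] chain_mapD(2)[OF s abc(3)] by simp
      finally show ?thesis
        using dc chain_mapD(2)[OF f abc(2)] chain_mapD(2)[OF s abc(3)]
        by (simp add: abc homotopy_pullback_def DA(5) DC(5) DB(1) lmodule_simps)
    qed
    \<comment> \<open>The third component in degree \<open>i\<close> is the term of \<open>B\<close>
      in degree \<open>i + 1\<close>, so the bound for \<open>B\<close> goes up by one.\<close>
    show "zero_module (ob ?W i)" if "\<bar>i\<bar> > max na (max (nb + 1) nc)"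
    proof -
      have "zero_module (ob A i)" "zero_module (ob B (i + 1))" "zero_module (ob C i)"
        using that by (auto intro!: na nb nc)
      then show ?thesis by (auto simp: zero_module_def homotopy_pullback_def)
    qed
  qed
qed

text \<open>\<open>W\<close> is a copy of the homotopy pullback, with its projections to
  \<open>A\<close> and \<open>C\<close>, and the third projection is the homotopy. That
  \<open>t\<close> is a quasi-isomorphism reflects that \<open>s\<close> is one: for a cycle
  \<open>a\<close>, its image f a is homologous to some s c, and a bounding element \<open>b\<close>
  completes (a, c, b) to a cycle over \<open>a\<close>.\<close>

lemma Ore_condition:
  fixes scale :: "'k::field \<Rightarrow> 'a::ring_1 \<Rightarrow> 'a" and \<iota> :: "'k list \<Rightarrow> 'm" and A B C :: "('a, 'm) cplx"
  assumes alg: "fd_algebra scale" and \<iota>: "inj \<iota>"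
    and A: "bounded_complex A" and C: "bounded_complex C" and B: "bounded_complex B"
    and f: "chain_map A B f" and s: "quasi_iso C B s"
  obtains W t h where "bounded_complex W" "quasi_iso W A t" "chain_map W C h"
    "homotopic W B (comp_map f t) (comp_map s h)"
proof -
  note cA = bounded_complexD(1)[OF A] and cB = bounded_complexD(1)[OF B] and cC = bounded_complexD(1)[OF C]
  note DA = chain_complexD[OF cA] and DB = chain_complexD[OF cB] and DC = chain_complexD[OF cC]
  note cs = quasi_isoD(1)[OF s]
  note fc = mhomD(1)[OF chain_mapD(1)[OF f]] and sc = mhomD(1)[OF chain_mapD(1)[OF cs]]
  let ?P = "homotopy_pullback A C B f s"
  note P = homotopy_pullback_bounded[OF A C B f cs]
  obtain W :: "('a, 'm) cplx" and j k where W: "bounded_complex W"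
    and j': "\<forall>i. j i \<in> mhom (ob ?P i) (ob W i)" and k': "\<forall>i. k i \<in> mhom (ob W i) (ob ?P i)"
    and kj: "\<forall>i. \<forall>x\<in>chains ?P i. k i (j i x) = x" and jk: "\<forall>i. \<forall>x\<in>chains W i. j i (k i x) = x"
    and bdW: "\<forall>i. bd W i = (\<lambda>x. j (i - 1) (bd ?P i (k i x)))"
    by (rule bounded_complex_copy[OF alg \<iota> P])
  have j: "j i \<in> mhom (ob ?P i) (ob W i)" and k: "k i \<in> mhom (ob W i) (ob ?P i)" for i using j' k' by auto
  note cW = bounded_complexD(1)[OF W] and cP = bounded_complexD(1)[OF P]
  note DP = chain_complexD[OF cP] and DW = chain_complexD[OF cW]
  have obP: "chains ?P i = chains A i \<times> chains C i \<times> chains B (i + 1)" for i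
    by (simp add: homotopy_pullback_def)
  have bdP: "bd ?P i (a, c, b) = (bd A i a, bd C i c,
      f i a \<oplus>\<^bsub>ob B i\<^esub> \<ominus>\<^bsub>ob B i\<^esub> (s i c \<oplus>\<^bsub>ob B i\<^esub> bd B (i + 1) b))" for i a c b
    by (simp add: homotopy_pullback_def)
  have kd: "k (i - 1) (bd W i x) = bd ?P i (k i x)" if "x \<in> chains W i" for i x
    using kj mhomD(1)[OF DP(2) mhomD(1)[OF k that]] by (simp add: bdW)
  have pr: "fst \<in> mhom (ob ?P i) (ob A i)" "(\<lambda>x. fst (snd x)) \<in> mhom (ob ?P i) (ob C i)"
    "(\<lambda>x. snd (snd x)) \<in> mhom (ob ?P i) (ob B (i + 1))" for i
    by (simp_all add: homotopy_pullback_def mhom_fst mhom_comp[OF mhom_snd mhom_fst] mhom_comp[OF mhom_snd mhom_snd])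
  define t where "t i x = fst (k i x)" for i x
  define h where "h i x = fst (snd (k i x))" for i x
  define \<sigma> where "\<sigma> i x = snd (snd (k i x))" for i x
  have th: "t i \<in> mhom (ob W i) (ob A i)" and hh: "h i \<in> mhom (ob W i) (ob C i)"
    and \<sigma>h: "\<sigma> i \<in> mhom (ob W i) (ob B (i + 1))" for i
    using mhom_comp[OF k pr(1), of i] mhom_comp[OF k pr(2), of i] mhom_comp[OF k pr(3), of i]
    by (simp_all add: t_def[abs_def] h_def[abs_def] \<sigma>_def[abs_def])
  have kx: "k i x = (t i x, h i x, \<sigma> i x)" for i x by (simp add: t_def h_def \<sigma>_def)
  have dW: "t (i - 1) (bd W i x) = bd A i (t i x)" "h (i - 1) (bd W i x) = bd C i (h i x)"
    "\<sigma> (i - 1) (bd W i x) = f i (t i x) \<oplus>\<^bsub>ob B i\<^esub> \<ominus>\<^bsub>ob B i\<^esub> (s i (h i x) \<oplus>\<^bsub>ob B i\<^esub> bd B (i + 1) (\<sigma> i x))"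
    if "x \<in> chains W i" for i x
    using kd[OF that] by (simp_all add: kx bdP)
  have tmap: "chain_map W A t" and hmap: "chain_map W C h"
    using th hh dW by (simp_all add: chain_map_def)
  have "homotopic W B (comp_map f t) (comp_map s h)"
    unfolding homotopic_def
  proof (intro exI[of _ \<sigma>] allI conjI ballI \<sigma>h)
    fix i x assume x: "x \<in> chains W i"
    note c = fc[OF mhomD(1)[OF th x]] sc[OF mhomD(1)[OF hh x]] mhomD(1)[OF DB(3) mhomD(1)[OF \<sigma>h x]]
    show "comp_map f t i x = comp_map s h i x \<oplus>\<^bsub>ob B i\<^esub>
        (bd B (i + 1) (\<sigma> i x) \<oplus>\<^bsub>ob B i\<^esub> \<sigma> (i - 1) (bd W i x))"
      using c DB(1) by (simp add: comp_map_def dW[OF x] lmodule_simps)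
  qed
  moreover have "quasi_iso W A t"
  proof (rule quasi_isoI[OF cW cA tmap])
    fix i a assume a: "a \<in> cycles A i"
    note ac = cyclesD(1)[OF a]
    have "f i a \<in> cycles B i" by (rule chain_map_cycles[OF cA cB f a])
    then obtain c b where c: "c \<in> cycles C i" and b: "b \<in> chains B (i + 1)"
      and eq: "f i a = s i c \<oplus>\<^bsub>ob B i\<^esub> bd B (i + 1) b"
      by (rule quasi_iso_surj[OF cC cB s]) blast
    note cc = cyclesD(1)[OF c]
    have P: "(a, c, b) \<in> chains ?P i" using ac cc b by (simp add: obP)
    have e: "bd ?P i (a, c, b) = \<zero>\<^bsub>ob ?P (i - 1)\<^esub>"
      using fc[OF ac] DB(1) cyclesD(2)[OF a] cyclesD(2)[OF c] unfolding bdP eq[symmetric]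
      by (simp add: homotopy_pullback_def lmodule_group)
    let ?w = "j i (a, c, b)"
    have w: "?w \<in> chains W i" "k i ?w = (a, c, b)" using mhomD(1)[OF j P] kj P by auto
    have "bd W i ?w = \<zero>\<^bsub>ob W (i - 1)\<^esub>" using mhom_zero[OF j DP(1) DW(1)] by (simp add: bdW w(2) e)
    then have "?w \<in> cycles W i" using w by (simp add: cycles_def)
    moreover have "t i ?w = a" using w(2) by (simp add: t_def)
    moreover have "a = a \<oplus>\<^bsub>ob A i\<^esub> bd A (i + 1) \<zero>\<^bsub>ob A (i + 1)\<^esub>"
      using ac DA(1) mhom_zero[OF DA(3) DA(1) DA(1)] by (simp add: lmodule_group)
    ultimately show "\<exists>x\<in>cycles W i. \<exists>z\<in>chains A (i + 1). t i x = a \<oplus>\<^bsub>ob A i\<^esub> bd A (i + 1) z"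
      using lmodule_group(1)[OF DA(1)] by metis
  next
    fix i w assume w: "w \<in> cycles W i" and tb: "t i w \<in> boundaries A i"
    note wc = cyclesD(1)[OF w]
    define a where "a = t i w"
    define c where "c = h i w"
    define b where "b = \<sigma> i w"
    have ac: "a \<in> chains A i" and cc: "c \<in> chains C i" and bc: "b \<in> chains B (i + 1)"
      using mhomD(1)[OF th wc] mhomD(1)[OF hh wc] mhomD(1)[OF \<sigma>h wc] by (auto simp: a_def b_def c_def)
    have z: "bd ?P i (a, c, b) = \<zero>\<^bsub>ob ?P (i - 1)\<^esub>"
      using kd[OF wc] cyclesD(2)[OF w] mhom_zero[OF k DW(1) DP(1)] by (simp add: kx a_def b_def c_def)
    then have ccyc: "c \<in> cycles C i"
      and e0: "f i a \<oplus>\<^bsub>ob B i\<^esub> \<ominus>\<^bsub>ob B i\<^esub> (s i c \<oplus>\<^bsub>ob B i\<^esub> bd B (i + 1) b) = \<zero>\<^bsub>ob B i\<^esub>"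
      unfolding bdP using cc by (auto simp: homotopy_pullback_def cycles_def)
    note dbc = mhomD(1)[OF DB(3) bc]
    have e1: "f i a = s i c \<oplus>\<^bsub>ob B i\<^esub> bd B (i + 1) b"
      using e0 fc[OF ac] sc[OF cc] dbc lmodule_group(2)[OF DB(1)] by (simp add: lmodule_diff_zero_iff[OF DB(1)])
    obtain a' where a': "a' \<in> chains A (i + 1)" "a = bd A (i + 1) a'" using tb by (auto simp: boundaries_def a_def)
    note fa' = fc[OF a'(1)]
    \<comment> \<open>Write a = d a'. From f a = s c + d b one gets s c = d b0, so injectivity of
      \<open>s\<close> on homology gives c = d c'. The pair (a', c') bounds up to the error y = b0 -
      s c', a cycle of degree \<open>i + 1\<close>. Surjectivity of \<open>s\<close> writes y = s c2
      + d b2, and (a', c' + c2, b2) bounds (a, c, b) exactly.\<close>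
    define b0 where "b0 = f (i + 1) a' \<oplus>\<^bsub>ob B (i + 1)\<^esub> \<ominus>\<^bsub>ob B (i + 1)\<^esub> b"
    have b0: "b0 \<in> chains B (i + 1)" using fa' bc DB(1) by (simp add: b0_def lmodule_group)
    have sb: "s i c = bd B (i + 1) b0"
      using e1 chain_mapD(3)[OF f a'(1)] fa' bc DB(1) sc[OF cc] dbc
      by (simp add: b0_def mhomD(2)[OF DB(3)] mhom_neg[OF DB(3) DB(1) DB(1)] a'(2) lmodule_simps)
    then have "c \<in> boundaries C i" using quasi_iso_inj[OF cC cB s ccyc] b0 by (auto simp: boundaries_def)
    then obtain c' where c': "c' \<in> chains C (i + 1)" "c = bd C (i + 1) c'" by (auto simp: boundaries_def)
    note sc' = sc[OF c'(1)]
    define y where "y = b0 \<oplus>\<^bsub>ob B (i + 1)\<^esub> \<ominus>\<^bsub>ob B (i + 1)\<^esub> s (i + 1) c'"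
    have yc: "y \<in> chains B (i + 1)" using b0 sc' DB(1) by (simp add: y_def lmodule_group)
    have "bd B (i + 1) y = \<zero>\<^bsub>ob B i\<^esub>"
      using b0 sc' DB(1) chain_mapD(3)[OF cs c'(1)] sb mhomD(1)[OF DB(3) b0]
      by (simp add: y_def mhomD(2)[OF DB(3)] mhom_neg[OF DB(3) DB(1) DB(1)] c'(2) lmodule_group)
    then have "y \<in> cycles B (i + 1)" using yc by (simp add: cycles_def)
    then obtain c2 b2 where c2: "c2 \<in> cycles C (i + 1)" and b2: "b2 \<in> chains B (i + 1 + 1)"
      and y: "y = s (i + 1) c2 \<oplus>\<^bsub>ob B (i + 1)\<^esub> bd B (i + 1 + 1) b2"
      by (rule quasi_iso_surj[OF cC cB s]) blast
    note cc2 = cyclesD(1)[OF c2]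
    note sc2 = sc[OF cc2] and db2 = mhomD(1)[OF DB(3) b2]
    let ?c = "c' \<oplus>\<^bsub>ob C (i + 1)\<^esub> c2"
    have Pc: "(a', ?c, b2) \<in> chains ?P (i + 1)"
      using a' c' cc2 b2 DC(1) by (simp add: obP lmodule_group)
    have dc: "bd C (i + 1) ?c = c"
      using c' cc2 cyclesD(2)[OF c2] DC(1) cc by (simp add: mhomD(2)[OF DC(3)] lmodule_group)
    have "s (i + 1) ?c \<oplus>\<^bsub>ob B (i + 1)\<^esub> bd B (i + 1 + 1) b2 = s (i + 1) c' \<oplus>\<^bsub>ob B (i + 1)\<^esub> y"
      using sc' sc2 db2 c' cc2 DB(1) by (simp add: y mhomD(2)[OF chain_mapD(1)[OF cs]] lmodule_ac)
    also have "\<dots> = b0" using sc' b0 DB(1) by (simp add: y_def lmodule_simps)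
    finally have "f (i + 1) a' \<oplus>\<^bsub>ob B (i + 1)\<^esub> \<ominus>\<^bsub>ob B (i + 1)\<^esub>
        (s (i + 1) ?c \<oplus>\<^bsub>ob B (i + 1)\<^esub> bd B (i + 1 + 1) b2) = b"
      using fa' bc DB(1) by (simp add: b0_def lmodule_simps)
    then have dP: "bd ?P (i + 1) (a', ?c, b2) = (a, c, b)" by (simp add: bdP dc a'(2)[symmetric])
    let ?w = "j (i + 1) (a', ?c, b2)"
    have w': "?w \<in> chains W (i + 1)" "k (i + 1) ?w = (a', ?c, b2)" using mhomD(1)[OF j Pc] kj Pc by auto
    have "bd W (i + 1) ?w = j (i + 1 - 1) (bd ?P (i + 1) (k (i + 1) ?w))" by (simp only: bdW)
    also have "\<dots> = j i (k i w)" unfolding w'(2) dP by (simp add: kx a_def b_def c_def)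
    finally have "bd W (i + 1) ?w = j i (k i w)" .
    then have "w = bd W (i + 1) ?w" using jk wc by simp
    then show "w \<in> boundaries W i" using w'(1) by (auto simp: boundaries_def)
  qed
  ultimately show thesis using W hmap that by blast
qed

section \<open>Homology of morphisms in the derived category\<close>

text \<open>The body of \<open>Dhomology_map\<close> at a given roof rather than a chosen one, so
  that independence of the choice can be stated.\<close>

definition roof_homology :: "int \<Rightarrow> ('a::ring_1, 'm) roof \<Rightarrow> 'm set \<Rightarrow> 'm set" where
  "roof_homology i r S = homology_map (tgt r) i (rleg r)
    (the_inv_into (carrier (homology (apex r) i)) (homology_map (src r) i (lleg r)) S)"

lemma is_roofD:
  assumes "is_roof r"
  shows "bounded_complex (src r)" "bounded_complex (apex r)" "bounded_complex (tgt r)"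
    "chain_complex (src r)" "chain_complex (apex r)" "chain_complex (tgt r)"
    "quasi_iso (apex r) (src r) (lleg r)" "chain_map (apex r) (src r) (lleg r)" "chain_map (apex r) (tgt r) (rleg r)"
  using assms by (auto simp: is_roof_def bounded_complexD quasi_isoD)

text \<open>The rule that avoids inverting the left leg: every class of the source is the image of a
  cycle of the apex, and on such classes a roof acts by pushing that cycle down the right
  leg.\<close>

lemma roof_homology_hcls:
  assumes r: "is_roof r" and z: "z \<in> cycles (apex r) i"
  shows "roof_homology i r (hcls (src r) i (lleg r i z)) = hcls (tgt r) i (rleg r i z)"
proof -
  note R = is_roofD[OF r] and c = cyclesD(1)[OF z]
  have inj: "inj_on (homology_map (src r) i (lleg r)) (carrier (homology (apex r) i))"
    using quasi_isoD(2)[OF R(7)] by (simp add: bij_betw_def)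
  have "the_inv_into (carrier (homology (apex r) i)) (homology_map (src r) i (lleg r)) (hcls (src r) i (lleg r i z))
      = hcls (apex r) i z"
    using the_inv_into_f_f[OF inj hcls_in[OF R(5) z]] homology_map_hcls[OF R(5,4,8) c] by simp
  then show ?thesis using homology_map_hcls[OF R(5,6,9) c] by (simp add: roof_homology_def)
qed

lemma roof_homology_cases:
  assumes r: "is_roof r" and S: "S \<in> carrier (homology (src r) i)"
  obtains z where "z \<in> cycles (apex r) i" "S = hcls (src r) i (lleg r i z)"
proof -
  note R = is_roofD[OF r]
  obtain x where x: "x \<in> cycles (src r) i" "S = hcls (src r) i x" using S hcls(2)[OF R(4)] by auto
  show thesis using quasi_iso_surj[OF R(5,4,7) x(1)] x(2) that by metis
qed

lemma roof_homology_mhom: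
  assumes r: "is_roof r"
  shows "roof_homology i r \<in> mhom (homology (src r) i) (homology (tgt r) i)"
proof -
  note R = is_roofD[OF r]
  have "the_inv_into (carrier (homology (apex r) i)) (homology_map (src r) i (lleg r))
      \<in> mhom (homology (src r) i) (homology (apex r) i)"
    by (rule mhom_inv[OF lmodule_homology[OF R(5)] homology_map_mhom[OF R(5,4,8)] quasi_isoD(2)[OF R(7)]])
  from mhom_comp[OF this homology_map_mhom[OF R(5,6,9)]] show ?thesis
    by (simp add: roof_homology_def[abs_def])
qed

text \<open>The common refinement \<open>W\<close> is quasi-isomorphic to the source, so a class can
  be represented by a cycle of \<open>W\<close>; the two homotopies then identify its images under
  both roofs.\<close>

lemma roof_rel_homology:
  assumes rel: "(r, q) \<in> roof_rel" and S: "S \<in> carrier (homology (src r) i)"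
  shows "roof_homology i r S = roof_homology i q S"
proof -
  obtain W t t' where r: "is_roof r" and q: "is_roof q" and st: "src r = src q" "tgt r = tgt q"
    and W: "bounded_complex W" and t: "chain_map W (apex r) t" and t': "chain_map W (apex q) t'"
    and qi: "quasi_iso W (src r) (comp_map (lleg r) t)"
    and hl: "homotopic W (src r) (comp_map (lleg r) t) (comp_map (lleg q) t')"
    and hr: "homotopic W (tgt r) (comp_map (rleg r) t) (comp_map (rleg q) t')"
    using rel unfolding roof_rel_def by blast
  note R = is_roofD[OF r] and Q = is_roofD[OF q] and cW = bounded_complexD(1)[OF W]
  obtain x where x: "x \<in> cycles (src r) i" "S = hcls (src r) i x" using S hcls(2)[OF R(4)] by auto
  obtain z where z: "z \<in> cycles W i" "hcls (src r) i x = hcls (src r) i (comp_map (lleg r) t i z)"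
    using quasi_iso_surj[OF cW R(4) qi x(1)] by metis
  have tz: "t i z \<in> cycles (apex r) i" "t' i z \<in> cycles (apex q) i"
    by (rule chain_map_cycles[OF cW R(5) t z(1)], rule chain_map_cycles[OF cW Q(5) t' z(1)])
  have cm: "chain_map W (src r) (comp_map (lleg q) t')" "chain_map W (tgt r) (comp_map (rleg q) t')"
    unfolding st by (rule chain_map_comp[OF t' Q(8)], rule chain_map_comp[OF t' Q(9)])
  have S1: "S = hcls (src r) i (lleg r i (t i z))" using x(2) z(2) by (simp add: comp_map_def)
  have S2: "S = hcls (src q) i (lleg q i (t' i z))"
    using homotopic_homology[OF cW R(4) quasi_isoD(1)[OF qi] cm(1) hl z(1)] S1 st by (simp add: comp_map_def)
  have "roof_homology i r S = hcls (tgt r) i (rleg r i (t i z))"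
    unfolding S1 by (rule roof_homology_hcls[OF r tz(1)])
  also have "\<dots> = hcls (tgt q) i (rleg q i (t' i z))"
    using homotopic_homology[OF cW R(6) chain_map_comp[OF t R(9)] cm(2) hr z(1)] st by (simp add: comp_map_def)
  also have "\<dots> = roof_homology i q S" unfolding S2 by (rule roof_homology_hcls[OF q tz(2), symmetric])
  finally show ?thesis .
qed

section \<open>Classes of roofs and their members\<close>

lemma comp_map_id [simp]: "comp_map f id_map = f"
  by (simp add: comp_map_def id_map_def)

lemma roof_rel_refl:
  assumes r: "is_roof r" shows "(r, r) \<in> roof_rel"
proof -
  note R = is_roofD[OF r]
  show ?thesis unfolding roof_rel_def
    using r R(2,7) chain_map_id[of "apex r"] homotopic_refl[OF R(5,4,8)] homotopic_refl[OF R(5,6,9)]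
    by (auto intro!: exI[of _ "apex r"] exI[of _ "id_map"])
qed

lemma roof_relD:
  assumes "(r, q) \<in> roof_rel"
  shows "is_roof r" "is_roof q" "src q = src r" "tgt q = tgt r"
  using assms unfolding roof_rel_def by auto

text \<open>\<open>DHom\<close> uses the relation restricted to roofs with fixed ends,
  \<open>DQ\<close> and the operations use the whole relation. Related roofs share their ends, so
  the classes coincide.\<close>

lemma roof_rel_Image:
  assumes "r \<in> roofs X Y"
  shows "(roof_rel \<inter> roofs X Y \<times> roofs X Y) `` {r} = roof_rel `` {r}"
  using assms roof_relD by (fastforce simp: roofs_def)

lemma DHomE:
  assumes "\<alpha> \<in> DHom X Y"
  obtains r where "is_roof r" "src r = X" "tgt r = Y" "r \<in> \<alpha>" "\<alpha> = roof_rel `` {r}"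
proof -
  obtain r where r: "r \<in> roofs X Y" "\<alpha> = (roof_rel \<inter> roofs X Y \<times> roofs X Y) `` {r}"
    using assms unfolding DHom_def by (auto elim: quotientE)
  then have R: "is_roof r" "src r = X" "tgt r = Y" by (auto simp: roofs_def)
  have "\<alpha> = roof_rel `` {r}" using r roof_rel_Image by simp
  moreover from this have "r \<in> \<alpha>" using roof_rel_refl[OF R(1)] by auto
  ultimately show thesis using R that by blast
qed

text \<open>A given member and the one picked by \<open>SOME\<close> are compared through the roof
  \<open>r0\<close> that generates the class, to which both are related.\<close>

lemma DHom_mem:
  assumes \<alpha>: "\<alpha> \<in> DHom X Y" and r: "r \<in> \<alpha>"
  shows "is_roof r" "src r = X" "tgt r = Y"
    and "S \<in> carrier (homology X i) \<Longrightarrow> roof_homology i r S = Dhomology_map i \<alpha> S"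
proof -
  obtain r0 where r0: "is_roof r0" "src r0 = X" "tgt r0 = Y" "r0 \<in> \<alpha>" "\<alpha> = roof_rel `` {r0}"
    using DHomE[OF \<alpha>] .
  have rel: "(r0, q) \<in> roof_rel" if "q \<in> \<alpha>" for q using that r0(5) by auto
  from rel[OF r] r0(2,3) show "is_roof r" "src r = X" "tgt r = Y" by (auto simp: roof_rel_def)
  assume S: "S \<in> carrier (homology X i)"
  have "(SOME r. r \<in> \<alpha>) \<in> \<alpha>" using r by (rule someI)
  then have "roof_homology i r S = roof_homology i (SOME r. r \<in> \<alpha>) S"
    using roof_rel_homology[OF rel[OF r]] roof_rel_homology[OF rel] S r0(2) by metis
  then show "roof_homology i r S = Dhomology_map i \<alpha> S"
    by (simp add: Dhomology_map_def roof_homology_def Let_def)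
qed

lemma DHom_nonempty: "\<alpha> \<in> DHom X Y \<Longrightarrow> \<exists>r. r \<in> \<alpha>"
  by (blast elim: DHomE)

lemma DHom_bounded:
  assumes "\<alpha> \<in> DHom X Y" shows "bounded_complex X" "bounded_complex Y"
  using assms is_roofD(1,3) by (blast elim: DHomE)+

lemma Dhomology_map_mhom:
  assumes \<alpha>: "\<alpha> \<in> DHom X Y"
  shows "Dhomology_map i \<alpha> \<in> mhom (homology X i) (homology Y i)"
proof -
  obtain r where r: "r \<in> \<alpha>" using DHom_nonempty[OF \<alpha>] by blast
  note R = DHom_mem[OF \<alpha> r]
  show ?thesis
    using mhom_cong[OF lmodule_homology roof_homology_mhom[OF R(1)], of i "Dhomology_map i \<alpha>"] R(2-)
      bounded_complexD(1)[OF DHom_bounded(1)[OF \<alpha>]] by simp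
qed

lemma DQ_DHom:
  assumes X: "bounded_complex X" and Y: "bounded_complex Y" and f: "chain_map X Y f"
  shows "DQ X Y f \<in> DHom X Y"
    and "S \<in> carrier (homology X i) \<Longrightarrow> Dhomology_map i (DQ X Y f) S = homology_map Y i f S"
proof -
  let ?r = "\<lparr>src = X, apex = X, tgt = Y, lleg = id_map, rleg = f\<rparr>"
  note cX = bounded_complexD(1)[OF X] and cY = bounded_complexD(1)[OF Y]
  have r: "is_roof ?r" using X Y f quasi_iso_id[OF cX] by (simp add: is_roof_def)
  have "DQ X Y f = (roof_rel \<inter> roofs X Y \<times> roofs X Y) `` {?r}"
    unfolding DQ_def by (rule roof_rel_Image[symmetric]) (simp add: roofs_def r)
  then show D: "DQ X Y f \<in> DHom X Y" using r unfolding DHom_def by (auto simp: roofs_def intro: quotientI)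
  have rm: "?r \<in> DQ X Y f" using roof_rel_refl[OF r] by (simp add: DQ_def)
  assume S: "S \<in> carrier (homology X i)"
  then obtain x where x: "x \<in> cycles X i" "S = hcls X i x" using hcls(2)[OF cX] by auto
  have "Dhomology_map i (DQ X Y f) S = roof_homology i ?r S" using DHom_mem(4)[OF D rm S] by simp
  also have "\<dots> = hcls Y i (f i x)" using roof_homology_hcls[OF r, of x i] x by (simp add: id_map_def)
  also have "\<dots> = homology_map Y i f S" using homology_map_hcls[OF cX cY f cyclesD(1)[OF x(1)]] x(2) by simp
  finally show "Dhomology_map i (DQ X Y f) S = homology_map Y i f S" .
qed

lemma Did_DHom:
  assumes X: "bounded_complex X"
  shows "Did X \<in> DHom X X"
    and "S \<in> carrier (homology X i) \<Longrightarrow> Dhomology_map i (Did X) S = S"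
  using DQ_DHom[OF X X chain_map_id] homology_map_id[OF bounded_complexD(1)[OF X]] by (auto simp: Did_def)

text \<open>\<open>Dcomp\<close> is so far only a set of roofs, so functoriality is stated for its
  members. A cycle \<open>z\<close> of the apex \<open>W\<close> represents the given class, and the
  homotopy lets its image in the middle object be computed along either leg.\<close>

lemma Dcomp_mem:
  assumes \<alpha>: "\<alpha> \<in> DHom X Y" and \<beta>: "\<beta> \<in> DHom Y Z" and \<rho>: "\<rho> \<in> Dcomp \<beta> \<alpha>"
    and S: "S \<in> carrier (homology X i)"
  shows "roof_homology i \<rho> S = Dhomology_map i \<beta> (Dhomology_map i \<alpha> S)"
proof -
  obtain r q W t h where r: "r \<in> \<alpha>" and q: "q \<in> \<beta>" and W: "bounded_complex W"
    and t: "quasi_iso W (apex r) t" and h: "chain_map W (apex q) h"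
    and hom: "homotopic W (tgt r) (comp_map (rleg r) t) (comp_map (lleg q) h)"
    and rel: "(\<lparr>src = src r, apex = W, tgt = tgt q,
       lleg = comp_map (lleg r) t, rleg = comp_map (rleg q) h\<rparr>, \<rho>) \<in> roof_rel"
    using \<rho> unfolding Dcomp_def by blast
  let ?c = "\<lparr>src = src r, apex = W, tgt = tgt q, lleg = comp_map (lleg r) t, rleg = comp_map (rleg q) h\<rparr>"
  note r' = DHom_mem[OF \<alpha> r] and q' = DHom_mem[OF \<beta> q]
  note R = is_roofD[OF r'(1)] and Q = is_roofD[OF q'(1)] and cW = bounded_complexD(1)[OF W]
  have c: "is_roof ?c" using rel by (rule roof_relD)
  obtain z where z: "z \<in> cycles W i" "S = hcls X i (lleg r i (t i z))"
    using roof_homology_cases[OF c] S r'(2) by (auto simp: comp_map_def)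
  note tz = chain_map_cycles[OF cW R(5) quasi_isoD(1)[OF t] z(1)] and hz = chain_map_cycles[OF cW Q(5) h z(1)]
  have "roof_homology i \<rho> S = roof_homology i ?c S"
    using roof_rel_homology[OF rel] S r'(2) by simp
  also have "\<dots> = hcls Z i (rleg q i (h i z))"
    using roof_homology_hcls[OF c, of z i] z r'(2) q'(3) by (simp add: comp_map_def)
  also have "\<dots> = roof_homology i q (hcls Y i (lleg q i (h i z)))"
    using roof_homology_hcls[OF q'(1) hz] q'(2,3) by simp
  also have "\<dots> = Dhomology_map i \<beta> (hcls Y i (lleg q i (h i z)))"
    by (rule q'(4)) (use hcls_in[OF Q(4) chain_map_cycles[OF Q(5,4,8) hz]] q'(2) in simp)
  also have "hcls Y i (lleg q i (h i z)) = hcls Y i (rleg r i (t i z))"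
  proof -
    have "chain_map W (tgt r) (comp_map (lleg q) h)" using chain_map_comp[OF h Q(8)] q'(2) r'(3) by simp
    from homotopic_homology[OF cW R(6) chain_map_comp[OF quasi_isoD(1)[OF t] R(9)] this hom z(1)] r'(3)
    show ?thesis by (simp add: comp_map_def)
  qed
  also have "\<dots> = Dhomology_map i \<alpha> S"
    using roof_homology_hcls[OF r'(1) tz] r'(2,3) r'(4)[OF S] z(2) by simp
  finally show ?thesis .
qed

lemma Dcomp_eq_DHom:
  assumes "\<alpha> \<in> DHom X Y" "\<beta> \<in> DHom Y Z" "\<gamma> \<in> DHom X Z" "Dcomp \<beta> \<alpha> = \<gamma>" "S \<in> carrier (homology X i)"
  shows "Dhomology_map i \<beta> (Dhomology_map i \<alpha> S) = Dhomology_map i \<gamma> S"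
proof -
  obtain \<rho> where "\<rho> \<in> \<gamma>" using DHom_nonempty[OF assms(3)] by blast
  then show ?thesis
    using Dcomp_mem[OF assms(1,2) _ assms(5)] DHom_mem(4)[OF assms(3) _ assms(5)] assms(4) by metis
qed

text \<open>An equation between two composites would be void if both were empty. The Ore condition
  provides an actual member, from which the equation of maps on homology can be read.\<close>

lemma Dcomp_nonempty:
  fixes scale :: "'k::field \<Rightarrow> 'a::ring_1 \<Rightarrow> 'a" and \<iota> :: "'k list \<Rightarrow> 'm" and X Y Z :: "('a, 'm) cplx"
  assumes alg: "fd_algebra scale" and \<iota>: "inj \<iota>" and \<alpha>: "\<alpha> \<in> DHom X Y" and \<beta>: "\<beta> \<in> DHom Y Z"
  shows "\<exists>\<rho>. \<rho> \<in> Dcomp \<beta> \<alpha>"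
proof -
  obtain r q where r: "r \<in> \<alpha>" and q: "q \<in> \<beta>" using DHom_nonempty \<alpha> \<beta> by meson
  note r' = DHom_mem[OF \<alpha> r] and q' = DHom_mem[OF \<beta> q]
  note R = is_roofD[OF r'(1)] and Q = is_roofD[OF q'(1)]
  have st: "src q = tgt r" using r'(3) q'(2) by simp
  obtain W t h where W: "bounded_complex W" "quasi_iso W (apex r) t" "chain_map W (apex q) h"
    "homotopic W (tgt r) (comp_map (rleg r) t) (comp_map (lleg q) h)"
    by (rule Ore_condition[OF alg \<iota> R(2) Q(2) R(3) R(9) Q(7)[unfolded st]])
  let ?c = "\<lparr>src = src r, apex = W, tgt = tgt q, lleg = comp_map (lleg r) t, rleg = comp_map (rleg q) h\<rparr>"
  have "is_roof ?c" using W R Q quasi_iso_comp[OF bounded_complexD(1)[OF W(1)] R(5,4) W(2) R(7)]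
    chain_map_comp[OF W(3) Q(9)] by (simp add: is_roof_def)
  then have "?c \<in> Dcomp \<beta> \<alpha>" unfolding Dcomp_def using r q W st roof_rel_refl by (auto intro!: bexI exI)
  then show ?thesis ..
qed

lemma Dcomp_eq_Dcomp:
  fixes scale :: "'k::field \<Rightarrow> 'a::ring_1 \<Rightarrow> 'a" and \<iota> :: "'k list \<Rightarrow> 'm" and X Y Y' Z :: "('a, 'm) cplx"
  assumes "fd_algebra scale" "inj \<iota>" "\<alpha> \<in> DHom X Y" "\<beta> \<in> DHom Y Z" "\<alpha>' \<in> DHom X Y'" "\<beta>' \<in> DHom Y' Z"
    and "Dcomp \<beta> \<alpha> = Dcomp \<beta>' \<alpha>'" "S \<in> carrier (homology X i)"
  shows "Dhomology_map i \<beta> (Dhomology_map i \<alpha> S) = Dhomology_map i \<beta>' (Dhomology_map i \<alpha>' S)"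
proof -
  obtain \<rho> where "\<rho> \<in> Dcomp \<beta> \<alpha>" using Dcomp_nonempty[OF assms(1-4)] by blast
  then show ?thesis
    using Dcomp_mem[OF assms(3,4) _ assms(8)] Dcomp_mem[OF assms(5,6) _ assms(8)] assms(7) by metis
qed

lemma Diso_bij:
  assumes "Diso X Y \<alpha>"
  shows "bij_betw (Dhomology_map i \<alpha>) (carrier (homology X i)) (carrier (homology Y i))"
proof -
  obtain \<beta> where \<alpha>: "\<alpha> \<in> DHom X Y" and \<beta>: "\<beta> \<in> DHom Y X" and eq: "Dcomp \<beta> \<alpha> = Did X" "Dcomp \<alpha> \<beta> = Did Y"
    using assms unfolding Diso_def by blast
  note I = Did_DHom[OF DHom_bounded(1)[OF \<alpha>]] Did_DHom[OF DHom_bounded(2)[OF \<alpha>]]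
  note m = mhomD(1)[OF Dhomology_map_mhom[OF \<alpha>]] mhomD(1)[OF Dhomology_map_mhom[OF \<beta>]]
  show ?thesis
  proof (rule bij_betwI)
    show "Dhomology_map i \<alpha> \<in> carrier (homology X i) \<rightarrow> carrier (homology Y i)"
      "Dhomology_map i \<beta> \<in> carrier (homology Y i) \<rightarrow> carrier (homology X i)" using m by auto
    show "Dhomology_map i \<beta> (Dhomology_map i \<alpha> S) = S" if "S \<in> carrier (homology X i)" for S
      using Dcomp_eq_DHom[OF \<alpha> \<beta> I(1) eq(1) that] I(2)[OF that] by simp
    show "Dhomology_map i \<alpha> (Dhomology_map i \<beta> S) = S" if "S \<in> carrier (homology Y i)" for S
      using Dcomp_eq_DHom[OF \<beta> \<alpha> I(3) eq(2) that] I(4)[OF that] by simp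
  qed
qed

section \<open>Exactness of the homology of a distinguished triangle\<close>

lemma is_direct_sumD:
  fixes M :: "('a::ring_1, 'm) module" (structure)
  assumes M: "is_direct_sum M M1 i1 M2 i2"
  shows "i1 \<in> mhom M1 M" "i2 \<in> mhom M2 M"
    "x \<in> carrier M \<Longrightarrow> \<exists>a\<in>carrier M1. \<exists>b\<in>carrier M2. x = i1 a \<oplus> i2 b"
    "a \<in> carrier M1 \<Longrightarrow> b \<in> carrier M2 \<Longrightarrow> a' \<in> carrier M1 \<Longrightarrow> b' \<in> carrier M2 \<Longrightarrow>
      i1 a \<oplus> i2 b = i1 a' \<oplus> i2 b' \<Longrightarrow> a = a' \<and> b = b'"
proof -
  show "i1 \<in> mhom M1 M" "i2 \<in> mhom M2 M" using M by (auto simp: is_direct_sum_def)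
  have inj: "inj_on (\<lambda>(x, y). i1 x \<oplus> i2 y) (carrier M1 \<times> carrier M2)"
    and im: "(\<lambda>(x, y). i1 x \<oplus> i2 y) ` (carrier M1 \<times> carrier M2) = carrier M"
    using M by (auto simp: is_direct_sum_def bij_betw_def)
  show "\<exists>a\<in>carrier M1. \<exists>b\<in>carrier M2. x = i1 a \<oplus> i2 b" if "x \<in> carrier M"
    using that unfolding im[symmetric] by auto
  show "a = a' \<and> b = b'" if "a \<in> carrier M1" "b \<in> carrier M2" "a' \<in> carrier M1" "b' \<in> carrier M2"
    "i1 a \<oplus> i2 b = i1 a' \<oplus> i2 b'"
    using inj_onD[OF inj, of "(a, b)" "(a', b')"] that by simp
qed

text \<open>The first two clauses are exactness at \<open>Y\<close>. The third is injectivity at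
  \<open>X\<close>, with the assumption that every cycle of the cone in degree \<open>i + 1\<close>
  is homologous to one from \<open>Y\<close> taking the place of a vanishing connecting map.\<close>

lemma cone_exact:
  assumes cone: "is_cone X Y f C \<iota> \<pi>" and X: "chain_complex X" and Y: "chain_complex Y" and C: "chain_complex C"
  shows "y \<in> cycles Y i \<Longrightarrow> \<iota> i y \<in> boundaries C i \<Longrightarrow> \<exists>x\<in>cycles X i. hcls Y i y = hcls Y i (f i x)"
    and "x \<in> cycles X i \<Longrightarrow> \<iota> i (f i x) \<in> boundaries C i"
    and "x \<in> cycles X i \<Longrightarrow> f i x \<in> boundaries Y i \<Longrightarrow>
      (\<And>c. c \<in> cycles C (i + 1) \<Longrightarrow> \<exists>y\<in>cycles Y (i + 1). hcls C (i + 1) c = hcls C (i + 1) (\<iota> (i + 1) y)) \<Longrightarrow>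
      x \<in> boundaries X i"
proof -
  note DX = chain_complexD[OF X] and DY = chain_complexD[OF Y] and DC = chain_complexD[OF C]
  have f: "chain_map X Y f" and \<iota>: "chain_map Y C \<iota>" using cone by (auto simp: is_cone_def)
  obtain \<sigma> where ds: "\<And>i. is_direct_sum (ob C i) (ob X (i - 1)) (\<sigma> i) (ob Y i) (\<iota> i)"
    and d\<sigma>: "\<And>i x. x \<in> chains X (i - 1) \<Longrightarrow> bd C i (\<sigma> i x) =
      \<sigma> (i - 1) (\<ominus>\<^bsub>ob X (i - 2)\<^esub> bd X (i - 1) x) \<oplus>\<^bsub>ob C (i - 1)\<^esub> \<iota> (i - 1) (f (i - 1) x)"
    using cone unfolding is_cone_def by blast
  note fc = mhomD(1)[OF chain_mapD(1)[OF f]] and \<iota>c = mhomD(1)[OF chain_mapD(1)[OF \<iota>]]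
  have \<sigma>: "\<sigma> (i + 1) \<in> mhom (ob X i) (ob C (i + 1))" for i using is_direct_sumD(1)[OF ds[of "i + 1"]] by simp
  note \<sigma>i = is_direct_sumD(1)[OF ds]
  \<comment> \<open>The differential of the cone in coordinates, stated from degree
    \<open>i + 1\<close> so that the \<open>X\<close>-component has degree \<open>i\<close>
    literally instead of \<open>i + 1 - 1\<close>.\<close>
  have d: "bd C (i + 1) (\<sigma> (i + 1) x \<oplus>\<^bsub>ob C (i + 1)\<^esub> \<iota> (i + 1) y)
      = \<sigma> i (\<ominus>\<^bsub>ob X (i - 1)\<^esub> bd X i x) \<oplus>\<^bsub>ob C i\<^esub> \<iota> i (f i x \<oplus>\<^bsub>ob Y i\<^esub> bd Y (i + 1) y)"
    if x: "x \<in> chains X i" and y: "y \<in> chains Y (i + 1)" for i x y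
  proof -
    have dx: "\<ominus>\<^bsub>ob X (i - 1)\<^esub> bd X i x \<in> chains X (i - 1)" using mhomD(1)[OF DX(2) x] DX(1) by (simp add: lmodule_group)
    note dy = mhomD(1)[OF DY(3) y]
    have "bd C (i + 1) (\<sigma> (i + 1) x) = \<sigma> i (\<ominus>\<^bsub>ob X (i - 1)\<^esub> bd X i x) \<oplus>\<^bsub>ob C i\<^esub> \<iota> i (f i x)"
      using d\<sigma>[of x "i + 1"] x by simp
    moreover have "bd C (i + 1) (\<iota> (i + 1) y) = \<iota> i (bd Y (i + 1) y)" by (rule chain_mapD(3)[OF \<iota> y])
    ultimately show ?thesis
      using mhomD(1)[OF \<sigma> x] \<iota>c[OF y] mhomD(1)[OF \<sigma>i dx] \<iota>c[OF fc[OF x]] \<iota>c[OF dy] DC(1)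
      by (simp add: mhomD(2)[OF DC(3)] mhomD(2)[OF chain_mapD(1)[OF \<iota>] fc[OF x] dy] lmodule_ac)
  qed
  have \<sigma>0: "\<sigma> i \<zero>\<^bsub>ob X (i - 1)\<^esub> = \<zero>\<^bsub>ob C i\<^esub>" for i by (rule mhom_zero[OF \<sigma>i DX(1) DC(1)])
  have \<iota>0: "\<iota> i \<zero>\<^bsub>ob Y i\<^esub> = \<zero>\<^bsub>ob C i\<^esub>" for i by (rule mhom_zero[OF chain_mapD(1)[OF \<iota>] DY(1) DC(1)])
  show "\<exists>x\<in>cycles X i. hcls Y i y = hcls Y i (f i x)" if y: "y \<in> cycles Y i" "\<iota> i y \<in> boundaries C i"
  proof -
    note yc = cyclesD(1)[OF y(1)]
    obtain c where c: "c \<in> chains C (i + 1)" "\<iota> i y = bd C (i + 1) c" using y(2) by (auto simp: boundaries_def)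
    obtain x y' where x: "x \<in> chains X i" and y': "y' \<in> chains Y (i + 1)"
      and ce: "c = \<sigma> (i + 1) x \<oplus>\<^bsub>ob C (i + 1)\<^esub> \<iota> (i + 1) y'"
      using is_direct_sumD(3)[OF ds c(1)] by auto
    have dx: "\<ominus>\<^bsub>ob X (i - 1)\<^esub> bd X i x \<in> chains X (i - 1)" using mhomD(1)[OF DX(2) x] DX(1) by (simp add: lmodule_group)
    have s: "f i x \<oplus>\<^bsub>ob Y i\<^esub> bd Y (i + 1) y' \<in> chains Y i"
      using fc[OF x] mhomD(1)[OF DY(3) y'] DY(1) by (simp add: lmodule_group)
    have "\<sigma> i \<zero>\<^bsub>ob X (i - 1)\<^esub> \<oplus>\<^bsub>ob C i\<^esub> \<iota> i y
        = \<sigma> i (\<ominus>\<^bsub>ob X (i - 1)\<^esub> bd X i x) \<oplus>\<^bsub>ob C i\<^esub> \<iota> i (f i x \<oplus>\<^bsub>ob Y i\<^esub> bd Y (i + 1) y')"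
      using c(2) \<iota>c[OF yc] DC(1) by (simp add: \<sigma>0 lmodule_group ce d[OF x y'])
    from is_direct_sumD(4)[OF ds lmodule_group(1)[OF DX(1)] yc dx s this]
    have e: "\<zero>\<^bsub>ob X (i - 1)\<^esub> = \<ominus>\<^bsub>ob X (i - 1)\<^esub> bd X i x" "y = f i x \<oplus>\<^bsub>ob Y i\<^esub> bd Y (i + 1) y'" by auto
    have "bd X i x = \<zero>\<^bsub>ob X (i - 1)\<^esub>"
      using e(1) lmodule_group(10)[OF DX(1) mhomD(1)[OF DX(2) x]] lmodule_group(11)[OF DX(1), of "i - 1"] by simp
    then have "x \<in> cycles X i" using x by (simp add: cycles_def)
    then show ?thesis using hcls_eq_iff[OF Y yc fc[OF x]] e(2) y' by blast
  qed
  show "\<iota> i (f i x) \<in> boundaries C i" if x: "x \<in> cycles X i"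
  proof -
    note xc = cyclesD(1)[OF x]
    have z: "\<zero>\<^bsub>ob Y (i + 1)\<^esub> \<in> chains Y (i + 1)" by (rule lmodule_group(1)[OF DY(1)])
    have "bd C (i + 1) (\<sigma> (i + 1) x \<oplus>\<^bsub>ob C (i + 1)\<^esub> \<iota> (i + 1) \<zero>\<^bsub>ob Y (i + 1)\<^esub>) = \<iota> i (f i x)"
      using fc[OF xc] \<iota>c[OF fc[OF xc]] DX(1) DY(1) DC(1) mhom_zero[OF DY(3) DY(1) DY(1)]
      by (simp add: d[OF xc z] cyclesD(2)[OF x] lmodule_group \<sigma>0)
    moreover have "\<sigma> (i + 1) x \<oplus>\<^bsub>ob C (i + 1)\<^esub> \<iota> (i + 1) \<zero>\<^bsub>ob Y (i + 1)\<^esub> \<in> chains C (i + 1)"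
      using mhomD(1)[OF \<sigma> xc] \<iota>c[OF z] DC(1) by (simp add: lmodule_group)
    ultimately show ?thesis unfolding boundaries_def by (metis image_eqI)
  qed
  show "x \<in> boundaries X i" if x: "x \<in> cycles X i" "f i x \<in> boundaries Y i"
    and surj: "\<And>c. c \<in> cycles C (i + 1) \<Longrightarrow> \<exists>y\<in>cycles Y (i + 1). hcls C (i + 1) c = hcls C (i + 1) (\<iota> (i + 1) y)"
  proof -
    note xc = cyclesD(1)[OF x(1)]
    obtain y where y: "y \<in> chains Y (i + 1)" "f i x = bd Y (i + 1) y" using x(2) by (auto simp: boundaries_def)
    have ny: "\<ominus>\<^bsub>ob Y (i + 1)\<^esub> y \<in> chains Y (i + 1)" using y DY(1) by (simp add: lmodule_group)
    \<comment> \<open>As f x = d y, the pair (x, -y) is a cycle of the cone. By assumption it is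
      \<iota> y' + d e for a cycle y' of \<open>Y\<close>. Only d e contributes to the
      \<open>X\<close>-component, namely - d x2 where x2 is the \<open>X\<close>-component of
      \<open>e\<close>; hence x = d (- x2).\<close>
    let ?c = "\<sigma> (i + 1) x \<oplus>\<^bsub>ob C (i + 1)\<^esub> \<iota> (i + 1) (\<ominus>\<^bsub>ob Y (i + 1)\<^esub> y)"
    have cc: "?c \<in> chains C (i + 1)" using mhomD(1)[OF \<sigma> xc] \<iota>c[OF ny] DC(1) by (simp add: lmodule_group)
    have "bd C (i + 1) ?c = \<zero>\<^bsub>ob C i\<^esub>"
      using y DX(1) DY(1) DC(1) mhomD(1)[OF DY(3) y(1)]
      by (simp add: d[OF xc ny] cyclesD(2)[OF x(1)] lmodule_group \<sigma>0 \<iota>0 mhom_neg[OF DY(3)])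
    then have "?c \<in> cycles C (i + 1)" using cc by (simp add: cycles_def)
    then obtain y' where y': "y' \<in> cycles Y (i + 1)" "hcls C (i + 1) ?c = hcls C (i + 1) (\<iota> (i + 1) y')"
      using surj by blast
    note yc' = cyclesD(1)[OF y'(1)]
    obtain e where e: "e \<in> chains C (i + 1 + 1)" "?c = \<iota> (i + 1) y' \<oplus>\<^bsub>ob C (i + 1)\<^esub> bd C (i + 1 + 1) e"
      using y'(2) hcls_eq_iff[OF C cc \<iota>c[OF yc']] by blast
    obtain x2 y2 where x2: "x2 \<in> chains X (i + 1)" and y2: "y2 \<in> chains Y (i + 1 + 1)"
      and ee: "e = \<sigma> (i + 1 + 1) x2 \<oplus>\<^bsub>ob C (i + 1 + 1)\<^esub> \<iota> (i + 1 + 1) y2"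
      using is_direct_sumD(3)[OF ds e(1), unfolded add_diff_cancel_right'] by blast
    have dx0: "bd X (i + 1) x2 \<in> chains X i" by (rule mhomD(1)[OF DX(3) x2])
    have dx: "\<ominus>\<^bsub>ob X i\<^esub> bd X (i + 1) x2 \<in> chains X i" using dx0 DX(1) by (simp add: lmodule_group)
    define y3 where "y3 = f (i + 1) x2 \<oplus>\<^bsub>ob Y (i + 1)\<^esub> bd Y (i + 1 + 1) y2"
    have s: "y3 \<in> chains Y (i + 1)"
      using fc[OF x2] mhomD(1)[OF DY(3) y2] lmodule_group(2)[OF DY(1)] unfolding y3_def by blast
    have de: "bd C (i + 1 + 1) e = \<sigma> (i + 1) (\<ominus>\<^bsub>ob X i\<^esub> bd X (i + 1) x2) \<oplus>\<^bsub>ob C (i + 1)\<^esub> \<iota> (i + 1) y3"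
      unfolding ee y3_def using d[OF x2 y2] unfolding add_diff_cancel_right' .
    have "?c = \<sigma> (i + 1) (\<ominus>\<^bsub>ob X i\<^esub> bd X (i + 1) x2) \<oplus>\<^bsub>ob C (i + 1)\<^esub> \<iota> (i + 1) (y' \<oplus>\<^bsub>ob Y (i + 1)\<^esub> y3)"
      unfolding e(2) de using \<iota>c[OF yc'] \<iota>c[OF s] mhomD(1)[OF \<sigma> dx] DC(1)
      by (simp add: mhomD(2)[OF chain_mapD(1)[OF \<iota>] yc' s] lmodule_ac)
    moreover have "y' \<oplus>\<^bsub>ob Y (i + 1)\<^esub> y3 \<in> chains Y (i + 1)" using yc' s DY(1) by (simp add: lmodule_group)
    ultimately have "x = \<ominus>\<^bsub>ob X i\<^esub> bd X (i + 1) x2"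
      using is_direct_sumD(4)[OF ds[of "i + 1"], of x "\<ominus>\<^bsub>ob Y (i + 1)\<^esub> y" "\<ominus>\<^bsub>ob X i\<^esub> bd X (i + 1) x2"
          "y' \<oplus>\<^bsub>ob Y (i + 1)\<^esub> y3"] xc ny dx by simp
    then have "x = bd X (i + 1) (\<ominus>\<^bsub>ob X (i + 1)\<^esub> x2)" by (simp add: mhom_neg[OF DX(3) DX(1) DX(1) x2])
    moreover have "\<ominus>\<^bsub>ob X (i + 1)\<^esub> x2 \<in> chains X (i + 1)" using x2 DX(1) by (simp add: lmodule_group)
    ultimately show ?thesis unfolding boundaries_def by (metis image_eqI)
  qed
qed

text \<open>The bijections that \<open>a\<close>, \<open>b\<close>, \<open>c\<close> induce on
  homology carry the chases in the cone over to the triangle; surjectivity of \<open>v\<close> in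
  degree \<open>i + 1\<close> becomes the assumption on cycles of the cone.\<close>

lemma triangle_homology_exact:
  fixes scale :: "'k::field \<Rightarrow> 'a::ring_1 \<Rightarrow> 'a" and \<iota> :: "'k list \<Rightarrow> 'm" and L M N :: "('a, 'm) cplx"
  assumes alg: "fd_algebra scale" and inj\<iota>: "inj \<iota>" and tri: "distinguished_triangle L M N u v w"
  shows "Dhomology_map i u ` carrier (homology L i)
      = {S \<in> carrier (homology M i). Dhomology_map i v S = \<zero>\<^bsub>homology N i\<^esub>}"
    and "Dhomology_map (i + 1) v ` carrier (homology M (i + 1)) = carrier (homology N (i + 1)) \<Longrightarrow>
      inj_on (Dhomology_map i u) (carrier (homology L i))"
proof -
  from tri obtain X Y C f \<iota> \<pi> a b c where uD: "u \<in> DHom L M" and vD: "v \<in> DHom M N"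
    and bX: "bounded_complex X" and bY: "bounded_complex Y" and bC: "bounded_complex C" and cone: "is_cone X Y f C \<iota> \<pi>"
    and ia: "Diso L X a" and ib: "Diso M Y b" and ic: "Diso N C c"
    and sq1: "Dcomp b u = Dcomp (DQ X Y f) a" and sq2: "Dcomp c v = Dcomp (DQ Y C \<iota>) b"
    unfolding distinguished_triangle_def by blast
  have f: "chain_map X Y f" and \<iota>: "chain_map Y C \<iota>" using cone by (auto simp: is_cone_def)
  note cX = bounded_complexD(1)[OF bX] and cY = bounded_complexD(1)[OF bY] and cC = bounded_complexD(1)[OF bC]
  have aD: "a \<in> DHom L X" and bD: "b \<in> DHom M Y" and cD: "c \<in> DHom N C" using ia ib ic by (auto simp: Diso_def)
  note cL = bounded_complexD(1)[OF DHom_bounded(1)[OF aD]] and cM = bounded_complexD(1)[OF DHom_bounded(1)[OF bD]]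
    and cN = bounded_complexD(1)[OF DHom_bounded(1)[OF cD]]
  note qf = DQ_DHom[OF bX bY f] and q\<iota> = DQ_DHom[OF bY bC \<iota>]
  note um = Dhomology_map_mhom[OF uD] and vm = Dhomology_map_mhom[OF vD]
    and am = Dhomology_map_mhom[OF aD] and bm = Dhomology_map_mhom[OF bD] and cm = Dhomology_map_mhom[OF cD]
  note hf = homology_map_hcls[OF cX cY f] and h\<iota> = homology_map_hcls[OF cY cC \<iota>]
  note LL = lmodule_homology[OF cL] and LM = lmodule_homology[OF cM] and LN = lmodule_homology[OF cN]
    and LX = lmodule_homology[OF cX] and LY = lmodule_homology[OF cY] and LC = lmodule_homology[OF cC]
  note fc = mhomD(1)[OF chain_mapD(1)[OF f]] and \<iota>c = mhomD(1)[OF chain_mapD(1)[OF \<iota>]]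
  have S1: "Dhomology_map i b (Dhomology_map i u S) = homology_map Y i f (Dhomology_map i a S)"
    if "S \<in> carrier (homology L i)" for S i
    using Dcomp_eq_Dcomp[OF alg inj\<iota> uD bD aD qf(1) sq1 that] qf(2)[OF mhomD(1)[OF am that]] by simp
  have S2: "Dhomology_map i c (Dhomology_map i v S) = homology_map C i \<iota> (Dhomology_map i b S)"
    if "S \<in> carrier (homology M i)" for S i
    using Dcomp_eq_Dcomp[OF alg inj\<iota> vD cD bD q\<iota>(1) sq2 that] q\<iota>(2)[OF mhomD(1)[OF bm that]] by simp
  have inj: "inj_on (Dhomology_map i a) (carrier (homology L i))" "inj_on (Dhomology_map i b) (carrier (homology M i))"
      "inj_on (Dhomology_map i c) (carrier (homology N i))"
    and sur: "Dhomology_map i a ` carrier (homology L i) = carrier (homology X i)"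
      "Dhomology_map i b ` carrier (homology M i) = carrier (homology Y i)"
      "Dhomology_map i c ` carrier (homology N i) = carrier (homology C i)" for i
    using Diso_bij[OF ia] Diso_bij[OF ib] Diso_bij[OF ic] by (auto simp: bij_betw_def)
  \<comment> \<open>The map induced by \<open>c\<close> is injective, so vanishing may be tested
    after it, where the square turns \<open>v\<close> into \<iota>.\<close>
  have v0: "Dhomology_map i v S = \<zero>\<^bsub>homology N i\<^esub> \<longleftrightarrow> homology_map C i \<iota> (Dhomology_map i b S) = \<zero>\<^bsub>homology C i\<^esub>"
    if S: "S \<in> carrier (homology M i)" for S i
    using S2[OF S] mhom_zero[OF cm LN LC] mhom_inj_iff[OF cm LN LC] inj(3) mhomD(1)[OF vm S] by metis
  let ?u = "Dhomology_map i u" and ?v = "Dhomology_map i v" and ?a = "Dhomology_map i a" and ?b = "Dhomology_map i b"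
  show "?u ` carrier (homology L i)
      = {S \<in> carrier (homology M i). ?v S = \<zero>\<^bsub>homology N i\<^esub>}"
  proof
    show "?u ` carrier (homology L i) \<subseteq> {S \<in> carrier (homology M i). ?v S = \<zero>\<^bsub>homology N i\<^esub>}"
    proof clarify
      fix T assume T: "T \<in> carrier (homology L i)"
      note uT = mhomD(1)[OF um T]
      obtain x where x: "x \<in> cycles X i" "?a T = hcls X i x"
        by (rule hcls_cases[OF cX mhomD(1)[OF am T]])
      note xc = cyclesD(1)[OF x(1)]
      have "homology_map C i \<iota> (?b (?u T)) = \<zero>\<^bsub>homology C i\<^esub>"
        using cone_exact(2)[OF cone cX cY cC x(1)] hcls_eq_zero_iff[OF cC \<iota>c[OF fc[OF xc]]]
        by (simp add: S1[OF T] x(2) hf[OF xc] h\<iota>[OF fc[OF xc]])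
      then show "?u T \<in> carrier (homology M i) \<and> ?v (?u T) = \<zero>\<^bsub>homology N i\<^esub>"
        using uT v0[OF uT] by simp
    qed
    show "{S \<in> carrier (homology M i). ?v S = \<zero>\<^bsub>homology N i\<^esub>} \<subseteq> ?u ` carrier (homology L i)"
    proof clarify
      fix S assume S: "S \<in> carrier (homology M i)" "?v S = \<zero>\<^bsub>homology N i\<^esub>"
      obtain y where y: "y \<in> cycles Y i" "?b S = hcls Y i y"
        by (rule hcls_cases[OF cY mhomD(1)[OF bm S(1)]])
      note yc = cyclesD(1)[OF y(1)]
      have "hcls C i (\<iota> i y) = \<zero>\<^bsub>homology C i\<^esub>" using v0[OF S(1)] S(2) y(2) h\<iota>[OF yc] by simp
      then have "\<iota> i y \<in> boundaries C i" using hcls_eq_zero_iff[OF cC \<iota>c[OF yc]] by simp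
      then obtain x where x: "x \<in> cycles X i" "hcls Y i y = hcls Y i (f i x)"
        using cone_exact(1)[OF cone cX cY cC y(1)] by blast
      have "hcls X i x \<in> ?a ` carrier (homology L i)" unfolding sur by (rule hcls_in[OF cX x(1)])
      then obtain T where T: "T \<in> carrier (homology L i)" "?a T = hcls X i x" by auto
      have "?b (?u T) = ?b S"
        using S1[OF T(1)] T(2) hf[OF cyclesD(1)[OF x(1)]] x(2) y(2) by simp
      then have "S = ?u T" using inj_onD[OF inj(2) _ mhomD(1)[OF um T(1)] S(1)] by simp
      then show "S \<in> ?u ` carrier (homology L i)" using T(1) by blast
    qed
  qed
  assume vs: "Dhomology_map (i + 1) v ` carrier (homology M (i + 1)) = carrier (homology N (i + 1))"
  have surj: "\<exists>y\<in>cycles Y (i + 1). hcls C (i + 1) z = hcls C (i + 1) (\<iota> (i + 1) y)" if z: "z \<in> cycles C (i + 1)" for z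
  proof -
    have "hcls C (i + 1) z \<in> Dhomology_map (i + 1) c ` Dhomology_map (i + 1) v ` carrier (homology M (i + 1))"
      unfolding vs sur by (rule hcls_in[OF cC z])
    then obtain S where S: "S \<in> carrier (homology M (i + 1))"
      "hcls C (i + 1) z = Dhomology_map (i + 1) c (Dhomology_map (i + 1) v S)" by auto
    obtain y where y: "y \<in> cycles Y (i + 1)" "Dhomology_map (i + 1) b S = hcls Y (i + 1) y"
      by (rule hcls_cases[OF cY mhomD(1)[OF bm S(1)]])
    then show ?thesis using S(2) S2[OF S(1)] h\<iota>[OF cyclesD(1)[OF y(1)]] by auto
  qed
  have "T = \<zero>\<^bsub>homology L i\<^esub>" if T: "T \<in> carrier (homology L i)" "?u T = \<zero>\<^bsub>homology M i\<^esub>" for T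
  proof -
    obtain x where x: "x \<in> cycles X i" "?a T = hcls X i x"
      by (rule hcls_cases[OF cX mhomD(1)[OF am T(1)]])
    note xc = cyclesD(1)[OF x(1)]
    have "hcls Y i (f i x) = \<zero>\<^bsub>homology Y i\<^esub>"
      using S1[OF T(1)] T(2) mhom_zero[OF bm LM LY] x(2) hf[OF xc] by simp
    then have "f i x \<in> boundaries Y i" using hcls_eq_zero_iff[OF cY fc[OF xc]] by simp
    then have "x \<in> boundaries X i" using cone_exact(3)[OF cone cX cY cC x(1) _ surj] by blast
    then have "?a T = \<zero>\<^bsub>homology X i\<^esub>" using hcls_eq_zero_iff[OF cX xc] x(2) by simp
    then show ?thesis using mhom_inj_iff[OF am LL LX] inj(1) T(1) by blast
  qed
  then show "inj_on ?u (carrier (homology L i))" using mhom_inj_iff[OF um LL LM] by blast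
qed

section \<open>Lifting maps along the homology of an Auslander-Reiten triangle\<close>

text \<open>Since \<open>N\<close> vanishes in negative degrees, all of \<open>N 0\<close> consists of cycles, so that its pullback along
  \<open>h\<close> surjects onto \<open>Y\<close>.\<close>

lemma complex_over:
  fixes scale :: "'k::field \<Rightarrow> 'a::ring_1 \<Rightarrow> 'a" and \<iota> :: "'k list \<Rightarrow> 'm"
    and N :: "('a, 'm) cplx" and Y :: "('a, 'y) module"
  assumes alg: "fd_algebra scale" and \<iota>: "inj \<iota>" and N: "bounded_complex N"
    and neg: "\<And>i. i < 0 \<Longrightarrow> zero_module (ob N i)"
    and Y: "fg_module Y" and h: "h \<in> mhom Y (homology N 0)"
  obtains W :: "('a, 'm) cplx" and \<phi> \<kappa> where "bounded_complex W" "chain_map W N \<phi>"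
    "\<kappa> \<in> mhom (homology W 0) Y" "bij_betw \<kappa> (carrier (homology W 0)) (carrier Y)"
    "\<forall>T\<in>carrier (homology W 0). homology_map N 0 \<phi> T = h (\<kappa> T)"
    "carrier (homology N 1) \<subseteq> homology_map N 1 \<phi> ` carrier (homology W 1)"
proof -
  note cN = bounded_complexD(1)[OF N]
  note DN = chain_complexD[OF cN] and LH = lmodule_homology[OF cN] and LY = fg_lmodule[OF Y]
  have c0: "cycles N 0 = chains N 0"
    using neg[of "-1"] mhomD(1)[OF DN(2)[of 0]] by (auto simp: cycles_def zero_module_def)
  have hc: "hcls N 0 \<in> mhom (ob N 0) (homology N 0)"
    using hcls(1)[OF cN, of 0] unfolding c0 mhom_restr_carrier .
  let ?P = "mprod (ob N 0) Y"
  note fgP = fg_module_mprod[OF bounded_complexD(2)[OF N, of 0] Y]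
  note LP = fg_lmodule[OF fgP]
  define K where "K = {x \<in> carrier ?P. hcls N 0 (fst x) \<oplus>\<^bsub>homology N 0\<^esub> \<ominus>\<^bsub>homology N 0\<^esub> h (snd x) = \<zero>\<^bsub>homology N 0\<^esub>}"
  have K: "lsubmodule K ?P" unfolding K_def
    by (intro lsubmodule_kernel mhom_add mhom_uminus LH LP mhom_comp[OF mhom_fst hc] mhom_comp[OF mhom_snd h])
  have K_iff: "(n, y) \<in> K \<longleftrightarrow> n \<in> chains N 0 \<and> y \<in> carrier Y \<and> hcls N 0 n = h y" for n y
    using lmodule_diff_zero_iff[OF LH mhomD(1)[OF hc] mhomD(1)[OF h], of n y] by (auto simp: K_def)
  note fgK = fg_module_restr[OF alg fgP K] and LK = lmodule_restr[OF LP K]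
  obtain Q :: "('a, 'm) module" and j k where Q: "fg_module Q"
    and j: "j \<in> mhom (restr ?P K) Q" and k: "k \<in> mhom Q (restr ?P K)"
    and kj: "\<And>x. x \<in> carrier (restr ?P K) \<Longrightarrow> k (j x) = x" and jk: "\<And>x. x \<in> carrier Q \<Longrightarrow> j (k x) = x"
    by (rule fg_module_copy[OF alg \<iota> fgK]) blast
  note LQ = fg_lmodule[OF Q]
  have kP: "k \<in> mhom Q ?P" using k lsubmoduleD(1)[OF K] by (rule mhom_restr_incl)
  define p where "p x = fst (k x)" for x
  define q where "q x = snd (k x)" for x
  have p: "p \<in> mhom Q (ob N 0)" and q: "q \<in> mhom Q Y"
    using mhom_comp[OF kP mhom_fst] mhom_comp[OF kP mhom_snd] by (simp_all add: p_def[abs_def] q_def[abs_def])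
  have kx: "k x = (p x, q x)" for x by (simp add: p_def q_def)
  have pq: "hcls N 0 (p x) = h (q x)" if "x \<in> carrier Q" for x
    using mhomD(1)[OF k that] K_iff[of "p x" "q x"] by (simp add: kx)
  have ex: "\<exists>x\<in>carrier Q. p x = n \<and> q x = y" if "n \<in> chains N 0" "y \<in> carrier Y" "hcls N 0 n = h y" for n y
    using that K_iff[of n y] mhomD(1)[OF j, of "(n, y)"] kj[of "(n, y)"]
    by (intro bexI[of _ "j (n, y)"]) (auto simp: p_def q_def)
  have inj: "x = x'" if "x \<in> carrier Q" "x' \<in> carrier Q" "p x = p x'" "q x = q x'" for x x'
    using that jk kx by metis
  have h0: "h \<zero>\<^bsub>Y\<^esub> = \<zero>\<^bsub>homology N 0\<^esub>" by (rule mhom_zero[OF h LY LH])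
  \<comment> \<open>The pair lies in the pullback because a boundary has class zero, which is also
    the value of \<open>h\<close> at zero.\<close>
  define d1 where "d1 z = j (bd N 1 z, \<zero>\<^bsub>Y\<^esub>)" for z
  have bd1: "bd N 1 \<in> mhom (ob N 1) (ob N 0)" using DN(2)[of 1] by simp
  have b0: "hcls N 0 (bd N 1 z) = h \<zero>\<^bsub>Y\<^esub>" if "z \<in> chains N 1" for z
    using hcls_eq_zero_iff[OF cN mhomD(1)[OF bd1 that]] that h0 by (simp add: boundaries_def)
  have d1: "d1 \<in> mhom (ob N 1) Q"
  proof -
    have "(\<lambda>z. (bd N 1 z, \<zero>\<^bsub>Y\<^esub>)) \<in> mhom (ob N 1) ?P" by (intro mhom_pair bd1 mhom_const_zero LY)
    then have "(\<lambda>z. (bd N 1 z, \<zero>\<^bsub>Y\<^esub>)) \<in> mhom (ob N 1) (restr ?P K)"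
      using b0 mhomD(1)[OF bd1] lmodule_group(1)[OF LY] by (simp add: mhom_def K_iff)
    from mhom_comp[OF this j] show ?thesis by (simp add: d1_def[abs_def])
  qed
  have pd1: "p (d1 z) = bd N 1 z" "q (d1 z) = \<zero>\<^bsub>Y\<^esub>" if "z \<in> chains N 1" for z
    using kj[of "(bd N 1 z, \<zero>\<^bsub>Y\<^esub>)"] K_iff[of "bd N 1 z" "\<zero>\<^bsub>Y\<^esub>"] b0[OF that] mhomD(1)[OF bd1 that] lmodule_group(1)[OF LY]
    by (simp_all add: d1_def p_def q_def)
  \<comment> \<open>Only the term in degree 0 is exchanged, so only the differentials entering and
    leaving it change; in all other degrees \<open>W\<close> is \<open>N\<close> and \<phi> is the
    identity.\<close>
  define W where "W = \<lparr>ob = (\<lambda>i. if i = 0 then Q else ob N i),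
    bd = (\<lambda>i. if i = 1 then d1 else if i = 0 then (\<lambda>x. bd N 0 (p x)) else bd N i)\<rparr>"
  have W0: "ob W 0 = Q" "bd W 0 = (\<lambda>x. bd N 0 (p x))" "bd W 1 = d1"
    and Wi: "i \<noteq> 0 \<Longrightarrow> ob W i = ob N i" "i \<noteq> 0 \<Longrightarrow> i \<noteq> 1 \<Longrightarrow> bd W i = bd N i" for i
    by (auto simp: W_def)
  define \<phi> where "\<phi> i = (if i = 0 then p else (\<lambda>x. x))" for i :: int
  obtain n where n: "\<And>i. \<bar>i\<bar> > n \<Longrightarrow> zero_module (ob N i)" using bounded_complex_bound[OF N] by blast
  have bW: "bounded_complex W"
  proof (rule bounded_complexI)
    fix i
    show "fg_module (ob W i)" using Q bounded_complexD(2)[OF N] by (simp add: W_def)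
    show bdi: "bd W i \<in> mhom (ob W i) (ob W (i - 1))"
    proof -
      consider "i = 0" | "i = 1" | "i \<noteq> 0" "i \<noteq> 1" by blast
      then show ?thesis
      proof cases
        case 1
        show ?thesis using mhom_comp[OF p DN(2)[of 0]] unfolding 1 by (simp add: W0 Wi)
      next
        case 2
        show ?thesis using d1 unfolding 2 by (simp add: W0 Wi)
      qed (simp add: Wi DN)
    qed
    show "bd W (i - 1) (bd W i x) = \<zero>\<^bsub>ob W (i - 2)\<^esub>" if x: "x \<in> chains W i" for x
    proof -
      consider "i = 0" | "i = 1" | "i = 2" | "i \<noteq> 0" "i \<noteq> 1" "i \<noteq> 2" by blast
      then show ?thesis
      proof cases
        case 1
        then show ?thesis using x DN(5)[OF mhomD(1)[OF p]] by (simp add: W0 Wi)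
      next
        case 2
        then show ?thesis using x DN(5)[of x 1] by (simp add: W0 Wi pd1)
      next
        case 3
        then have x2: "x \<in> chains N 2" using x by (simp add: Wi)
        have c: "bd N 2 x \<in> chains N 1" using mhomD(1)[OF DN(2)[of 2] x2] by simp
        have "d1 (bd N 2 x) = \<zero>\<^bsub>Q\<^esub>"
        proof (rule inj)
          show "p (d1 (bd N 2 x)) = p \<zero>\<^bsub>Q\<^esub>" using pd1[OF c] DN(5)[OF x2] mhom_zero[OF p LQ DN(1)] by simp
          show "q (d1 (bd N 2 x)) = q \<zero>\<^bsub>Q\<^esub>" using pd1[OF c] mhom_zero[OF q LQ LY] by simp
        qed (use mhomD(1)[OF d1 c] lmodule_group(1)[OF LQ] in auto)
        then show ?thesis unfolding 3 by (simp add: W0 Wi)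
      next
        case 4
        then show ?thesis using x DN(5) by (simp add: Wi)
      qed
    qed
    show "zero_module (ob W i)" if "\<bar>i\<bar> > max n 0" using that n by (simp add: Wi)
  qed
  note cW = bounded_complexD(1)[OF bW]
  have \<phi>: "chain_map W N \<phi>"
    unfolding chain_map_def
  proof (intro allI conjI ballI)
    fix i
    show "\<phi> i \<in> mhom (ob W i) (ob N i)" using p by (simp add: \<phi>_def W_def mhom_id)
    show "bd N i (\<phi> i x) = \<phi> (i - 1) (bd W i x)" if "x \<in> chains W i" for x
      using that by (auto simp: \<phi>_def W0 Wi pd1)
  qed
  have cW0: "cycles W 0 = carrier Q"
    using neg[of "-1"] mhomD(1)[OF chain_complexD(2)[OF cW, of 0]] by (auto simp: cycles_def zero_module_def W0 Wi)
  have hW: "hcls W 0 \<in> mhom Q (homology W 0)"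
    using hcls(1)[OF cW, of 0] unfolding cW0 W0 mhom_restr_carrier .
  have imW: "hcls W 0 ` carrier Q = carrier (homology W 0)" using hcls(2)[OF cW] cW0 by simp
  \<comment> \<open>The kernel of the projection \<open>q\<close> consists of the pairs (n, 0) with
    \<open>n\<close> a boundary, which is the image of \<open>d1\<close>. So \<open>q\<close>
    induces an isomorphism \<kappa> of H_0(W) with \<open>Y\<close>.\<close>
  have W0_iff: "hcls W 0 x = \<zero>\<^bsub>homology W 0\<^esub> \<longleftrightarrow> q x = \<zero>\<^bsub>Y\<^esub>" if x: "x \<in> carrier Q" for x
  proof -
    have "hcls W 0 x = \<zero>\<^bsub>homology W 0\<^esub> \<longleftrightarrow> (\<exists>z\<in>chains N 1. x = d1 z)"
      using hcls_eq_zero_iff[OF cW, of x 0] x by (auto simp: boundaries_def W0 Wi)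
    also have "\<dots> \<longleftrightarrow> q x = \<zero>\<^bsub>Y\<^esub>"
    proof
      assume qx: "q x = \<zero>\<^bsub>Y\<^esub>"
      then have "hcls N 0 (p x) = \<zero>\<^bsub>homology N 0\<^esub>" using pq[OF x] h0 by simp
      then have "p x \<in> boundaries N 0" using hcls_eq_zero_iff[OF cN mhomD(1)[OF p x]] by simp
      then obtain z where z: "z \<in> chains N 1" "p x = bd N 1 z" by (auto simp: boundaries_def)
      have "x = d1 z" by (rule inj[OF x mhomD(1)[OF d1 z(1)]]) (simp_all add: pd1[OF z(1)] z(2) qx)
      with z show "\<exists>z\<in>chains N 1. x = d1 z" by blast
    qed (auto simp: pd1)
    finally show ?thesis .
  qed
  obtain \<kappa> where \<kappa>: "\<kappa> \<in> mhom (homology W 0) Y" "\<And>x. x \<in> carrier Q \<Longrightarrow> \<kappa> (hcls W 0 x) = q x"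
    by (rule mhom_factor_surj[OF LQ lmodule_homology[OF cW] LY hW imW q]) (use W0_iff in blast)+
  have "T = \<zero>\<^bsub>homology W 0\<^esub>" if T: "T \<in> carrier (homology W 0)" "\<kappa> T = \<zero>\<^bsub>Y\<^esub>" for T
  proof -
    obtain x where "x \<in> carrier Q" "T = hcls W 0 x" using T(1) unfolding imW[symmetric] by auto
    then show ?thesis using T(2) \<kappa>(2) W0_iff by simp
  qed
  then have "inj_on \<kappa> (carrier (homology W 0))"
    using mhom_inj_iff[OF \<kappa>(1) lmodule_homology[OF cW] LY] by blast
  moreover have "carrier Y \<subseteq> \<kappa> ` carrier (homology W 0)"
  proof
    fix y assume y: "y \<in> carrier Y"
    have "h y \<in> hcls N 0 ` chains N 0" using mhomD(1)[OF h y] hcls(2)[OF cN, of 0] c0 by simp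
    then obtain n where "n \<in> chains N 0" "hcls N 0 n = h y" by auto
    then obtain x where "x \<in> carrier Q" "q x = y" using ex y by blast
    then show "y \<in> \<kappa> ` carrier (homology W 0)" using \<kappa>(2) mhomD(1)[OF hW] by (metis image_eqI)
  qed
  ultimately have bij: "bij_betw \<kappa> (carrier (homology W 0)) (carrier Y)"
    using mhomD(1)[OF \<kappa>(1)] by (auto simp: bij_betw_def)
  have \<phi>\<kappa>: "homology_map N 0 \<phi> T = h (\<kappa> T)" if T: "T \<in> carrier (homology W 0)" for T
  proof -
    obtain x where x: "x \<in> carrier Q" "T = hcls W 0 x" using T unfolding imW[symmetric] by auto
    then show ?thesis using homology_map_hcls[OF cW cN \<phi>, of x 0] \<kappa>(2) pq by (simp add: W0 \<phi>_def)
  qed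
  have "carrier (homology N 1) \<subseteq> homology_map N 1 \<phi> ` carrier (homology W 1)"
  proof
    fix S assume "S \<in> carrier (homology N 1)"
    then obtain z where z: "z \<in> cycles N 1" "S = hcls N 1 z" using hcls(2)[OF cN] by auto
    have zc: "z \<in> chains N 1" "bd N 1 z = \<zero>\<^bsub>ob N 0\<^esub>" using cyclesD[OF z(1)] by auto
    \<comment> \<open>Because the second component of \<open>d1\<close> is zero, every 1-cycle of
      \<open>N\<close> is already a 1-cycle of \<open>W\<close>; this is the source of surjectivity
      on H_1.\<close>
    have "d1 z = \<zero>\<^bsub>Q\<^esub>"
      by (rule inj[OF mhomD(1)[OF d1 zc(1)] lmodule_group(1)[OF LQ]])
        (simp_all add: pd1[OF zc(1)] zc(2) mhom_zero[OF p LQ DN(1)] mhom_zero[OF q LQ LY])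
    then have zW: "z \<in> cycles W 1" using zc(1) by (simp add: cycles_def W0 Wi)
    have "homology_map N 1 \<phi> (hcls W 1 z) = S"
      using homology_map_hcls[OF cW cN \<phi> cyclesD(1)[OF zW]] z(2) by (simp add: \<phi>_def)
    then show "S \<in> homology_map N 1 \<phi> ` carrier (homology W 1)" using hcls_in[OF cW zW] by blast
  qed
  with \<phi>\<kappa> show thesis by (intro that[OF bW \<phi> \<kappa>(1) bij] ballI)
qed

text \<open>That \<open>h\<close> has no section is spelled out because \<open>split_epi\<close>
  compares modules on one type, whereas \<open>Y\<close> will be the algebra, on \<open>'a\<close>,
  as well as an arbitrary test module on \<open>'m set\<close>. The second conclusion does not
  mention \<open>h\<close>: a single map without section yields it.\<close>

lemma AR_triangle_lift:
  fixes scale :: "'k::field \<Rightarrow> 'a::ring_1 \<Rightarrow> 'a" and \<iota> :: "'k list \<Rightarrow> 'm"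
    and N :: "('a, 'm) cplx" and Y :: "('a, 'y) module"
  assumes alg: "fd_algebra scale" and \<iota>: "inj \<iota>" and tri: "AR_triangle L M N u v w"
    and neg: "\<And>i. i < 0 \<Longrightarrow> zero_module (ob N i)"
    and Y: "fg_module Y" and h: "h \<in> mhom Y (homology N 0)"
    and ns: "\<not> (\<exists>s\<in>mhom (homology N 0) Y. \<forall>S\<in>carrier (homology N 0). h (s S) = S)"
  shows "\<exists>k\<in>mhom Y (homology M 0). \<forall>y\<in>carrier Y. Dhomology_map 0 v (k y) = h y"
    and "Dhomology_map 1 v ` carrier (homology M 1) = carrier (homology N 1)"
proof -
  have v: "v \<in> DHom M N" using tri by (auto simp: AR_triangle_def distinguished_triangle_def)
  note N = DHom_bounded(2)[OF v]
  obtain W :: "('a, 'm) cplx" and \<phi> \<kappa> where W: "bounded_complex W" and \<phi>: "chain_map W N \<phi>"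
    and \<kappa>: "\<kappa> \<in> mhom (homology W 0) Y" "bij_betw \<kappa> (carrier (homology W 0)) (carrier Y)"
    and \<phi>\<kappa>: "\<forall>T\<in>carrier (homology W 0). homology_map N 0 \<phi> T = h (\<kappa> T)"
    and sur: "carrier (homology N 1) \<subseteq> homology_map N 1 \<phi> ` carrier (homology W 1)"
    by (rule complex_over[OF alg \<iota> N neg Y h])
  note f = DQ_DHom[OF W N \<phi>]
  have "\<not> Dsplit_epi W N (DQ W N \<phi>)"
  proof
    assume "Dsplit_epi W N (DQ W N \<phi>)"
    then obtain \<beta> where \<beta>: "\<beta> \<in> DHom N W" "Dcomp (DQ W N \<phi>) \<beta> = Did N" by (auto simp: Dsplit_epi_def)
    note m = Dhomology_map_mhom[OF \<beta>(1), of 0]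
    \<comment> \<open>On homology a section \<beta> of W \<rightarrow> N becomes a section of the
      induced map, and following it by \<kappa> gives the excluded section of
      \<open>h\<close>.\<close>
    have "\<forall>S\<in>carrier (homology N 0). h (\<kappa> (Dhomology_map 0 \<beta> S)) = S"
    proof
      fix S assume S: "S \<in> carrier (homology N 0)"
      show "h (\<kappa> (Dhomology_map 0 \<beta> S)) = S"
        using Dcomp_eq_DHom[OF \<beta>(1) f(1) Did_DHom(1)[OF N] \<beta>(2) S] Did_DHom(2)[OF N S]
          f(2)[OF mhomD(1)[OF m S]] \<phi>\<kappa> mhomD(1)[OF m S] by simp
    qed
    from bexI[where P = "\<lambda>s. \<forall>S\<in>carrier (homology N 0). h (s S) = S", OF this mhom_comp[OF m \<kappa>(1)]]
    show False using ns by simp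
  qed
  then obtain f' where f': "f' \<in> DHom W M" "Dcomp v f' = DQ W N \<phi>"
    using tri W f(1) unfolding AR_triangle_def by blast
  have vf: "Dhomology_map i v (Dhomology_map i f' T) = homology_map N i \<phi> T" if "T \<in> carrier (homology W i)" for T i
    using Dcomp_eq_DHom[OF f'(1) v f(1) f'(2) that] f(2)[OF that] by simp
  let ?\<kappa>' = "the_inv_into (carrier (homology W 0)) \<kappa>"
  have \<kappa>': "?\<kappa>' \<in> mhom Y (homology W 0)"
    by (rule mhom_inv[OF lmodule_homology[OF bounded_complexD(1)[OF W]] \<kappa>])
  show "\<exists>k\<in>mhom Y (homology M 0). \<forall>y\<in>carrier Y. Dhomology_map 0 v (k y) = h y"
  proof (intro bexI ballI)
    show "(\<lambda>y. Dhomology_map 0 f' (?\<kappa>' y)) \<in> mhom Y (homology M 0)"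
      by (rule mhom_comp[OF \<kappa>' Dhomology_map_mhom[OF f'(1)]])
    show "Dhomology_map 0 v (Dhomology_map 0 f' (?\<kappa>' y)) = h y" if y: "y \<in> carrier Y" for y
      using vf[OF mhomD(1)[OF \<kappa>' y]] \<phi>\<kappa> mhomD(1)[OF \<kappa>' y] f_the_inv_into_f_bij_betw[OF \<kappa>(2) y] by simp
  qed
  show "Dhomology_map 1 v ` carrier (homology M 1) = carrier (homology N 1)"
  proof
    show "Dhomology_map 1 v ` carrier (homology M 1) \<subseteq> carrier (homology N 1)"
      using mhomD(1)[OF Dhomology_map_mhom[OF v]] by auto
    show "carrier (homology N 1) \<subseteq> Dhomology_map 1 v ` carrier (homology M 1)"
    proof
      fix S assume "S \<in> carrier (homology N 1)"
      then obtain T where T: "T \<in> carrier (homology W 1)" "S = homology_map N 1 \<phi> T" using sur by blast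
      then have "S = Dhomology_map 1 v (Dhomology_map 1 f' T)" using vf by simp
      then show "S \<in> Dhomology_map 1 v ` carrier (homology M 1)"
        using mhomD(1)[OF Dhomology_map_mhom[OF f'(1)] T(1)] by blast
    qed
  qed
qed

section \<open>The algebra as a module over itself, and projectivity\<close>

definition regular_module :: "('a::ring_1, 'a) module" where
  "regular_module = \<lparr>carrier = UNIV, mult = undefined, one = undefined, zero = 0, add = (+), smult = (*)\<rparr>"

lemma regular_module_simps [simp]:
  "carrier regular_module = UNIV" "\<zero>\<^bsub>regular_module\<^esub> = 0"
  "a \<oplus>\<^bsub>regular_module\<^esub> b = a + b" "a \<odot>\<^bsub>regular_module\<^esub> b = a * b"
  by (simp_all add: regular_module_def)

lemma fg_regular_module: "fg_module (regular_module :: ('a::ring_1, 'a) module)"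
proof -
  have L: "lmodule (regular_module :: ('a, 'a) module)"
    by (rule lmoduleI) (simp_all add: algebra_simps)
  have "x \<in> mspan (regular_module :: ('a, 'a) module) {1}" for x
    using lsubmoduleD(5)[OF lsubmodule_mspan[OF L], of "{1}" 1 x] mspan_superset[of "{1}" "regular_module :: ('a, 'a) module"]
    by simp
  then show ?thesis using L by (auto simp: fg_module_iff intro!: exI[of _ "{1}"])
qed

lemma mhom_regular:
  assumes "lmodule M" "x \<in> carrier M" shows "(\<lambda>a. a \<odot>\<^bsub>M\<^esub> x) \<in> mhom regular_module M"
  using assms by (intro mhomI) (simp_all add: lmoduleD)

text \<open>The map a \<mapsto> a x from the algebra onto \<open>H\<close> has the section
  \<open>s\<close>, so \<open>H\<close> is a summand of a free module of rank one. The proof carries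
  this over to \<open>X\<close>, on whose own type projectivity is tested.\<close>

lemma projective_if_retract_of_regular:
  fixes X :: "('a::ring_1, 'm) module" and H :: "('a, 'n) module"
  assumes X: "lmodule X" and H: "lmodule H" and iso: "module_iso H X" and x: "x \<in> carrier H"
    and s: "s \<in> mhom H regular_module" "\<And>y. y \<in> carrier H \<Longrightarrow> s y \<odot>\<^bsub>H\<^esub> x = y"
  shows "projective_module X"
proof -
  obtain f where f: "f \<in> mhom H X" "bij_betw f (carrier H) (carrier X)" using iso by (auto simp: module_iso_def)
  let ?f' = "the_inv_into (carrier H) f"
  have f': "?f' \<in> mhom X H" by (rule mhom_inv[OF H f])
  have sf: "(\<lambda>y. s (?f' y)) \<in> mhom X regular_module" by (rule mhom_comp[OF f' s(1)])
  have gen: "s (?f' y) \<odot>\<^bsub>X\<^esub> f x = y" if y: "y \<in> carrier X" for y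
    using mhomD(3)[OF f(1) x, of "s (?f' y)"] s(2)[OF mhomD(1)[OF f' y]] f_the_inv_into_f_bij_betw[OF f(2) y] by simp
  show ?thesis
    unfolding projective_module_def
  proof (intro conjI X allI impI; elim conjE)
    fix A B :: "('a, 'm) module" and g p
    assume A: "lmodule A" and B: "lmodule B" and g: "g \<in> mhom A B" "g ` carrier A = carrier B" and p: "p \<in> mhom X B"
    note fx = mhomD(1)[OF f(1) x]
    have "p (f x) \<in> g ` carrier A" unfolding g(2) by (rule mhomD(1)[OF p fx])
    then obtain a where a: "a \<in> carrier A" "g a = p (f x)" by auto
    \<comment> \<open>Only the generator f x has to be lifted: with g a = p (f x), multiplying
      \<open>a\<close> by the coefficient that \<open>s\<close> assigns to an element lifts
      \<open>p\<close> on that element.\<close>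
    show "\<exists>h\<in>mhom X A. \<forall>y\<in>carrier X. g (h y) = p y"
    proof (intro bexI ballI)
      show "(\<lambda>y. s (?f' y) \<odot>\<^bsub>A\<^esub> a) \<in> mhom X A" by (rule mhom_comp[OF sf mhom_regular[OF A a(1)]])
      show "g (s (?f' y) \<odot>\<^bsub>A\<^esub> a) = p y" if "y \<in> carrier X" for y
        using mhomD(3)[OF g(1) a(1)] a(2) mhomD(3)[OF p fx, of "s (?f' y)"] gen[OF that] by simp
    qed
  qed
qed

theorem proposition5p2:
  fixes scale :: "'k::field \<Rightarrow> 'a::ring_1 \<Rightarrow> 'a"
    and L M N :: "('a, 'm) cplx"
    and u v w :: "('a, 'm) roof set"
    and X :: "('a, 'm) module"
  assumes algebra: "fd_algebra scale"
    and universe: "\<exists>\<iota> :: 'k list \<Rightarrow> 'm. inj \<iota>"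
    and triangle: "AR_triangle L M N u v w"
    and X: "fg_module X" "\<not> projective_module X"
    and N: "truncated_projective_resolution N X"
  shows "short_exact (homology L 0) (Dhomology_map 0 u) (homology M 0) (Dhomology_map 0 v) (homology N 0) \<and>
    (split_exact (homology L 0) (Dhomology_map 0 u) (homology M 0) (Dhomology_map 0 v) (homology N 0) \<or>
     sum_of_split_and_AR (homology L 0) (Dhomology_map 0 u) (homology M 0) (Dhomology_map 0 v) (homology N 0))"
proof -
  obtain \<iota> :: "'k list \<Rightarrow> 'm" where \<iota>: "inj \<iota>" using universe by blast
  have dt: "distinguished_triangle L M N u v w" using triangle by (simp add: AR_triangle_def)
  then have u: "u \<in> DHom L M" and v: "v \<in> DHom M N" by (auto simp: distinguished_triangle_def)
  note bL = DHom_bounded(1)[OF u] and bM = DHom_bounded(2)[OF u] and bN = DHom_bounded(2)[OF v]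
  note fg = fg_homology[OF algebra]
  have neg: "zero_module (ob N i)" if "i < 0" for i
    using N that unfolding truncated_projective_resolution_def by blast
  have iso: "module_iso (homology N 0) X" using N by (simp add: truncated_projective_resolution_def)
  note LN = lmodule_homology[OF bounded_complexD(1)[OF bN], of 0]
  have ns: "\<not> (\<exists>s\<in>mhom (homology N 0) regular_module. \<forall>T\<in>carrier (homology N 0). s T \<odot>\<^bsub>homology N 0\<^esub> S = T)"
    if "S \<in> carrier (homology N 0)" for S
    using projective_if_retract_of_regular[OF fg_lmodule[OF X(1)] LN iso that] X(2) by blast
  note lift = AR_triangle_lift[OF algebra \<iota> triangle neg]
  \<comment> \<open>Any map without section serves here; the zero map a \<mapsto> a 0 is taken. A
    section of it would again make \<open>X\<close> projective.\<close>
  have surj1: "Dhomology_map 1 v ` carrier (homology M 1) = carrier (homology N 1)"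
    using lift(2)[OF _ fg_regular_module mhom_regular[OF LN lmodule_group(1)[OF LN]] ns[OF lmodule_group(1)[OF LN]]] .
  have surj0: "Dhomology_map 0 v ` carrier (homology M 0) = carrier (homology N 0)"
  proof
    show "Dhomology_map 0 v ` carrier (homology M 0) \<subseteq> carrier (homology N 0)"
      using mhomD(1)[OF Dhomology_map_mhom[OF v]] by auto
    show "carrier (homology N 0) \<subseteq> Dhomology_map 0 v ` carrier (homology M 0)"
    proof
      fix S assume S: "S \<in> carrier (homology N 0)"
      \<comment> \<open>The class \<open>S\<close> is the value at 1 of a \<mapsto> a S, so a lift
        of this map, evaluated at 1, is a preimage.\<close>
      obtain k where k: "k \<in> mhom regular_module (homology M 0)" "\<forall>a. Dhomology_map 0 v (k a) = a \<odot>\<^bsub>homology N 0\<^esub> S"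
        using lift(1)[OF _ fg_regular_module mhom_regular[OF LN S] ns[OF S]] by auto
      then have "S = Dhomology_map 0 v (k 1)" using lmoduleD(3)[OF LN S] by simp
      then show "S \<in> Dhomology_map 0 v ` carrier (homology M 0)" using mhomD(1)[OF k(1)] by simp
    qed
  qed
  have ex: "short_exact (homology L 0) (Dhomology_map 0 u) (homology M 0) (Dhomology_map 0 v) (homology N 0)"
    using fg[OF bL] fg[OF bM] fg[OF bN] Dhomology_map_mhom[OF u] Dhomology_map_mhom[OF v] surj0
      triangle_homology_exact[OF algebra \<iota> dt, of 0] surj1
    by (simp add: short_exact_def)
  \<comment> \<open>The homology modules and their test modules live on \<open>'m set\<close>, so
    lists of scalars are embedded there, by way of singletons.\<close>
  have "inj (\<lambda>xs. {\<iota> xs})" using \<iota> by (auto simp: inj_on_def)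
  from split_or_sum_of_split_and_AR[OF algebra this ex]
  have "split_exact (homology L 0) (Dhomology_map 0 u) (homology M 0) (Dhomology_map 0 v) (homology N 0) \<or>
     sum_of_split_and_AR (homology L 0) (Dhomology_map 0 u) (homology M 0) (Dhomology_map 0 v) (homology N 0)"
    using lift(1) unfolding split_epi_def by blast
  with ex show ?thesis by simp
qed

end
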